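(* Let $G_1,\ldots,G_n$ be non-discrete, compactly generated, tdlc groups and let $\Gamma \leq G = G_1 \times \ldots \times G_n$ be a cocompact lattice such that $p_i \colon \Gamma \rightarrow G_i$ has dense image for every $i=1,\ldots,n$. (i) If $G_i$ is quasi just-non-compact for all $i$, then $$(\mathrm{Irr2}) \Rightarrow (\mathrm{Irr0}) \Leftrightarrow (\mathrm{Irr1}') \Leftrightarrow (\mathrm{Irr3}) \Leftarrow (\mathrm{Irr4}).$$ (ii) If $G_i$ is just-non-compact for all $i$, then $$(\mathrm{Irr0}) \Leftrightarrow (\mathrm{Irr1}') \Leftrightarrow (\mathrm{Irr2}) \Leftrightarrow (\mathrm{Irr3}) \Leftarrow (\mathrm{Irr4}).$$ (iii) If every finite index open subgroup of $G_i$ is just-non-compact for all $i$, then $$(\mathrm{Irr0}) \Leftrightarrow (\mathrm{Irr1}') \Leftrightarrow (\mathrm{Irr2}) \Leftrightarrow (\mathrm{Irr3}) \Leftrightarrow (\mathrm{Irr4}).$$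
   Context: "tdlc" means totally disconnected locally compact (Hausdorff topological group). A locally compact group is just-non-compact if it is non-compact and every closed normal subgroup is trivial or cocompact; it is quasi just-non-compact if it is non-compact and every closed normal subgroup is discrete or cocompact. For $\Sigma \subseteq \{1,\ldots,n\}$, $G_\Sigma = \prod_{j \in \Sigma} G_j$, identified with its natural image in $G$, and $p_\Sigma \colon G \to G_\Sigma$ is the projection; $p_i = p_{\{i\}}$. The conditions on $\Gamma$ are: (Irr0) For every partition $\Pi \cup \Sigma = \{1,\ldots,n\}$ with $\Pi, \Sigma \neq \varnothing$, the subgroup $(G_\Pi \cap \Gamma)(G_\Sigma \cap \Gamma)$ is of infinite index in $\Gamma$. (Irr1$'$) For every $\Sigma \subsetneq \{1,\ldots,n\}$, the closure of the image of $p_\Sigma \colon \Gamma \to G_\Sigma$ contains $\prod_{i \in \Sigma} G^+_i$, where each $G^+_i$ is some non-discrete closed cocompact normal subgroup of $G_i$. (Irr2) For every non-empty $\Sigma \subseteq \{1,\ldots,n\}$, the projection $p_\Sigma \colon \Gamma \to G_\Sigma$ is injective (equivalently, $p_i \colon \Gamma \to G_i$ is injective for every $i$). (Irr3) For every non-empty $\Sigma \subsetneq \{1,\ldots,n\}$, the projection $p_\Sigma \colon \Gamma \to G_\Sigma$ has a non-discrete image. (Irr4) If a subgroup $\Lambda \leq \Gamma$ is isomorphic to a direct product of two non-trivial groups, then the index $|\Gamma : \Lambda|$ is infinite. *)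

theory Defs
  imports "HOL-Analysis.Analysis" "HOL-Algebra.Product_Groups" "HOL-Algebra.Generated_Groups"
begin

section \<open>Topological groups\<close>

locale topological_group = group G for G (structure) +
  fixes T :: "'a topology"
  assumes topspace_eq_carrier: "topspace T = carrier G"
    and continuous_mult: "continuous_map (prod_topology T T) T (\<lambda>(x, y). x \<otimes> y)"
    and continuous_inv: "continuous_map T T (\<lambda>x. inv x)"

text \<open>Locally compact groups are Hausdorff by convention.\<close>

locale locally_compact_group = topological_group +
  assumes Hausdorff: "Hausdorff_space T"
    and locally_compact: "locally_compact_space T"

definition totally_disconnected_space :: "'a topology \<Rightarrow> bool" where
  "totally_disconnected_space X \<longleftrightarrow> (\<forall>S. connectedin X S \<longrightarrow> (\<exists>x. S \<subseteq> {x}))"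

locale tdlc_group = locally_compact_group +
  assumes totally_disconnected: "totally_disconnected_space T"

definition discretein :: "'a topology \<Rightarrow> 'a set \<Rightarrow> bool" where
  "discretein X S \<longleftrightarrow> subtopology X S = discrete_topology S"

definition compactly_generated :: "('a, 'b) monoid_scheme \<Rightarrow> 'a topology \<Rightarrow> bool" where
  "compactly_generated G T \<longleftrightarrow> (\<exists>K. compactin T K \<and> generate G K = carrier G)"


section \<open>Coset spaces, cocompact subgroups and lattices\<close>

text \<open>
  The set of cosets \<open>H #> x\<close> with the quotient topology. Inversion induces a homeomorphism onto the
  space of left cosets, which exchanges right and left translations.
\<close>

definition coset_space ::
    "('a, 'b) monoid_scheme \<Rightarrow> 'a topology \<Rightarrow> 'a set \<Rightarrow> 'a set topology" where
  "coset_space G T H =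
     topology (\<lambda>U. U \<subseteq> rcosets\<^bsub>G\<^esub> H \<and> openin T {x \<in> topspace T. H #>\<^bsub>G\<^esub> x \<in> U})"

lemma openin_coset_space:
  "openin (coset_space G T H) U \<longleftrightarrow>
     U \<subseteq> rcosets\<^bsub>G\<^esub> H \<and> openin T {x \<in> topspace T. H #>\<^bsub>G\<^esub> x \<in> U}"
proof -
  have *: "{x \<in> topspace T. H #>\<^bsub>G\<^esub> x \<in> A \<inter> B} =
      {x \<in> topspace T. H #>\<^bsub>G\<^esub> x \<in> A} \<inter> {x \<in> topspace T. H #>\<^bsub>G\<^esub> x \<in> B}" for A B
    by auto
  have **: "{x \<in> topspace T. H #>\<^bsub>G\<^esub> x \<in> \<Union>\<K>} =
      (\<Union>A\<in>\<K>. {x \<in> topspace T. H #>\<^bsub>G\<^esub> x \<in> A})" for \<K>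
    by auto
  have "istopology (\<lambda>U. U \<subseteq> rcosets\<^bsub>G\<^esub> H \<and> openin T {x \<in> topspace T. H #>\<^bsub>G\<^esub> x \<in> U})"
    unfolding istopology_def * ** by blast
  then show ?thesis
    by (simp add: coset_space_def)
qed

lemma (in topological_group) topspace_coset_space [simp]:
  "topspace (coset_space G T H) = rcosets H"
proof -
  have "{x \<in> topspace T. H #> x \<in> rcosets H} = topspace T"
    by (auto simp: RCOSETS_def topspace_eq_carrier)
  then have "openin (coset_space G T H) (rcosets H)"
    by (simp add: openin_coset_space)
  then show ?thesis
    using openin_coset_space[of G T H] openin_subset openin_topspace by (metis subset_antisym)
qed

lemma (in topological_group) quotient_map_coset_space:
  "quotient_map T (coset_space G T H) (\<lambda>x. H #> x)"
  by (auto simp: quotient_map_def openin_coset_space RCOSETS_def topspace_eq_carrier)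

definition cocompact :: "('a, 'b) monoid_scheme \<Rightarrow> 'a topology \<Rightarrow> 'a set \<Rightarrow> bool" where
  "cocompact G T H \<longleftrightarrow> compact_space (coset_space G T H)"

text \<open>A finite regular Borel measure on a topological space that need not be metrizable.\<close>

definition finite_radon_measure :: "'a topology \<Rightarrow> 'a measure \<Rightarrow> bool" where
  "finite_radon_measure X M \<longleftrightarrow>
     sets M = sets (sigma (topspace X) {U. openin X U}) \<and>
     finite_measure M \<and>
     (\<forall>A\<in>sets M. emeasure M A = (INF U\<in>{U. openin X U \<and> A \<subseteq> U}. emeasure M U)) \<and>
     (\<forall>U. openin X U \<longrightarrow> emeasure M U = (SUP K\<in>{K. compactin X K \<and> K \<subseteq> U}. emeasure M K))"

definition finite_covolume :: "('a, 'b) monoid_scheme \<Rightarrow> 'a topology \<Rightarrow> 'a set \<Rightarrow> bool" where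
  "finite_covolume G T H \<longleftrightarrow>
     (\<exists>M. finite_radon_measure (coset_space G T H) M \<and> emeasure M (space M) \<noteq> 0 \<and>
        (\<forall>g\<in>carrier G. \<forall>A\<in>sets M. emeasure M ((\<lambda>C. C #>\<^bsub>G\<^esub> g) ` A) = emeasure M A))"

definition lattice_subgroup :: "('a, 'b) monoid_scheme \<Rightarrow> 'a topology \<Rightarrow> 'a set \<Rightarrow> bool" where
  "lattice_subgroup G T H \<longleftrightarrow> subgroup H G \<and> discretein T H \<and> finite_covolume G T H"

definition cocompact_lattice :: "('a, 'b) monoid_scheme \<Rightarrow> 'a topology \<Rightarrow> 'a set \<Rightarrow> bool" where
  "cocompact_lattice G T H \<longleftrightarrow> lattice_subgroup G T H \<and> cocompact G T H"


section \<open>Just-non-compact groups\<close>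

definition just_non_compact :: "('a, 'b) monoid_scheme \<Rightarrow> 'a topology \<Rightarrow> bool" where
  "just_non_compact G T \<longleftrightarrow>
     locally_compact_group G T \<and> \<not> compact_space T \<and>
     (\<forall>N. N \<lhd> G \<and> closedin T N \<longrightarrow> N = {\<one>\<^bsub>G\<^esub>} \<or> cocompact G T N)"

definition quasi_just_non_compact :: "('a, 'b) monoid_scheme \<Rightarrow> 'a topology \<Rightarrow> bool" where
  "quasi_just_non_compact G T \<longleftrightarrow>
     locally_compact_group G T \<and> \<not> compact_space T \<and>
     (\<forall>N. N \<lhd> G \<and> closedin T N \<longrightarrow> discretein T N \<or> cocompact G T N)"

definition finite_index :: "('a, 'b) monoid_scheme \<Rightarrow> 'a set \<Rightarrow> bool" where
  "finite_index G H \<longleftrightarrow> finite (rcosets\<^bsub>G\<^esub> H)"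


section \<open>Irreducibility conditions for a subgroup of a product\<close>

text \<open>
  The ambient group is \<open>product_group {1..n} G\<close>, whose elements are extensional functions on
  \<open>{1..n}\<close>; the projection to the factors in \<open>S\<close> is \<open>\<lambda>x. restrict x S\<close>. The factors share an
  element type, which is no restriction: finitely many groups can be realised on disjoint subsets
  of one type.
\<close>

definition subproduct :: "nat \<Rightarrow> (nat \<Rightarrow> ('a, 'b) monoid_scheme) \<Rightarrow> nat set \<Rightarrow> (nat \<Rightarrow> 'a) set" where
  "subproduct n G S =
     {x \<in> carrier (product_group {1..n} G). \<forall>i\<in>{1..n} - S. x i = \<one>\<^bsub>G i\<^esub>}"

definition irr0 :: "nat \<Rightarrow> (nat \<Rightarrow> ('a, 'b) monoid_scheme) \<Rightarrow> (nat \<Rightarrow> 'a) set \<Rightarrow> bool" where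
  "irr0 n G \<Gamma> \<longleftrightarrow>
     (\<forall>P S. P \<union> S = {1..n} \<and> P \<inter> S = {} \<and> P \<noteq> {} \<and> S \<noteq> {} \<longrightarrow>
        \<not> finite_index (product_group {1..n} G\<lparr>carrier := \<Gamma>\<rparr>)
            ((subproduct n G P \<inter> \<Gamma>) <#>\<^bsub>product_group {1..n} G\<^esub> (subproduct n G S \<inter> \<Gamma>)))"

definition irr1' ::
    "nat \<Rightarrow> (nat \<Rightarrow> ('a, 'b) monoid_scheme) \<Rightarrow> (nat \<Rightarrow> 'a topology) \<Rightarrow> (nat \<Rightarrow> 'a) set \<Rightarrow> bool" where
  "irr1' n G T \<Gamma> \<longleftrightarrow>
     (\<forall>S. S \<subset> {1..n} \<longrightarrow>
        (\<exists>N. (\<forall>i\<in>S. N i \<lhd> G i \<and> closedin (T i) (N i) \<and> cocompact (G i) (T i) (N i) \<and>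
                 \<not> discretein (T i) (N i)) \<and>
             (\<Pi>\<^sub>E i\<in>S. N i) \<subseteq> product_topology T S closure_of ((\<lambda>x. restrict x S) ` \<Gamma>)))"

definition irr2 :: "nat \<Rightarrow> (nat \<Rightarrow> 'a) set \<Rightarrow> bool" where
  "irr2 n \<Gamma> \<longleftrightarrow> (\<forall>S. S \<subseteq> {1..n} \<and> S \<noteq> {} \<longrightarrow> inj_on (\<lambda>x. restrict x S) \<Gamma>)"

definition irr3 :: "nat \<Rightarrow> (nat \<Rightarrow> 'a topology) \<Rightarrow> (nat \<Rightarrow> 'a) set \<Rightarrow> bool" where
  "irr3 n T \<Gamma> \<longleftrightarrow>
     (\<forall>S. S \<subset> {1..n} \<and> S \<noteq> {} \<longrightarrow>
        \<not> discretein (product_topology T S) ((\<lambda>x. restrict x S) ` \<Gamma>))"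

text \<open>
  The two direct factors may be taken on the element type of the ambient group without loss of
  generality, because each of them embeds in \<open>\<Lambda>\<close>.
\<close>

definition irr4 :: "nat \<Rightarrow> (nat \<Rightarrow> ('a, 'b) monoid_scheme) \<Rightarrow> (nat \<Rightarrow> 'a) set \<Rightarrow> bool" where
  "irr4 n G \<Gamma> \<longleftrightarrow>
     (\<forall>\<Lambda>. subgroup \<Lambda> (product_group {1..n} G\<lparr>carrier := \<Gamma>\<rparr>) \<and>
          (\<exists>(A :: (nat \<Rightarrow> 'a) monoid) (B :: (nat \<Rightarrow> 'a) monoid).
             group A \<and> group B \<and> \<not> trivial_group A \<and> \<not> trivial_group B \<and>
             product_group {1..n} G\<lparr>carrier := \<Lambda>\<rparr> \<cong> A \<times>\<times> B) \<longrightarrow>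
        \<not> finite_index (product_group {1..n} G\<lparr>carrier := \<Gamma>\<rparr>) \<Lambda>)"

end

theory Submission
  imports Defs
begin

text \<open>
  Write \<open>H\<^sub>S\<close> for the closure of the projection of \<open>\<Gamma>\<close> to the factor \<open>G\<^sub>S\<close>. All conditions are compared
  with (Irr3).

  If a projection to \<open>G\<^sub>S\<close> is discrete, then \<open>\<Gamma>\<close> meets the complementary factor \<open>G\<^sub>P\<close> in a cocompact,
  hence finitely generated, subgroup; its centralizer in the projection of \<open>\<Gamma>\<close> to \<open>G\<^sub>P\<close> is open there.
  In a quasi just-non-compact group a non-discrete closed normal subgroup cannot commute with a
  cocompact subgroup, since otherwise the conjugates of a small compact open subgroup would
  intersect in a non-discrete compact normal subgroup. So the projection to \<open>G\<^sub>P\<close> is discrete as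
  well, and \<open>\<Gamma>\<close> is virtually a product.

  For (Irr1') it suffices that \<open>H\<^sub>S\<close> meets every factor \<open>G\<^sub>i\<close> with \<open>i \<in> S\<close> in a non-discrete group. In a
  minimal counterexample \<open>S\<close>, let \<open>H\<^sub>S \<inter> G\<^sub>i\<close> be discrete. If the intersection \<open>M\<close> of \<open>H\<^sub>S\<close> with the
  complementary factor is discrete too, then the two slices of \<open>H\<^sub>S\<close> over compact open subgroups of
  the two factors have small compact open normal subgroups, being compactly generated and locally
  residually discrete. As the slices generate \<open>H\<^sub>S\<close> up to a compact set, \<open>H\<^sub>S\<close> itself has a compact open
  normal subgroup, and its projections contradict quasi just-non-compactness. If \<open>M\<close> is not
  discrete, neither is its projection to some \<open>G\<^sub>j\<close>, and commutators of \<open>M\<close> with \<open>H\<^bsub>S - {i}\<^esub> \<inter> G\<^sub>j\<close> show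
  that \<open>H\<^sub>S \<inter> G\<^sub>j\<close> is cocompact in \<open>G\<^sub>j\<close>. Then \<open>H\<^bsub>S - {j}\<^esub> \<inter> G\<^sub>i\<close> maps to a profinite group with discrete kernel
  \<open>H\<^sub>S \<inter> G\<^sub>i\<close>, so that a directed family of non-discrete normal subgroups of \<open>G\<^sub>i\<close> has discrete
  intersection, which is impossible.

  In the just-non-compact case the same commutator argument makes every element of \<open>\<Gamma>\<close> with a trivial
  coordinate trivial, and a virtual direct decomposition of \<open>\<Gamma>\<close> would give two commuting cocompact
  normal subgroups of a finite index subgroup of \<open>G\<^sub>i\<close>.
\<close>

section \<open>Topological groups\<close>

text \<open>Most contradictions end with a compact normal subgroup of a quasi just-non-compact
  group: it is not cocompact, hence discrete. What has to be built each time is a compact invariant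
  subgroup that is still a neighbourhood of the identity in a given non-discrete group. The obstacle
  is that the acting group X is not compact, so that the conjugates of a compact open subgroup may
  have trivial intersection. \<open>normal_core\<close> isolates the remedy: X is written as a
  compact set times a set P. Conjugation by the compact part is uniformly controlled near the
  identity, and conjugation by P is controlled algebraically: P centralizes small elements, is
  trivial, is a normal subgroup, or is a product of two slices.

  The other source of uniformity is compact generation, which passes to closed cocompact subgroups.
  It gives one neighbourhood of the identity that commutes with all of a cocompact subgroup, and one
  member of a directed family whose trace on a compact open subgroup is normalized.

  No quotient groups are formed: cocompactness means a compact set of representatives.\<close>

context group begin

lemma inv_cancel_left [simp]:
  assumes "x \<in> carrier G" "y \<in> carrier G"
  shows "x \<otimes> (inv x \<otimes> y) = y" "inv x \<otimes> (x \<otimes> y) = y"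
  using assms by (simp_all flip: m_assoc)

definition normalizes :: "'a set \<Rightarrow> 'a set \<Rightarrow> bool" where
  "normalizes X A \<longleftrightarrow> (\<forall>x\<in>X. \<forall>a\<in>A. x \<otimes> a \<otimes> inv x \<in> A)"

lemma normalizesD: "normalizes X A \<Longrightarrow> x \<in> X \<Longrightarrow> a \<in> A \<Longrightarrow> x \<otimes> a \<otimes> inv x \<in> A"
  by (simp add: normalizes_def)

lemma normalizesD_inv:
  assumes "normalizes X A" "subgroup X G" "x \<in> X" "a \<in> A"
  shows "inv x \<otimes> a \<otimes> x \<in> A"
  using normalizesD[OF assms(1) subgroup.m_inv_closed[OF assms(2,3)] assms(4)]
    subgroup.mem_carrier[OF assms(2,3)] by simp

text \<open>The labels \<open>f\<close> need not belong to \<open>E\<close>. Choosing one element of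
  each class that meets \<open>E\<close> replaces a finite cover with centres elsewhere by coset
  representatives inside \<open>E\<close>.\<close>

lemma subgroup_finite_cover:
  assumes "subgroup H G" "finite F" "E \<subseteq> carrier G"
    and cover: "\<And>x. x \<in> E \<Longrightarrow> \<exists>f\<in>F. P f x"
    and diff: "\<And>f x y. f \<in> F \<Longrightarrow> P f x \<Longrightarrow> P f y \<Longrightarrow> x \<in> E \<Longrightarrow> y \<in> E \<Longrightarrow> x \<otimes> inv y \<in> H"
  obtains C where "finite C" "C \<subseteq> E" "\<And>x. x \<in> E \<Longrightarrow> \<exists>c\<in>C. x \<otimes> inv c \<in> H"
proof -
  define r where "r f = (SOME x. x \<in> E \<and> P f x)" for f
  define C where "C = r ` {f\<in>F. \<exists>x. x \<in> E \<and> P f x}"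
  have r: "r f \<in> E \<and> P f (r f)" if "\<exists>x. x \<in> E \<and> P f x" for f
    unfolding r_def by (rule someI_ex[OF that])
  show ?thesis
  proof
    show "finite C" using assms(2) by (simp add: C_def)
    show "C \<subseteq> E" using r by (auto simp: C_def)
    fix x assume x: "x \<in> E"
    then obtain f where f: "f \<in> F" "P f x" using cover by blast
    then have "r f \<in> C" "x \<otimes> inv (r f) \<in> H" using r[of f] x diff[of f x "r f"] by (auto simp: C_def)
    then show "\<exists>c\<in>C. x \<otimes> inv c \<in> H" by blast
  qed
qed

end

context topological_group begin

lemmas [simp] = topspace_eq_carrier

lemma continuous_map_mult [continuous_intros]:
  assumes "continuous_map X T f" "continuous_map X T g"
  shows "continuous_map X T (\<lambda>x. f x \<otimes> g x)"
  using continuous_map_compose[OF continuous_map_pairedI[OF assms] continuous_mult] by (simp add: o_def)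

lemma continuous_map_m_inv [continuous_intros]:
  assumes "continuous_map X T f"
  shows "continuous_map X T (\<lambda>x. inv (f x))"
  using continuous_map_compose[OF assms continuous_inv] by (simp add: o_def)

abbreviation cl :: "'a set \<Rightarrow> 'a set" where
  "cl \<equiv> Abstract_Topology.closure_of T"

lemma openin_preimage:
  assumes "continuous_map T T f" "openin T U"
  shows "openin T {x \<in> carrier G. f x \<in> U}"
  using openin_continuous_map_preimage[OF assms] by simp

lemma closedin_preimage:
  assumes "continuous_map T T f" "closedin T U"
  shows "closedin T {x \<in> carrier G. f x \<in> U}"
  using closedin_continuous_map_preimage[OF assms] by simp

lemma continuous_map_const_group [continuous_intros]:
  "a \<in> carrier G \<Longrightarrow> continuous_map X T (\<lambda>x. a)"
  by simp

lemma continuous_map_ident [continuous_intros]: "continuous_map T T (\<lambda>x. x)"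
  using continuous_map_id by (simp add: id_def)

lemma openin_subset_carrier: "openin T U \<Longrightarrow> U \<subseteq> carrier G"
  using openin_subset by force

lemma closedin_subset_carrier: "closedin T U \<Longrightarrow> U \<subseteq> carrier G"
  using closedin_subset by force

lemma compactin_subset_carrier: "compactin T U \<Longrightarrow> U \<subseteq> carrier G"
  using compactin_subset_topspace by force

lemma openin_l_translate:
  assumes "openin T U" "a \<in> carrier G"
  shows "openin T ((\<lambda>u. a \<otimes> u) ` U)"
proof -
  have "(\<lambda>u. a \<otimes> u) ` U = {x \<in> carrier G. inv a \<otimes> x \<in> U}"
    using assms openin_subset_carrier[OF assms(1)] by (force intro!: image_eqI)
  then show ?thesis
    using assms by (simp add: openin_preimage continuous_intros)
qed

lemma openin_r_translate:
  assumes "openin T U" "a \<in> carrier G"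
  shows "openin T ((\<lambda>u. u \<otimes> a) ` U)"
proof -
  have "(\<lambda>u. u \<otimes> a) ` U = {x \<in> carrier G. x \<otimes> inv a \<in> U}"
    using assms openin_subset_carrier[OF assms(1)] by (force intro!: image_eqI simp: m_assoc)
  then show ?thesis
    using assms by (simp add: openin_preimage continuous_intros)
qed

lemma compactin_mult:
  assumes "compactin T K" "compactin T L"
  shows "compactin T {k \<otimes> l |k l. k \<in> K \<and> l \<in> L}"
proof -
  have "compactin T ((\<lambda>(x, y). x \<otimes> y) ` (K \<times> L))"
    by (rule image_compactin[OF _ continuous_mult]) (simp add: assms compactin_Times)
  moreover have "(\<lambda>(x, y). x \<otimes> y) ` (K \<times> L) = {k \<otimes> l |k l. k \<in> K \<and> l \<in> L}" by auto
  ultimately show ?thesis by simp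
qed

lemma compactin_inv:
  "compactin T K \<Longrightarrow> compactin T ((\<lambda>x. inv x) ` K)"
  by (rule image_compactin[OF _ continuous_inv])

text \<open>The product is the image of the closed set of pairs (x, k) with x k^-1 in
  \<open>H\<close> under the projection along the compact set \<open>K\<close>, and that projection
  is a closed map.\<close>

lemma closedin_mult_compactin:
  assumes H: "closedin T H" and K: "compactin T K"
  shows "closedin T {h \<otimes> k |h k. h \<in> H \<and> k \<in> K}"
proof -
  let ?P = "prod_topology T (subtopology T K)"
  have KG: "K \<subseteq> carrier G" and HG: "H \<subseteq> carrier G"
    using K H compactin_subset_carrier closedin_subset_carrier by auto
  have 1: "continuous_map ?P T (\<lambda>p. fst p \<otimes> inv (snd p))"
    by (intro continuous_intros continuous_map_into_fulltopology[OF continuous_map_snd] continuous_map_fst)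
  have "closedin ?P {p \<in> topspace ?P. fst p \<otimes> inv (snd p) \<in> H}"
    by (rule closedin_continuous_map_preimage[OF 1 H])
  moreover have "closed_map ?P T fst"
    by (rule closed_map_fst) (simp add: K compact_space_subtopology)
  ultimately have "closedin T (fst ` {p \<in> topspace ?P. fst p \<otimes> inv (snd p) \<in> H})"
    by (simp add: closed_map_def)
  moreover have "fst ` {p \<in> topspace ?P. fst p \<otimes> inv (snd p) \<in> H} = {h \<otimes> k |h k. h \<in> H \<and> k \<in> K}"
  proof (intro equalityI subsetI)
    fix x assume "x \<in> fst ` {p \<in> topspace ?P. fst p \<otimes> inv (snd p) \<in> H}"
    then obtain k where "x \<in> carrier G" "k \<in> K" "x \<otimes> inv k \<in> H" using KG by auto
    then show "x \<in> {h \<otimes> k |h k. h \<in> H \<and> k \<in> K}"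
      using KG by (intro CollectI exI[of _ "x \<otimes> inv k"] exI[of _ k]) (auto simp: m_assoc subset_iff)
  next
    fix x assume "x \<in> {h \<otimes> k |h k. h \<in> H \<and> k \<in> K}"
    then obtain h k where "x = h \<otimes> k" "h \<in> H" "k \<in> K" by blast
    then show "x \<in> fst ` {p \<in> topspace ?P. fst p \<otimes> inv (snd p) \<in> H}"
      using KG HG by (intro image_eqI[of _ _ "(x, k)"]) (auto simp: m_assoc subset_iff)
  qed
  ultimately show ?thesis by simp
qed

text \<open>Wallace's theorem for the compact sets {1} and \<open>W\<close>: the neighbourhood
  \<open>V\<close> of the identity is uniform over \<open>W\<close>. It is applied to conjugation,
  commutators and translations with the second variable in a compact set.\<close>

lemma tube_at_one:
  assumes f: "continuous_map (prod_topology T T) T (\<lambda>p. f (fst p) (snd p))"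
    and W: "compactin T W" and U: "openin T U" and fU: "\<And>w. w \<in> W \<Longrightarrow> f \<one> w \<in> U"
  obtains V where "openin T V" "\<one> \<in> V" "\<And>g w. g \<in> V \<Longrightarrow> w \<in> W \<Longrightarrow> f g w \<in> U"
proof -
  have o: "openin (prod_topology T T) {p \<in> topspace (prod_topology T T). f (fst p) (snd p) \<in> U}" (is "openin _ ?A")
    by (rule openin_continuous_map_preimage[OF f U])
  have s: "{\<one>} \<times> W \<subseteq> ?A" using fU compactin_subset_carrier[OF W] by auto
  obtain A B where "openin T A" "openin T B" "{\<one>} \<subseteq> A" "W \<subseteq> B" and AB: "A \<times> B \<subseteq> ?A"
    by (rule Wallace_theorem_prod_topology[OF _ W o s]) auto
  have "f g w \<in> U" if "g \<in> A" "w \<in> W" for g w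
    using subsetD[OF AB, of "(g, w)"] that \<open>W \<subseteq> B\<close> by auto
  with that[of A] \<open>openin T A\<close> \<open>{\<one>} \<subseteq> A\<close> show ?thesis by blast
qed

lemma subgroup_openI:
  assumes H: "subgroup H G" and U: "openin T U" "\<one> \<in> U" "U \<subseteq> H"
  shows "openin T H"
proof (subst openin_subopen, intro ballI)
  fix x assume x: "x \<in> H"
  have "x \<in> carrier G" by (rule subgroup.mem_carrier[OF H x])
  moreover have "(\<lambda>u. x \<otimes> u) ` U \<subseteq> H" using subgroup.m_closed[OF H x] U(3) by auto
  ultimately show "\<exists>V. openin T V \<and> x \<in> V \<and> V \<subseteq> H"
    using U by (intro exI[of _ "(\<lambda>u. x \<otimes> u) ` U"]) (auto intro!: openin_l_translate image_eqI[of _ _ \<one>])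
qed

lemma open_subgroup_closedin:
  assumes H: "subgroup H G" and o: "openin T H"
  shows "closedin T H"
proof -
  have HG: "H \<subseteq> carrier G" using H subgroup.subset by blast
  have "openin T (carrier G - H)"
  proof (subst openin_subopen, intro ballI)
    fix x assume x: "x \<in> carrier G - H"
    have "x \<otimes> u \<notin> H" if "u \<in> H" for u
    proof
      assume "x \<otimes> u \<in> H"
      then have "(x \<otimes> u) \<otimes> inv u \<in> H" using that H by (simp add: subgroup.m_closed subgroup.m_inv_closed)
      then show False using x that HG by (auto simp: m_assoc)
    qed
    then show "\<exists>V. openin T V \<and> x \<in> V \<and> V \<subseteq> carrier G - H"
      using x o HG subgroup.one_closed[OF H]
      by (intro exI[of _ "(\<lambda>u. x \<otimes> u) ` H"]) (auto intro!: openin_l_translate image_eqI[of _ _ \<one>])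
  qed
  then show ?thesis using HG by (simp add: closedin_def)
qed

lemma closure_of_mult_subset:
  assumes f: "continuous_map (prod_topology T T) T (\<lambda>p. f (fst p) (snd p))"
    and sub: "\<And>a b. a \<in> A \<Longrightarrow> b \<in> B \<Longrightarrow> f a b \<in> C" and "a \<in> cl A" "b \<in> cl B"
  shows "f a b \<in> cl C"
proof -
  have "(\<lambda>p. f (fst p) (snd p)) ` (prod_topology T T closure_of (A \<times> B)) \<subseteq>
      cl ((\<lambda>p. f (fst p) (snd p)) ` (A \<times> B))"
    by (rule continuous_map_image_closure_subset[OF f])
  also have "\<dots> \<subseteq> cl C"
    by (rule closure_of_mono) (use sub in auto)
  finally show ?thesis using assms(3,4) by (force simp: closure_of_Times)
qed

lemma continuous_commutator:
  "continuous_map (prod_topology T T) T (\<lambda>p. fst p \<otimes> snd p \<otimes> inv (fst p) \<otimes> inv (snd p))"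
  by (intro continuous_intros continuous_map_fst continuous_map_snd)

lemma continuous_conjugation:
  "continuous_map (prod_topology T T) T (\<lambda>p. fst p \<otimes> snd p \<otimes> inv (fst p))"
  by (intro continuous_intros continuous_map_fst continuous_map_snd)

lemma closure_of_subset_carrier: "cl A \<subseteq> carrier G"
  using closure_of_subset_topspace[of T A] by simp

lemma closure_of_superset: "A \<subseteq> carrier G \<Longrightarrow> A \<subseteq> cl A"
  by (simp add: closure_of_subset)

lemma subgroup_closure_of:
  assumes H: "subgroup H G"
  shows "subgroup (cl H) G"
proof
  show "cl H \<subseteq> carrier G" by (rule closure_of_subset_carrier)
  have HG: "H \<subseteq> carrier G" using H subgroup.subset by blast
  show "\<one> \<in> cl H" using closure_of_superset[OF HG] subgroup.one_closed[OF H] by blast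
  fix x assume x: "x \<in> cl H"
  have "continuous_map (prod_topology T T) T (\<lambda>p. inv (snd p))"
    by (intro continuous_intros continuous_map_snd)
  from closure_of_mult_subset[OF this _ x x, of H] show "inv x \<in> cl H"
    by (simp add: H subgroup.m_inv_closed)
  fix y assume y: "y \<in> cl H"
  have "continuous_map (prod_topology T T) T (\<lambda>p. fst p \<otimes> snd p)"
    by (intro continuous_intros continuous_map_fst continuous_map_snd)
  from closure_of_mult_subset[OF this _ x y, of H] show "x \<otimes> y \<in> cl H"
    by (simp add: H subgroup.m_closed)
qed

lemma normalizes_closure_of:
  assumes "normalizes X A"
  shows "normalizes (cl X) (cl A)"
  unfolding normalizes_def
proof (intro ballI)
  fix x a assume "x \<in> cl X" "a \<in> cl A"
  then show "x \<otimes> a \<otimes> inv x \<in> cl A"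
    by (rule closure_of_mult_subset[OF continuous_conjugation, rotated]) (rule normalizesD[OF assms])
qed

lemma commutators_closure_of:
  assumes "\<And>f b. f \<in> F \<Longrightarrow> b \<in> B \<Longrightarrow> f \<otimes> b \<otimes> inv f \<otimes> inv b \<in> D" "closedin T D"
    and "f \<in> cl F" "b \<in> cl B"
  shows "f \<otimes> b \<otimes> inv f \<otimes> inv b \<in> D"
proof -
  have "f \<otimes> b \<otimes> inv f \<otimes> inv b \<in> cl D"
    using assms(3,4) by (rule closure_of_mult_subset[OF continuous_commutator, rotated]) (rule assms(1))
  then show ?thesis using assms(2) by (simp add: closure_of_closedin)
qed

end

section \<open>Relative discreteness and cocompactness\<close>

context topological_group begin

text \<open>Discreteness tested at the identity. For a subgroup it agrees with
  \<open>discretein\<close> (\<open>discr_iff_discretein\<close>); for a general set, such as one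
  containing commutators, it says only that the identity is not a limit of other points of the
  set.\<close>

definition discr :: "'a set \<Rightarrow> bool" where
  "discr A \<longleftrightarrow> (\<exists>U. openin T U \<and> \<one> \<in> U \<and> U \<inter> A \<subseteq> {\<one>})"

text \<open>A compact set of representatives replaces the coset space. This form passes to images
  under continuous homomorphisms (\<open>cocompact_in_pr\<close>) and to larger sets
  \<open>H\<close>, and it makes sense inside a subgroup \<open>X\<close> of the ambient
  group.\<close>

definition cocompact_in :: "'a set \<Rightarrow> 'a set \<Rightarrow> bool" where
  "cocompact_in H X \<longleftrightarrow> (\<exists>K. compactin T K \<and> K \<subseteq> X \<and> (\<forall>x\<in>X. \<exists>h\<in>H. \<exists>k\<in>K. x = h \<otimes> k))"

lemma cocompact_inE:
  assumes "cocompact_in H X"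
  obtains K where "compactin T K" "K \<subseteq> X" "\<And>x. x \<in> X \<Longrightarrow> \<exists>h\<in>H. \<exists>k\<in>K. x = h \<otimes> k"
  using assms by (auto simp: cocompact_in_def)

lemma discr_subset: "discr B \<Longrightarrow> A \<subseteq> B \<Longrightarrow> discr A"
  unfolding discr_def by blast

lemma discr_if_locally_contained:
  assumes "discr B" "openin T U" "\<one> \<in> U" "A \<inter> U \<subseteq> B"
  shows "discr A"
proof -
  obtain V where "openin T V" "\<one> \<in> V" "V \<inter> B \<subseteq> {\<one>}" using assms(1) by (auto simp: discr_def)
  then show ?thesis
    using assms unfolding discr_def by (intro exI[of _ "V \<inter> U"]) auto
qed

text \<open>\<open>V\<close> is the largest subset of \<open>W\<close> invariant under conjugation
  by \<open>X\<close>. For x = c p the conjugate x^-1 v x equals p^-1 (c^-1 v c) p. The tube lemma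
  gives a neighbourhood \<open>U\<close> with c^-1 U c inside \<open>Q\<close> for all c in the
  compact set \<open>C\<close>, and the hypothesis on \<open>Q\<close> takes care of p. So
  \<open>V\<close> still contains a neighbourhood of the identity in \<open>F\<close>.\<close>

lemma normal_core:
  assumes X: "subgroup X G" and C: "compactin T C" "C \<subseteq> X" and P: "P \<subseteq> X"
    and dec: "\<And>x. x \<in> X \<Longrightarrow> \<exists>c\<in>C. \<exists>p\<in>P. x = c \<otimes> p"
    and W: "subgroup W G" "closedin T W" and F: "normalizes X F" "F \<subseteq> carrier G"
    and Q: "openin T Q" "\<one> \<in> Q" "\<And>p q. p \<in> P \<Longrightarrow> q \<in> F \<inter> Q \<Longrightarrow> inv p \<otimes> q \<otimes> p \<in> W"
  obtains V U where "subgroup V G" "V \<subseteq> W" "normalizes X V" "closedin T V"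
    "openin T U" "\<one> \<in> U" "F \<inter> U \<subseteq> V" "\<forall>A. A \<subseteq> W \<and> normalizes X A \<longrightarrow> A \<subseteq> V"
proof -
  have XG: "X \<subseteq> carrier G" and WG: "W \<subseteq> carrier G" using X W(1) subgroup.subset by blast+
  define V where "V = {v \<in> carrier G. \<forall>x\<in>X. inv x \<otimes> v \<otimes> x \<in> W}"
  have "continuous_map (prod_topology T T) T (\<lambda>p. inv (snd p) \<otimes> fst p \<otimes> snd p)"
    by (intro continuous_intros continuous_map_fst continuous_map_snd)
  then obtain U where U: "openin T U" "\<one> \<in> U" "\<And>g w. g \<in> U \<Longrightarrow> w \<in> C \<Longrightarrow> inv w \<otimes> g \<otimes> w \<in> Q"
    by (rule tube_at_one[OF _ C(1) Q(1)]) (use C XG Q(2) in \<open>auto simp: subset_iff\<close>)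
  show ?thesis
  proof (rule that[of V U])
    show "V \<subseteq> W" using subgroup.one_closed[OF X] by (force simp: V_def)
    show "subgroup V G"
    proof
      show "V \<subseteq> carrier G" by (auto simp: V_def)
      show "\<one> \<in> V" using XG subgroup.one_closed[OF W(1)] by (auto simp: V_def subset_iff)
      fix a assume a: "a \<in> V"
      show "inv a \<in> V"
      proof -
        have "inv x \<otimes> inv a \<otimes> x \<in> W" if "x \<in> X" for x
        proof -
          have "inv (inv x \<otimes> a \<otimes> x) \<in> W" using a that subgroup.m_inv_closed[OF W(1)] by (auto simp: V_def)
          then show ?thesis using a that XG by (auto simp: V_def inv_mult_group m_assoc subset_iff)
        qed
        then show ?thesis using a by (auto simp: V_def)
      qed
      fix b assume b: "b \<in> V"
      show "a \<otimes> b \<in> V"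
      proof -
        have "inv x \<otimes> (a \<otimes> b) \<otimes> x \<in> W" if "x \<in> X" for x
        proof -
          have "(inv x \<otimes> a \<otimes> x) \<otimes> (inv x \<otimes> b \<otimes> x) \<in> W"
            using a b that subgroup.m_closed[OF W(1)] by (auto simp: V_def)
          then show ?thesis using a b that XG by (auto simp: V_def m_assoc subset_iff)
        qed
        then show ?thesis using a b by (auto simp: V_def)
      qed
    qed
    show "normalizes X V"
      unfolding normalizes_def
    proof (intro ballI)
      fix x a assume x: "x \<in> X" and a: "a \<in> V"
      have "inv y \<otimes> (x \<otimes> a \<otimes> inv x) \<otimes> y \<in> W" if "y \<in> X" for y
      proof -
        have "inv x \<otimes> y \<in> X" using x that X by (simp add: subgroup.m_closed subgroup.m_inv_closed)
        then have "inv (inv x \<otimes> y) \<otimes> a \<otimes> (inv x \<otimes> y) \<in> W" using a by (auto simp: V_def)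
        then show ?thesis using a x that XG by (auto simp: V_def inv_mult_group m_assoc subset_iff)
      qed
      then show "x \<otimes> a \<otimes> inv x \<in> V" using a x XG by (auto simp: V_def)
    qed
    show "closedin T V"
    proof -
      have "V = (\<Inter>x\<in>X. {v \<in> carrier G. inv x \<otimes> v \<otimes> x \<in> W})"
        using subgroup.one_closed[OF X] by (auto simp: V_def)
      moreover have "closedin T {v \<in> carrier G. inv x \<otimes> v \<otimes> x \<in> W}" if "x \<in> X" for x
        using that XG W by (intro closedin_preimage continuous_intros) auto
      ultimately show ?thesis using subgroup.one_closed[OF X] by (auto intro!: closedin_Inter)
    qed
    show "F \<inter> U \<subseteq> V"
    proof
      fix v assume v: "v \<in> F \<inter> U"
      have "inv x \<otimes> v \<otimes> x \<in> W" if x: "x \<in> X" for x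
      proof -
        obtain c p where cp: "c \<in> C" "p \<in> P" "x = c \<otimes> p" using dec[OF x] by blast
        have "inv c \<otimes> v \<otimes> c \<in> F \<inter> Q"
          using normalizesD_inv[OF F(1) X, of c v] cp(1) C(2) v U(3) by auto
        from Q(3)[OF cp(2) this] show ?thesis
          using cp v F(2) C P XG by (auto simp: inv_mult_group m_assoc subset_iff)
      qed
      then show "v \<in> V" using v F by (auto simp: V_def)
    qed
    have "A \<subseteq> V" if "A \<subseteq> W" "normalizes X A" for A
      using normalizesD_inv[OF that(2) X] that(1) WG unfolding V_def by blast
    then show "\<forall>A. A \<subseteq> W \<and> normalizes X A \<longrightarrow> A \<subseteq> V" by blast
  qed (use U in auto)
qed

lemma generate_commute:
  assumes "C \<subseteq> carrier G" "f \<in> carrier G" "\<And>c. c \<in> C \<Longrightarrow> f \<otimes> c = c \<otimes> f" "b \<in> generate G C"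
  shows "f \<otimes> b = b \<otimes> f"
  using assms(4)
proof induction
  case one then show ?case using assms by simp
next
  case (incl h) then show ?case using assms by simp
next
  case (inv h)
  then have h: "h \<in> carrier G" "f \<otimes> h = h \<otimes> f" using assms by auto
  have "f \<otimes> inv h = inv h \<otimes> (h \<otimes> f) \<otimes> inv h" using h(1) assms(2) by (simp add: m_assoc)
  also have "\<dots> = inv h \<otimes> (f \<otimes> h) \<otimes> inv h" by (simp only: h(2))
  also have "\<dots> = inv h \<otimes> f" using h(1) assms(2) by (simp add: m_assoc)
  finally show ?case .
next
  case (eng h1 h2)
  then have h: "h1 \<in> carrier G" "h2 \<in> carrier G" using generate_in_carrier[OF assms(1)] by auto
  have "f \<otimes> (h1 \<otimes> h2) = (f \<otimes> h1) \<otimes> h2" using h assms(2) by (simp add: m_assoc)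
  also have "\<dots> = h1 \<otimes> (f \<otimes> h2)" unfolding eng.IH(1) using h assms(2) by (simp add: m_assoc)
  also have "\<dots> = h1 \<otimes> h2 \<otimes> f" unfolding eng.IH(2) using h assms(2) by (simp add: m_assoc)
  finally show ?case .
qed

text \<open>As f tends to the identity, its commutators with elements of the compact set
  \<open>C\<close> tend to the identity uniformly. Since they lie in \<open>D\<close>, which is
  discrete at the identity, they are eventually trivial; commuting with \<open>C\<close> then gives
  commuting with the group it generates.\<close>

lemma commuting_neighbourhood:
  assumes C: "compactin T C" and D: "discr D" and F: "F \<subseteq> carrier G"
    and comm: "\<And>f c. f \<in> F \<Longrightarrow> c \<in> C \<Longrightarrow> f \<otimes> c \<otimes> inv f \<otimes> inv c \<in> D"
  obtains U where "openin T U" "\<one> \<in> U" "\<And>f b. f \<in> F \<inter> U \<Longrightarrow> b \<in> generate G C \<Longrightarrow> f \<otimes> b = b \<otimes> f"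
proof -
  have CG: "C \<subseteq> carrier G" using C compactin_subset_carrier by blast
  obtain V where V: "openin T V" "\<one> \<in> V" "V \<inter> D \<subseteq> {\<one>}" using D by (auto simp: discr_def)
  obtain U where U: "openin T U" "\<one> \<in> U" "\<And>g w. g \<in> U \<Longrightarrow> w \<in> C \<Longrightarrow> g \<otimes> w \<otimes> inv g \<otimes> inv w \<in> V"
    by (rule tube_at_one[OF continuous_commutator C V(1)]) (use CG V in \<open>auto simp: subset_iff\<close>)
  have "f \<otimes> b = b \<otimes> f" if f: "f \<in> F \<inter> U" and b: "b \<in> generate G C" for f b
  proof (rule generate_commute[OF CG _ _ b])
    show fG: "f \<in> carrier G" using f F by auto
    fix c assume c: "c \<in> C"
    have "f \<otimes> c \<otimes> inv f \<otimes> inv c = \<one>" using U(3)[of f c] comm[of f c] V(3) f c by auto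
    then have "f \<otimes> c \<otimes> inv f \<otimes> inv c \<otimes> (c \<otimes> f) = \<one> \<otimes> (c \<otimes> f)" by simp
    then show "f \<otimes> c = c \<otimes> f" using c CG fG by (auto simp: m_assoc subset_iff)
  qed
  with U that show ?thesis by blast
qed

text \<open>A compact version of the Reidemeister-Schreier rewriting: each product k e of a
  representative and a generator or its inverse is b k' with b in \<open>B\<close> and k' a
  representative, and b = k e k'^-1 ranges over a compact set. Words in \<open>C\<close> are
  rewritten from left to right.\<close>

lemma compact_generation_cocompact:
  assumes C: "compactin T C" and X: "X = generate G C" and B: "subgroup B G" "closedin T B" "B \<subseteq> X"
    and cc: "cocompact_in B X"
  obtains C' where "compactin T C'" "B = generate G C'"
proof -
  have CG: "C \<subseteq> carrier G" using C compactin_subset_carrier by blast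
  have Xs: "subgroup X G" unfolding X by (rule generate_is_subgroup[OF CG])
  have XG: "X \<subseteq> carrier G" using Xs subgroup.subset by blast
  obtain K0 where K0: "compactin T K0" "K0 \<subseteq> X" "\<And>x. x \<in> X \<Longrightarrow> \<exists>h\<in>B. \<exists>k\<in>K0. x = h \<otimes> k"
    using cocompact_inE[OF cc] by blast
  \<comment> \<open>The identity is added as the representative from which the rewriting of a word
    starts.\<close>
  define K where "K = insert \<one> K0"
  have K: "compactin T K" "K \<subseteq> X" "\<one> \<in> K"
    using K0 subgroup.one_closed[OF Xs] compactin_Un[of T "{\<one>}" K0] by (auto simp: K_def)
  define E where "E = C \<union> (\<lambda>x. inv x) ` C"
  have E: "compactin T E" unfolding E_def by (intro compactin_Un C compactin_inv)
  define L where "L = {m \<otimes> k |m k. m \<in> {k \<otimes> e |k e. k \<in> K \<and> e \<in> E} \<and> k \<in> (\<lambda>x. inv x) ` K}"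
  have L: "compactin T L" unfolding L_def by (intro compactin_mult compactin_inv K E)
  \<comment> \<open>\<open>B \<inter> L\<close> contains the Schreier generators.
    \<open>B \<inter> K\<close> serves for the last representative of a word, which lies in
    \<open>B\<close> when the word does.\<close>
  define C' where "C' = (B \<inter> L) \<union> (B \<inter> K)"
  have C': "compactin T C'" unfolding C'_def
    by (intro compactin_Un closed_Int_compactin B L K)
  have C'B: "C' \<subseteq> B" by (auto simp: C'_def)
  have gB: "generate G C' \<subseteq> B" by (rule generate_subgroup_incl[OF C'B B(1)])
  have "B \<subseteq> carrier G" using B subgroup.subset by blast
  then have C'G: "C' \<subseteq> carrier G" using C'B by auto
  have EX: "E \<subseteq> X" unfolding E_def X by (auto intro: generate.incl generate.inv)
  have step: "\<exists>b\<in>generate G C'. \<exists>k'\<in>K. k \<otimes> e = b \<otimes> k'" if k: "k \<in> K" and e: "e \<in> E" for k e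
  proof -
    have keX: "k \<otimes> e \<in> X" using k e K EX subgroup.m_closed[OF Xs] by auto
    then obtain b k' where bk: "b \<in> B" "k' \<in> K" "k \<otimes> e = b \<otimes> k'" using K0(3)[OF keX] unfolding K_def by blast
    have "b = k \<otimes> e \<otimes> inv k'" using bk k e K EX XG \<open>B \<subseteq> carrier G\<close> by (auto simp: m_assoc subset_iff)
    moreover have "k \<otimes> e \<otimes> inv k' \<in> L" unfolding L_def using k e bk by blast
    ultimately have "b \<in> C'" using bk by (auto simp: C'_def)
    then have "b \<in> generate G C'" by (rule generate.incl)
    with bk(2,3) show ?thesis by (intro bexI)
  qed
  have main: "\<exists>b\<in>generate G C'. \<exists>k'\<in>K. k \<otimes> y = b \<otimes> k'" if y: "y \<in> generate G C" and k: "k \<in> K" for y k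
    using y k
  proof (induction arbitrary: k)
    case one
    then have "k \<otimes> \<one> = \<one> \<otimes> k" using K XG by auto
    then show ?case using one generate.one[of G C'] by (intro bexI)
  next
    case (incl h) then show ?case by (intro step) (auto simp: E_def)
  next
    case (inv h) then show ?case by (intro step) (auto simp: E_def)
  next
    case (eng h1 h2)
    obtain b1 k1 where 1: "b1 \<in> generate G C'" "k1 \<in> K" "k \<otimes> h1 = b1 \<otimes> k1" using eng.IH(1)[OF eng.prems] by (elim bexE)
    obtain b2 k2 where 2: "b2 \<in> generate G C'" "k2 \<in> K" "k1 \<otimes> h2 = b2 \<otimes> k2" using eng.IH(2)[OF 1(2)] by (elim bexE)
    have g: "h1 \<in> carrier G" "h2 \<in> carrier G" using eng.hyps generate_in_carrier[OF CG] by blast+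
    have g': "b1 \<in> carrier G" "b2 \<in> carrier G" using 1(1) 2(1) generate_in_carrier[OF C'G] by blast+
    have g'': "k \<in> carrier G" "k1 \<in> carrier G" "k2 \<in> carrier G" using 1(2) 2(2) eng.prems K(2) XG by blast+
    have "k \<otimes> (h1 \<otimes> h2) = (k \<otimes> h1) \<otimes> h2" using g g'' by (simp add: m_assoc)
    also have "\<dots> = b1 \<otimes> (k1 \<otimes> h2)" unfolding 1(3) using g g' g'' by (simp add: m_assoc)
    also have "\<dots> = (b1 \<otimes> b2) \<otimes> k2" unfolding 2(3) using g g' g'' by (simp add: m_assoc)
    finally show ?case using generate.eng[OF 1(1) 2(1)] 2(2) by (intro bexI)
  qed
  have "B \<subseteq> generate G C'"
  proof
    fix b assume b: "b \<in> B"
    obtain b' k where bk: "b' \<in> generate G C'" "k \<in> K" "\<one> \<otimes> b = b' \<otimes> k"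
      using main[of b \<one>] b B(3) K(3) X by (auto simp: subset_iff)
    have bG: "b \<in> carrier G" "b' \<in> carrier G" "k \<in> carrier G"
      using b bk \<open>B \<subseteq> carrier G\<close> K XG gB by auto
    have "k = inv b' \<otimes> b" using bk bG by simp
    then have "k \<in> B" using b bk gB subgroup.m_closed[OF B(1)] subgroup.m_inv_closed[OF B(1)] by auto
    then have "k \<in> generate G C'" using bk by (intro generate.incl) (auto simp: C'_def)
    then show "b \<in> generate G C'" using bk bG generate.eng[of b' G C' k] by simp
  qed
  with gB have "B = generate G C'" by blast
  with C' show ?thesis by (rule that)
qed

lemma compactin_directed_family:
  assumes Z: "compactin T Z" and ne: "\<N> \<noteq> {}" and cl: "\<And>N. N \<in> \<N> \<Longrightarrow> closedin T N"
    and dir: "\<And>M N. M \<in> \<N> \<Longrightarrow> N \<in> \<N> \<Longrightarrow> \<exists>L\<in>\<N>. L \<subseteq> M \<inter> N"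
    and disj: "Z \<inter> \<Inter>\<N> = {}"
  obtains N where "N \<in> \<N>" "Z \<inter> N = {}"
proof -
  obtain \<F> where \<F>: "finite \<F>" "\<F> \<subseteq> \<N>" "Z \<inter> \<Inter>\<F> = {}"
    using Z disj cl unfolding compactin_fip by meson
  have "\<exists>N\<in>\<N>. N \<subseteq> \<Inter>\<F>"
    using \<F>(1,2)
  proof induction
    case empty then show ?case using ne by auto
  next
    case (insert M \<F>)
    then obtain N where N: "N \<in> \<N>" "N \<subseteq> \<Inter>\<F>" by auto
    obtain L where "L \<in> \<N>" "L \<subseteq> M \<inter> N" using dir[OF _ N(1)] insert.prems by blast
    then show ?case using N by blast
  qed
  then obtain N where N: "N \<in> \<N>" "N \<subseteq> \<Inter>\<F>" by blast
  then have "Z \<inter> N = {}" using \<F>(3) by blast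
  with N(1) show ?thesis by (rule that)
qed

end

context locally_compact_group begin

lemma compactin_closedin: "compactin T K \<Longrightarrow> closedin T K"
  by (rule compactin_imp_closedin[OF Hausdorff])

end

section \<open>Compact open subgroups\<close>

context tdlc_group begin

definition compact_open_subgroup :: "'a set \<Rightarrow> bool" where
  "compact_open_subgroup U \<longleftrightarrow> subgroup U G \<and> openin T U \<and> compactin T U"

lemma compact_open_subgroupD:
  assumes "compact_open_subgroup U"
  shows "subgroup U G" "openin T U" "compactin T U" "closedin T U" "\<one> \<in> U" "U \<subseteq> carrier G"
  using assms compactin_closedin[of U] subgroup.one_closed[of U G] subgroup.subset[of U G]
  unfolding compact_open_subgroup_def by blast+

text \<open>The component of the identity is a point, so local compactness gives a compact open and
  closed neighbourhood \<open>V\<close> inside \<open>O'\<close>. Elements that preserve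
  \<open>V\<close> under left translation, together with their inverses, form a subgroup; it lies in
  \<open>V\<close> because \<open>V\<close> contains the identity, and it is open by the tube
  lemma.\<close>

lemma van_Dantzig:
  assumes O: "openin T O'" "\<one> \<in> O'"
  obtains U where "compact_open_subgroup U" "U \<subseteq> O'"
proof -
  have "\<one> \<in> topspace T" by simp
  then obtain U0 K where U0: "openin T U0" "compactin T K" "\<one> \<in> U0" "U0 \<subseteq> K"
    using locally_compact unfolding locally_compact_space_def by meson
  have "connectedin T (connected_component_of_set T \<one>)" by (rule connectedin_connected_component_of)
  then obtain z where z: "connected_component_of_set T \<one> \<subseteq> {z}"
    using totally_disconnected unfolding totally_disconnected_space_def by blast
  have "\<one> \<in> connected_component_of_set T \<one>" by (simp add: connected_component_of_refl)
  with z have "connected_component_of_set T \<one> = {\<one>}" by blast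
  moreover have "connected_component_of_set T \<one> \<in> connected_components_of T"
    by (simp add: connected_component_in_connected_components_of)
  ultimately have 1: "{\<one>} \<in> connected_components_of T" by simp
  have 2: "compactin T {\<one>}" "openin T (O' \<inter> U0)" "{\<one>} \<subseteq> O' \<inter> U0" using O U0 by auto
  obtain V V' where V: "openin T V" "openin T V'" "disjnt V V'" "V \<union> V' = topspace T" "{\<one>} \<subseteq> V" "V \<subseteq> O' \<inter> U0"
    by (rule wilder_locally_compact_component_thm[OF locally_compact Hausdorff 1 2])
  have "V = topspace T - V'" using V openin_subset by (auto simp: disjnt_def)
  then have "closedin T V" using closedin_diff[OF closedin_topspace V(2)] by simp
  then have "compactin T V" using U0 V closed_compactin[of T K V] by auto
  have VG: "V \<subseteq> carrier G" using openin_subset_carrier[OF V(1)] .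
  have "continuous_map (prod_topology T T) T (\<lambda>p. fst p \<otimes> snd p)"
    by (intro continuous_intros continuous_map_fst continuous_map_snd)
  then obtain A where A: "openin T A" "\<one> \<in> A" "\<And>g w. g \<in> A \<Longrightarrow> w \<in> V \<Longrightarrow> g \<otimes> w \<in> V"
    by (rule tube_at_one[OF _ \<open>compactin T V\<close> V(1)]) (use VG in auto)
  have "continuous_map (prod_topology T T) T (\<lambda>p. inv (fst p) \<otimes> snd p)"
    by (intro continuous_intros continuous_map_fst continuous_map_snd)
  then obtain B where B: "openin T B" "\<one> \<in> B" "\<And>g w. g \<in> B \<Longrightarrow> w \<in> V \<Longrightarrow> inv g \<otimes> w \<in> V"
    by (rule tube_at_one[OF _ \<open>compactin T V\<close> V(1)]) (use VG in auto)
  define H where "H = {x \<in> carrier G. \<forall>v\<in>V. x \<otimes> v \<in> V \<and> inv x \<otimes> v \<in> V}"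
  have H: "subgroup H G"
  proof
    show "H \<subseteq> carrier G" "\<one> \<in> H" using VG by (auto simp: H_def)
    fix x assume x: "x \<in> H"
    then show "inv x \<in> H" by (auto simp: H_def)
    fix y assume y: "y \<in> H"
    show "x \<otimes> y \<in> H" using x y VG by (auto simp: H_def m_assoc inv_mult_group subset_iff)
  qed
  have HV: "H \<subseteq> V" using V(5) by (force simp: H_def)
  have oH: "openin T H"
  proof (rule subgroup_openI[OF H])
    show "openin T (A \<inter> B)" using A B by auto
    show "A \<inter> B \<subseteq> H" using A(3) B(3) openin_subset_carrier[OF A(1)] by (auto simp: H_def)
  qed (use A B in auto)
  have "compactin T H"
    using closed_compactin[OF \<open>compactin T V\<close> HV open_subgroup_closedin[OF H oH]] .
  then show ?thesis using that[of H] H oH HV V(6) by (auto simp: compact_open_subgroup_def)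
qed

lemma discrE:
  assumes "discr D"
  obtains U where "compact_open_subgroup U" "U \<inter> D \<subseteq> {\<one>}"
proof -
  obtain O' where O: "openin T O'" "\<one> \<in> O'" "O' \<inter> D \<subseteq> {\<one>}" using assms by (auto simp: discr_def)
  obtain U where U: "compact_open_subgroup U" "U \<subseteq> O'" using van_Dantzig[OF O(1,2)] .
  show ?thesis by (rule that[OF U(1)]) (use U O in blast)
qed

text \<open>Two elements of \<open>D\<close> in the same coset x U differ by an element of
  \<open>U \<inter> D\<close>, so x U contains at most one point of \<open>D\<close>. For x outside
  \<open>D\<close> that point can be removed.\<close>

lemma discr_subgroup_closedin:
  assumes D: "subgroup D G" "discr D"
  shows "closedin T D"
proof -
  obtain U where U: "compact_open_subgroup U" "U \<inter> D \<subseteq> {\<one>}" using discrE[OF D(2)] .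
  note U' = compact_open_subgroupD[OF U(1)]
  have DG: "D \<subseteq> carrier G" using D subgroup.subset by blast
  have "openin T (carrier G - D)"
  proof (subst openin_subopen, intro ballI)
    fix x assume x: "x \<in> carrier G - D"
    let ?N = "(\<lambda>u. x \<otimes> u) ` U"
    have N: "openin T ?N" "x \<in> ?N" using x U' by (auto intro!: openin_l_translate image_eqI[of _ _ \<one>])
    show "\<exists>V. openin T V \<and> x \<in> V \<and> V \<subseteq> carrier G - D"
    proof (cases "?N \<inter> D = {}")
      case True
      then show ?thesis using N openin_subset_carrier[OF N(1)] by (intro exI[of _ ?N]) auto
    next
      case False
      then obtain u where u: "u \<in> U" "x \<otimes> u \<in> D" by auto
      have "d = x \<otimes> u" if d: "d \<in> ?N" "d \<in> D" for d
      proof -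
        obtain v where v: "v \<in> U" "d = x \<otimes> v" using d by auto
        have g: "u \<in> carrier G" "v \<in> carrier G" "x \<in> carrier G" using u v x U' by auto
        have "inv (x \<otimes> u) \<otimes> d = inv u \<otimes> v" using g v by (simp add: inv_mult_group m_assoc)
        moreover have "inv u \<otimes> v \<in> U" using u v U'(1) by (simp add: subgroup.m_closed subgroup.m_inv_closed)
        moreover have "inv (x \<otimes> u) \<otimes> d \<in> D" using u d D(1) by (simp add: subgroup.m_closed subgroup.m_inv_closed)
        ultimately have "inv u \<otimes> v = \<one>" using U(2) by auto
        then have "u \<otimes> (inv u \<otimes> v) = u" using g by simp
        then show ?thesis using g v by simp
      qed
      moreover have "closedin T {x \<otimes> u}"
        using u DG by (intro compactin_closedin) auto
      moreover have "x \<noteq> x \<otimes> u" using u x by auto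
      ultimately show ?thesis using N openin_subset_carrier[OF N(1)]
        by (intro exI[of _ "?N - {x \<otimes> u}"]) (auto intro: openin_diff)
    qed
  qed
  then show ?thesis using DG by (simp add: closedin_def)
qed

text \<open>The finitely many cosets of \<open>D\<close> other than \<open>D\<close> itself are
  closed and miss the identity, so near the identity \<open>E\<close> is contained in
  \<open>D\<close>.\<close>

lemma discr_finite_extension:
  assumes D: "subgroup D G" "discr D" and C: "finite C" "C \<subseteq> carrier G"
    and E: "E \<subseteq> carrier G" "\<And>x. x \<in> E \<Longrightarrow> \<exists>c\<in>C. x \<otimes> inv c \<in> D"
  shows "discr E"
proof -
  define B where "B = (\<Union>c\<in>C - D. {x \<in> carrier G. x \<otimes> inv c \<in> D})"
  have "closedin T {x \<in> carrier G. x \<otimes> inv c \<in> D}" if "c \<in> C" for c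
    using that C(2) by (intro closedin_preimage continuous_intros discr_subgroup_closedin D) auto
  then have B: "closedin T B" unfolding B_def using C(1) by (intro closedin_Union) auto
  have "c \<in> D" if "c \<in> C" "inv c \<in> D" for c
    using subgroup.m_inv_closed[OF D(1) that(2)] that(1) C(2) by auto
  then have oB: "\<one> \<notin> B" unfolding B_def using C(2) by auto
  show ?thesis
  proof (rule discr_if_locally_contained[OF D(2)])
    show "openin T (carrier G - B)" using B by (auto simp: closedin_def)
    show "\<one> \<in> carrier G - B" using oB by auto
    show "E \<inter> (carrier G - B) \<subseteq> D"
    proof
      fix x assume x: "x \<in> E \<inter> (carrier G - B)"
      obtain c where c: "c \<in> C" "x \<otimes> inv c \<in> D" using E(2)[of x] x by auto
      then have "c \<in> D" using x by (auto simp: B_def)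
      then have "x \<otimes> inv c \<otimes> c \<in> D" using subgroup.m_closed[OF D(1) c(2)] by blast
      then show "x \<in> D" using x c(1) C(2) by (auto simp: m_assoc subset_iff)
    qed
  qed
qed

lemma compact_finite_cosets:
  assumes K: "compactin T K" and U: "subgroup U G" "openin T U"
  obtains F where "finite F" "F \<subseteq> K" "\<And>k. k \<in> K \<Longrightarrow> \<exists>f\<in>F. k \<otimes> inv f \<in> U"
proof -
  have KG: "K \<subseteq> carrier G" using K compactin_subset_carrier by blast
  have UG: "U \<subseteq> carrier G" using U subgroup.subset by blast
  have "K \<subseteq> \<Union>((\<lambda>k. (\<lambda>u. u \<otimes> k) ` U) ` K)"
    using subgroup.one_closed[OF U(1)] KG by (force intro!: image_eqI[of _ _ \<one>])
  moreover have "\<forall>V\<in>(\<lambda>k. (\<lambda>u. u \<otimes> k) ` U) ` K. openin T V"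
    using KG U by (auto intro!: openin_r_translate)
  ultimately obtain \<F> where \<F>: "finite \<F>" "\<F> \<subseteq> (\<lambda>k. (\<lambda>u. u \<otimes> k) ` U) ` K" "K \<subseteq> \<Union>\<F>"
    using K unfolding compactin_def by meson
  obtain F where F: "F \<subseteq> K" "finite F" "\<F> = (\<lambda>k. (\<lambda>u. u \<otimes> k) ` U) ` F"
    using finite_subset_image[OF \<F>(1,2)] by blast
  have "\<exists>f\<in>F. k \<otimes> inv f \<in> U" if k: "k \<in> K" for k
  proof -
    obtain f u where f: "f \<in> F" "u \<in> U" "k = u \<otimes> f" using \<F>(3) k F(3) by auto
    then have "k \<otimes> inv f = u" using F(1) KG UG by (auto simp: m_assoc subset_iff)
    with f show ?thesis by (intro bexI[of _ f]) auto
  qed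
  with F(2,1) show ?thesis by (rule that)
qed

lemma finite_discr_Int_compact:
  assumes D: "subgroup D G" "discr D" and K: "compactin T K"
  shows "finite (D \<inter> K)"
proof -
  obtain U where U: "compact_open_subgroup U" "U \<inter> D \<subseteq> {\<one>}" using discrE[OF D(2)] .
  note U' = compact_open_subgroupD[OF U(1)]
  have KG: "K \<subseteq> carrier G" using K compactin_subset_carrier by blast
  obtain F where F: "finite F" "F \<subseteq> K" "\<And>k. k \<in> K \<Longrightarrow> \<exists>f\<in>F. k \<otimes> inv f \<in> U"
    using compact_finite_cosets[OF K U'(1,2)] by blast
  obtain C where C: "finite C" "C \<subseteq> D \<inter> K" "\<And>x. x \<in> D \<inter> K \<Longrightarrow> \<exists>c\<in>C. x \<otimes> inv c \<in> {\<one>}"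
  proof (rule subgroup_finite_cover[of "{\<one>}" F "D \<inter> K" "\<lambda>f x. x \<otimes> inv f \<in> U"])
    show "subgroup {\<one>} G" by (rule triv_subgroup)
    show "finite F" "D \<inter> K \<subseteq> carrier G" using F KG by auto
    show "\<exists>f\<in>F. x \<otimes> inv f \<in> U" if "x \<in> D \<inter> K" for x using F(3) that by blast
    fix f x y assume f: "f \<in> F" "x \<otimes> inv f \<in> U" "y \<otimes> inv f \<in> U" "x \<in> D \<inter> K" "y \<in> D \<inter> K"
    have g: "f \<in> carrier G" "x \<in> carrier G" "y \<in> carrier G" using f F(2) KG by auto
    have "x \<otimes> inv f \<otimes> inv (y \<otimes> inv f) \<in> U" using f U'(1) by (simp add: subgroup.m_closed subgroup.m_inv_closed)
    then have "x \<otimes> inv y \<in> U" using g by (simp add: inv_mult_group m_assoc)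
    moreover have "x \<otimes> inv y \<in> D" using f D(1) by (simp add: subgroup.m_closed subgroup.m_inv_closed)
    ultimately show "x \<otimes> inv y \<in> {\<one>}" using U(2) by auto
  qed (rule that)
  have "D \<inter> K \<subseteq> C"
  proof
    fix x assume x: "x \<in> D \<inter> K"
    then obtain c where c: "c \<in> C" "x \<otimes> inv c = \<one>" using C(3) by auto
    then have "x = c" using x C(2) KG inv_equality[of x "inv c"] by (auto simp: subset_iff)
    then show "x \<in> C" using c by simp
  qed
  then show ?thesis using C(1) finite_subset by blast
qed

text \<open>For x = h k in \<open>L \<inter> U\<close> the element h = x k^-1 lies in one of the
  finitely many cosets U f that cover the inverses of \<open>K\<close>. Dividing h by a
  representative c of its coset taken in \<open>H\<close> gives x = (h c^-1)(c k), with h c^-1 in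
  \<open>H \<inter> U\<close> and c k in a compact set.\<close>

lemma cocompact_in_Int_open:
  assumes H: "subgroup H G" "H \<subseteq> L" and L: "subgroup L G" "closedin T L"
    and cc: "cocompact_in H L" and U: "subgroup U G" "openin T U"
  shows "cocompact_in (H \<inter> U) (L \<inter> U)"
proof -
  have LG: "L \<subseteq> carrier G" using L subgroup.subset by blast
  obtain K where K: "compactin T K" "K \<subseteq> L" "\<And>x. x \<in> L \<Longrightarrow> \<exists>h\<in>H. \<exists>k\<in>K. x = h \<otimes> k"
    using cocompact_inE[OF cc] by blast
  obtain F where F: "finite F" "F \<subseteq> (\<lambda>x. inv x) ` K" "\<And>k. k \<in> (\<lambda>x. inv x) ` K \<Longrightarrow> \<exists>f\<in>F. k \<otimes> inv f \<in> U"
    using compact_finite_cosets[OF compactin_inv[OF K(1)] U] by blast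
  have FG: "F \<subseteq> carrier G" using F(2) K(2) LG by auto
  define E where "E = {h \<in> H. \<exists>f\<in>F. h \<otimes> inv f \<in> U}"
  obtain C where C: "finite C" "C \<subseteq> E" "\<And>x. x \<in> E \<Longrightarrow> \<exists>c\<in>C. x \<otimes> inv c \<in> H \<inter> U"
  proof (rule subgroup_finite_cover[of "H \<inter> U" F E "\<lambda>f x. x \<otimes> inv f \<in> U"])
    show "subgroup (H \<inter> U) G" by (rule subgroups_Inter_pair[OF H(1) U(1)])
    show "finite F" by fact
    show "E \<subseteq> carrier G" using H LG by (auto simp: E_def)
    show "\<exists>f\<in>F. x \<otimes> inv f \<in> U" if "x \<in> E" for x using that by (simp add: E_def)
    fix f x y assume f: "f \<in> F" "x \<otimes> inv f \<in> U" "y \<otimes> inv f \<in> U" "x \<in> E" "y \<in> E"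
    have g: "f \<in> carrier G" "x \<in> carrier G" "y \<in> carrier G" using f FG H(2) LG by (auto simp: E_def)
    have "x \<otimes> inv f \<otimes> inv (y \<otimes> inv f) \<in> U" using f U(1) by (simp add: subgroup.m_closed subgroup.m_inv_closed)
    then have "x \<otimes> inv y \<in> U" using g by (simp add: inv_mult_group m_assoc)
    moreover have "x \<otimes> inv y \<in> H" using f H(1) by (simp add: E_def subgroup.m_closed subgroup.m_inv_closed)
    ultimately show "x \<otimes> inv y \<in> H \<inter> U" by auto
  qed (rule that)
  have CG: "C \<subseteq> carrier G" using C(2) H LG by (auto simp: E_def)
  define K' where "K' = L \<inter> U \<inter> {c \<otimes> k |c k. c \<in> C \<and> k \<in> K}"
  show ?thesis
    unfolding cocompact_in_def
  proof (intro exI conjI ballI)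
    have "compactin T C" using C(1) CG by (simp add: finite_imp_compactin)
    then show "compactin T K'" unfolding K'_def
      by (intro closed_Int_compactin closedin_Int L open_subgroup_closedin U compactin_mult K)
    show "K' \<subseteq> L \<inter> U" by (auto simp: K'_def)
    fix x assume x: "x \<in> L \<inter> U"
    obtain h k where hk: "h \<in> H" "k \<in> K" "x = h \<otimes> k" using K(3)[of x] x by auto
    have g: "h \<in> carrier G" "k \<in> carrier G" "x \<in> carrier G" using hk x H(2) LG K(2) by auto
    obtain f where f: "f \<in> F" "inv k \<otimes> inv f \<in> U" using F(3)[of "inv k"] hk(2) by auto
    have fG: "f \<in> carrier G" using f FG by auto
    have "x \<otimes> (inv k \<otimes> inv f) \<in> U" using f x subgroup.m_closed[OF U(1)] by auto
    then have "h \<otimes> inv f \<in> U" using hk g fG by (simp add: m_assoc)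
    then obtain c where c: "c \<in> C" "h \<otimes> inv c \<in> H \<inter> U" using C(3)[of h] f(1) hk(1) by (auto simp: E_def)
    have cG: "c \<in> carrier G" using c CG by auto
    have "c \<otimes> k = inv (h \<otimes> inv c) \<otimes> x" using g cG hk by (simp add: inv_mult_group m_assoc)
    moreover have "inv (h \<otimes> inv c) \<otimes> x \<in> U"
      using c x subgroup.m_closed[OF U(1)] subgroup.m_inv_closed[OF U(1)] by auto
    moreover have "c \<otimes> k \<in> L"
      by (rule subgroup.m_closed[OF L(1)]) (use c(1) hk(2) C(2) H(2) K(2) in \<open>auto simp: E_def\<close>)
    ultimately have "c \<otimes> k \<in> L \<inter> U" by simp
    then have "c \<otimes> k \<in> K'" unfolding K'_def using c(1) hk(2) by blast
    moreover have "x = (h \<otimes> inv c) \<otimes> (c \<otimes> k)" using g cG hk by (simp add: m_assoc)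
    ultimately show "\<exists>h\<in>H \<inter> U. \<exists>k\<in>K'. x = h \<otimes> k" using c(2) by blast
  qed
qed

text \<open>
  Let \<open>s\<close> range over finitely many generators of \<open>X\<close> modulo \<open>U\<close>. The elements \<open>x\<close> such that exactly one
  of \<open>x\<close> and \<open>inv s \<otimes> x \<otimes> s\<close> lies in \<open>U\<close> form a compact set that misses \<open>\<Inter>\<N>\<close>, hence misses some member
  \<open>N\<close> of the directed family. Then \<open>s\<close> normalizes \<open>N \<inter> U\<close>.
\<close>

lemma residually_trivial_normalizes:
  assumes X: "subgroup X G" "X = generate G C" "compactin T C"
    and ne: "\<N> \<noteq> {}" and N: "\<And>N. N \<in> \<N> \<Longrightarrow> N \<subseteq> X \<and> closedin T N \<and> normalizes X N"
    and dir: "\<And>M N. M \<in> \<N> \<Longrightarrow> N \<in> \<N> \<Longrightarrow> \<exists>L\<in>\<N>. L \<subseteq> M \<inter> N"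
    and U: "compact_open_subgroup U" "\<Inter>\<N> \<inter> U \<subseteq> {\<one>}"
  obtains N where "N \<in> \<N>" "normalizes X (N \<inter> U)"
proof -
  note U' = compact_open_subgroupD[OF U(1)]
  have CG: "C \<subseteq> carrier G" using X(3) compactin_subset_carrier by blast
  have CX: "C \<subseteq> X" unfolding X(2) by (auto intro: generate.incl)
  have XG: "X \<subseteq> carrier G" using X subgroup.subset by blast
  obtain S where S: "finite S" "S \<subseteq> C" "\<And>k. k \<in> C \<Longrightarrow> \<exists>f\<in>S. k \<otimes> inv f \<in> U"
    using compact_finite_cosets[OF X(3) U'(1,2)] by blast
  define Z1 where "Z1 s = {x \<in> carrier G. inv s \<otimes> x \<otimes> s \<in> carrier G - U} \<inter> U" for s
  define Z2 where "Z2 s = (carrier G - U) \<inter> (\<lambda>x. s \<otimes> x \<otimes> inv s) ` U" for s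
  define Z where "Z = (\<Union>s\<in>S. Z1 s \<union> Z2 s)"
  have clU: "closedin T (carrier G - U)" using U'(2) by (simp add: openin_closedin_eq)
  have "compactin T (Z1 s \<union> Z2 s)" if "s \<in> S" for s
  proof (rule compactin_Un)
    have s: "s \<in> carrier G" using that S CG by auto
    show "compactin T (Z1 s)" unfolding Z1_def
      by (intro closed_Int_compactin closedin_preimage continuous_intros clU U' s inv_closed)
    have "continuous_map T T (\<lambda>x. s \<otimes> x \<otimes> inv s)" using s by (intro continuous_intros) auto
    then show "compactin T (Z2 s)" unfolding Z2_def
      by (intro closed_Int_compactin clU image_compactin[OF U'(3)])
  qed
  then have Z: "compactin T Z" unfolding Z_def using S(1) by (intro compactin_Union) auto
  have "Z \<inter> \<Inter>\<N> = {}"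
  proof (rule ccontr)
    assume "Z \<inter> \<Inter>\<N> \<noteq> {}"
    then obtain z s where z: "z \<in> \<Inter>\<N>" "s \<in> S" "z \<in> Z1 s \<union> Z2 s" unfolding Z_def by blast
    have s: "s \<in> X" "s \<in> carrier G" using z S CX CG by auto
    show False
    proof (cases "z \<in> Z1 s")
      case True
      then have "z = \<one>" using z(1) U(2) by (auto simp: Z1_def)
      then show False using True U'(5) s by (auto simp: Z1_def)
    next
      case False
      then obtain u where u: "u \<in> U" "z = s \<otimes> u \<otimes> inv s" "z \<notin> U" using z by (auto simp: Z2_def)
      have uG: "u \<in> carrier G" using u U' by auto
      have "inv s \<otimes> z \<otimes> s \<in> N" if "N \<in> \<N>" for N
        using normalizesD_inv[of X N s z] N[OF that] X(1) s z(1) that by blast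
      moreover have "inv s \<otimes> z \<otimes> s = u" using u uG s by (simp add: m_assoc)
      ultimately have "u = \<one>" using u(1) U(2) by auto
      then show False using u U'(5) s by auto
    qed
  qed
  then obtain N where N': "N \<in> \<N>" "Z \<inter> N = {}"
    using compactin_directed_family[OF Z ne _ dir] N by blast
  note NN = N[OF N'(1)]
  have nX: "normalizes X N" using NN by blast
  \<comment> \<open>The elements x such that both x and its inverse conjugate
    \<open>N \<inter> U\<close> into \<open>U\<close> form a group. It contains \<open>S\<close> and
    \<open>U \<inter> X\<close>, hence \<open>C\<close>, hence all of \<open>X\<close>.\<close>
  let ?M = "{x \<in> X. \<forall>y\<in>N \<inter> U. x \<otimes> y \<otimes> inv x \<in> U \<and> inv x \<otimes> y \<otimes> x \<in> U}"
  have MS: "s \<in> ?M" if "s \<in> S" for s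
  proof -
    have s: "s \<in> X" "s \<in> carrier G" using that S CX CG by auto
    have "s \<otimes> y \<otimes> inv s \<in> U \<and> inv s \<otimes> y \<otimes> s \<in> U" if y: "y \<in> N \<inter> U" for y
    proof
      have yG: "y \<in> carrier G" using y U' by auto
      have "s \<otimes> y \<otimes> inv s \<in> N" using normalizesD[OF nX s(1)] y by blast
      then have "s \<otimes> y \<otimes> inv s \<notin> Z2 s" using N'(2) \<open>s \<in> S\<close> unfolding Z_def by blast
      then show "s \<otimes> y \<otimes> inv s \<in> U" using y yG s by (auto simp: Z2_def)
      have "y \<notin> Z1 s" using y N'(2) \<open>s \<in> S\<close> unfolding Z_def by blast
      then show "inv s \<otimes> y \<otimes> s \<in> U" using y yG s by (auto simp: Z1_def)
    qed
    then show ?thesis using s by auto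
  qed
  have Minv: "inv x \<in> ?M" if "x \<in> ?M" for x
    using that XG subgroup.m_inv_closed[OF X(1)] by auto
  have Mmult: "x \<otimes> y \<in> ?M" if x: "x \<in> ?M" and y: "y \<in> ?M" for x y
  proof -
    have xy: "x \<in> X" "y \<in> X" "x \<in> carrier G" "y \<in> carrier G" using x y XG by auto
    have "(x \<otimes> y) \<otimes> v \<otimes> inv (x \<otimes> y) \<in> U \<and> inv (x \<otimes> y) \<otimes> v \<otimes> (x \<otimes> y) \<in> U" if v: "v \<in> N \<inter> U" for v
    proof -
      have vG: "v \<in> carrier G" using v U' by auto
      have "y \<otimes> v \<otimes> inv y \<in> N \<inter> U" using v y normalizesD[OF nX xy(2)] by auto
      then have "x \<otimes> (y \<otimes> v \<otimes> inv y) \<otimes> inv x \<in> U" using x by auto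
      moreover have "inv x \<otimes> v \<otimes> x \<in> N \<inter> U" using v x normalizesD_inv[OF nX X(1) xy(1)] by auto
      then have "inv y \<otimes> (inv x \<otimes> v \<otimes> x) \<otimes> y \<in> U" using y by auto
      ultimately show ?thesis using xy vG by (simp add: inv_mult_group m_assoc)
    qed
    then show ?thesis using xy subgroup.m_closed[OF X(1)] by auto
  qed
  have MU: "u \<in> ?M" if "u \<in> U" "u \<in> X" for u
    using that U'(1) by (auto simp: subgroup.m_closed subgroup.m_inv_closed)
  have MC: "c \<in> ?M" if c: "c \<in> C" for c
  proof -
    obtain s where s: "s \<in> S" "c \<otimes> inv s \<in> U" using S(3)[OF c] by blast
    have "c \<otimes> inv s \<in> X"
      by (intro subgroup.m_closed[OF X(1)] subgroup.m_inv_closed[OF X(1)]) (use c s S(2) CX in auto)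
    then have "c \<otimes> inv s \<otimes> s \<in> ?M" using Mmult[OF MU[OF s(2)] MS[OF s(1)]] by blast
    moreover have "c \<otimes> inv s \<otimes> s = c" using c s CG S(2) by (auto simp: m_assoc subset_iff)
    ultimately show ?thesis by simp
  qed
  have "x \<in> ?M" if "x \<in> generate G C" for x
    using that
  proof induction
    case one show ?case by (rule MU[OF U'(5) subgroup.one_closed[OF X(1)]])
  next
    case (incl h) then show ?case by (rule MC)
  next
    case (inv h) then show ?case by (rule Minv[OF MC])
  next
    case (eng h1 h2) then show ?case using Mmult by blast
  qed
  then have "normalizes X (N \<inter> U)"
    unfolding normalizes_def using X(2) normalizesD[OF nX] by auto
  with N'(1) show ?thesis by (rule that)
qed

end

section \<open>Quasi just-non-compact subgroups\<close>

context tdlc_group begin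

text \<open>The property for a subgroup of the ambient group, with normality and cocompactness taken
  relative to \<open>X\<close>. In this form it serves for the factors and for closures of projected
  finite index subgroups without changing the group.\<close>

definition qjnc :: "'a set \<Rightarrow> bool" where
  "qjnc X \<longleftrightarrow> subgroup X G \<and> closedin T X \<and> \<not> compactin T X \<and>
     (\<forall>N. subgroup N G \<and> N \<subseteq> X \<and> closedin T N \<and> normalizes X N \<longrightarrow> discr N \<or> cocompact_in N X)"

lemma compactin_if_cocompact_in:
  assumes "compactin T N" "cocompact_in N X" "closedin T X"
  shows "compactin T X"
proof -
  obtain K where K: "compactin T K" "K \<subseteq> X" "\<And>x. x \<in> X \<Longrightarrow> \<exists>h\<in>N. \<exists>k\<in>K. x = h \<otimes> k"
    using cocompact_inE[OF assms(2)] by blast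
  have "X \<subseteq> {n \<otimes> k |n k. n \<in> N \<and> k \<in> K}" using K(3) by blast
  with closed_compactin[OF compactin_mult[OF assms(1) K(1)] _ assms(3)] show ?thesis .
qed

lemma qjncD:
  assumes "qjnc X"
  shows "subgroup X G" "closedin T X" "\<not> compactin T X" "X \<subseteq> carrier G"
    "\<And>N. subgroup N G \<Longrightarrow> N \<subseteq> X \<Longrightarrow> closedin T N \<Longrightarrow> normalizes X N \<Longrightarrow> \<not> discr N \<Longrightarrow> cocompact_in N X"
  using assms subgroup.subset[of X G] unfolding qjnc_def by blast+

text \<open>A compact normal subgroup that is cocompact would make \<open>X\<close> a closed subset
  of a product of two compact sets, contrary to non-compactness.\<close>

lemma qjnc_compact_normal:
  assumes "qjnc X" "subgroup N G" "N \<subseteq> X" "compactin T N" "normalizes X N"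
  shows "discr N"
  using qjncD[OF assms(1)] compactin_closedin[OF assms(4)] compactin_if_cocompact_in[OF assms(4)] assms
  by blast

text \<open>Near the identity \<open>F\<close> is fixed by conjugation with \<open>B\<close>, and
  \<open>X\<close> is \<open>B\<close> up to a compact set. Hence the normal core of
  \<open>F \<inter> U\<close> is still a neighbourhood of the identity in \<open>F\<close>; being
  compact and normal in \<open>X\<close>, it is discrete, and so is \<open>F\<close>.\<close>

lemma qjnc_no_centralized_neighbourhood:
  assumes X: "qjnc X" and F: "subgroup F G" "F \<subseteq> X" "closedin T F" "normalizes X F" "\<not> discr F"
    and B: "B \<subseteq> X" "cocompact_in B X"
    and O: "openin T O'" "\<one> \<in> O'" "\<And>f b. f \<in> F \<inter> O' \<Longrightarrow> b \<in> B \<Longrightarrow> f \<otimes> b = b \<otimes> f"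
  shows False
proof -
  note X' = qjncD[OF X]
  obtain U where U: "compact_open_subgroup U" "U \<subseteq> O'" using van_Dantzig[OF O(1,2)] .
  note U' = compact_open_subgroupD[OF U(1)]
  obtain K where K: "compactin T K" "K \<subseteq> X" "\<And>x. x \<in> X \<Longrightarrow> \<exists>h\<in>B. \<exists>k\<in>K. x = h \<otimes> k"
    using cocompact_inE[OF B(2)] by blast
  \<comment> \<open>Cocompactness puts the compact factor last, whereas \<open>normal_core\<close>
    expects it first. Taking inverses exchanges the two.\<close>
  have inv_dec: "\<exists>c\<in>(\<lambda>x. inv x) ` K. \<exists>p\<in>(\<lambda>x. inv x) ` B. x = c \<otimes> p" if x: "x \<in> X" for x
  proof -
    obtain b k where bk: "b \<in> B" "k \<in> K" "inv x = b \<otimes> k" using K(3) subgroup.m_inv_closed[OF X'(1) x] by blast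
    have g: "b \<in> carrier G" "k \<in> carrier G" "x \<in> carrier G" using bk x B K X'(4) by auto
    have "x = inv (b \<otimes> k)" unfolding bk(3)[symmetric] using g by simp
    then have "x = inv k \<otimes> inv b" using g by (simp add: inv_mult_group)
    then show ?thesis using bk by blast
  qed
  have sW: "subgroup (F \<inter> U) G" by (rule subgroups_Inter_pair[OF F(1) U'(1)])
  have cW: "closedin T (F \<inter> U)" using F(3) U'(4) by (rule closedin_Int)
  have FG: "F \<subseteq> carrier G" using F(2) X'(4) by blast
  have Q: "inv p \<otimes> q \<otimes> p \<in> F \<inter> U" if p: "p \<in> (\<lambda>x. inv x) ` B" and q: "q \<in> F \<inter> U" for p q
  proof -
    obtain b where b: "b \<in> B" "p = inv b" using p by auto
    have g: "b \<in> carrier G" "q \<in> carrier G" using b q FG B X'(4) by auto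
    have "inv p \<otimes> q \<otimes> p = (b \<otimes> q) \<otimes> inv b" using b g by simp
    also have "\<dots> = (q \<otimes> b) \<otimes> inv b" using O(3)[of q b] q b(1) U(2) by auto
    also have "\<dots> = q" using g by (simp add: m_assoc)
    finally show ?thesis using q by simp
  qed
  obtain V N where V: "subgroup V G" "V \<subseteq> F \<inter> U" "normalizes X V" "closedin T V"
    "openin T N" "\<one> \<in> N" "F \<inter> N \<subseteq> V"
  proof (rule normal_core[OF X'(1) compactin_inv[OF K(1)] _ _ inv_dec sW cW F(4) FG U'(2,5) Q])
    show "(\<lambda>x. inv x) ` K \<subseteq> X" using K(2) subgroup.m_inv_closed[OF X'(1)] by auto
    show "(\<lambda>x. inv x) ` B \<subseteq> X" using B(1) subgroup.m_inv_closed[OF X'(1)] by auto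
  qed
  have "compactin T V" using closed_compactin[OF U'(3) _ V(4)] V(2) by auto
  then have "discr V" using qjnc_compact_normal[OF X V(1) _ _ V(3)] V(2) F(2) by auto
  then have "discr F" using discr_if_locally_contained[of V N F] V by auto
  then show False using F(5) by simp
qed

text \<open>The cocompact subgroup \<open>B\<close> is again compactly generated, so a neighbourhood
  of the identity in \<open>F\<close> commutes with all of \<open>B\<close> by
  \<open>commuting_neighbourhood\<close>, which \<open>qjnc_no_centralized_neighbourhood\<close>
  forbids.\<close>

lemma qjnc_no_discrete_commutators:
  assumes X: "qjnc X" "X = generate G C" "compactin T C"
    and F: "subgroup F G" "F \<subseteq> X" "closedin T F" "normalizes X F" "\<not> discr F"
    and B: "subgroup B G" "B \<subseteq> X" "closedin T B" "cocompact_in B X"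
    and D: "discr D" "\<And>f b. f \<in> F \<Longrightarrow> b \<in> B \<Longrightarrow> f \<otimes> b \<otimes> inv f \<otimes> inv b \<in> D"
  shows False
proof -
  obtain C' where C': "compactin T C'" "B = generate G C'"
    using compact_generation_cocompact[OF X(3,2) B(1,3,2,4)] .
  have "C' \<subseteq> B" unfolding C'(2) by (auto intro: generate.incl)
  moreover have FG: "F \<subseteq> carrier G" using F(1) subgroup.subset by blast
  ultimately obtain U where U: "openin T U" "\<one> \<in> U" "\<And>f b. f \<in> F \<inter> U \<Longrightarrow> b \<in> B \<Longrightarrow> f \<otimes> b = b \<otimes> f"
    using commuting_neighbourhood[OF C'(1) D(1) FG D(2)] C'(2) by (metis subsetD)
  show False
    by (rule qjnc_no_centralized_neighbourhood[OF X(1) F B(2,4) U])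
qed

text \<open>If the intersection were discrete, \<open>residually_trivial_normalizes\<close> would
  provide a member \<open>N\<close> and a compact open subgroup \<open>U\<close> such that
  \<open>N \<inter> U\<close> is normalized by \<open>X\<close>. This compact normal subgroup is
  discrete, and it is open in \<open>N\<close>.\<close>

lemma qjnc_directed_Inter:
  assumes X: "qjnc X" "X = generate G C" "compactin T C"
    and ne: "\<N> \<noteq> {}"
    and N: "\<And>N. N \<in> \<N> \<Longrightarrow> subgroup N G \<and> N \<subseteq> X \<and> closedin T N \<and> normalizes X N \<and> \<not> discr N"
    and dir: "\<And>M N. M \<in> \<N> \<Longrightarrow> N \<in> \<N> \<Longrightarrow> \<exists>L\<in>\<N>. L \<subseteq> M \<inter> N"
  shows "\<not> discr (\<Inter>\<N>)"
proof
  note X' = qjncD[OF X(1)]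
  assume "discr (\<Inter>\<N>)"
  then obtain U where U: "compact_open_subgroup U" "U \<inter> \<Inter>\<N> \<subseteq> {\<one>}" by (rule discrE)
  note U' = compact_open_subgroupD[OF U(1)]
  have N': "N \<subseteq> X \<and> closedin T N \<and> normalizes X N" if "N \<in> \<N>" for N using N[OF that] by simp
  have U2: "\<Inter>\<N> \<inter> U \<subseteq> {\<one>}" using U(2) by auto
  obtain N where NN: "N \<in> \<N>" "normalizes X (N \<inter> U)"
    by (rule residually_trivial_normalizes[OF X'(1) X(2,3) ne N' dir U(1) U2])
  note N2 = N[OF NN(1)]
  have "discr (N \<inter> U)"
  proof (rule qjnc_compact_normal[OF X(1) _ _ _ NN(2)])
    show "subgroup (N \<inter> U) G" using subgroups_Inter_pair[OF _ U'(1)] N2 by simp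
    show "N \<inter> U \<subseteq> X" using N2 by auto
    show "compactin T (N \<inter> U)" using closed_Int_compactin[OF _ U'(3)] N2 by auto
  qed
  then have "discr N" using discr_if_locally_contained[of "N \<inter> U" U N] U' by auto
  then show False using N2 by simp
qed

end

section \<open>Internal direct products\<close>

text \<open>
  A direct product is treated internally: \<open>pr S\<close> replaces the coordinates outside \<open>S\<close> by the
  identity, and the factor over \<open>S\<close> is the range of this endomorphism.
\<close>

locale tdlc_product = tdlc_group G T for G (structure) and T :: "'a topology" +
  fixes I :: "'i set" and pr :: "'i set \<Rightarrow> 'a \<Rightarrow> 'a"
  assumes finite_I: "finite I"
    and pr_mult: "x \<in> carrier G \<Longrightarrow> y \<in> carrier G \<Longrightarrow> pr S (x \<otimes> y) = pr S x \<otimes> pr S y"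
    and pr_cont: "continuous_map T T (pr S)"
    and pr_pr: "x \<in> carrier G \<Longrightarrow> pr S (pr S' x) = pr (S \<inter> S') x"
    and pr_all: "x \<in> carrier G \<Longrightarrow> pr I x = x"
    and pr_empty: "x \<in> carrier G \<Longrightarrow> pr {} x = \<one>"
    and pr_Un: "x \<in> carrier G \<Longrightarrow> S \<inter> S' = {} \<Longrightarrow> pr (S \<union> S') x = pr S x \<otimes> pr S' x"
begin

lemma pr_closed [simp]: "x \<in> carrier G \<Longrightarrow> pr S x \<in> carrier G"
  using continuous_map_image_subset_topspace[OF pr_cont, of S] by auto

lemma pr_one [simp]: "pr S \<one> = \<one>"
proof -
  have "pr S \<one> \<otimes> pr S \<one> = pr S \<one>" using pr_mult[of \<one> \<one> S] by simp
  then show ?thesis by simp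
qed

lemma pr_inv: "x \<in> carrier G \<Longrightarrow> pr S (inv x) = inv (pr S x)"
  using pr_mult[of "inv x" x S] by (intro inv_equality[symmetric]) auto

lemma pr_conj:
  "x \<in> carrier G \<Longrightarrow> y \<in> carrier G \<Longrightarrow> pr S (x \<otimes> y \<otimes> inv x) = pr S x \<otimes> pr S y \<otimes> inv (pr S x)"
  by (simp add: pr_mult pr_inv)

lemma subgroup_pr_image: "subgroup H G \<Longrightarrow> subgroup (pr S ` H) G"
proof
  assume H: "subgroup H G"
  have HG: "H \<subseteq> carrier G" using H subgroup.subset by blast
  show "pr S ` H \<subseteq> carrier G" using HG by auto
  show "\<one> \<in> pr S ` H" using subgroup.one_closed[OF H] by (auto intro!: image_eqI[of _ _ \<one>])
  fix x assume "x \<in> pr S ` H"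
  then obtain a where a: "a \<in> H" "x = pr S a" by auto
  show "inv x \<in> pr S ` H"
    using a HG subgroup.m_inv_closed[OF H] by (intro image_eqI[of _ _ "inv a"]) (auto simp: pr_inv)
  fix y assume "y \<in> pr S ` H"
  then obtain b where b: "b \<in> H" "y = pr S b" by auto
  show "x \<otimes> y \<in> pr S ` H"
    using a b HG subgroup.m_closed[OF H a(1) b(1)] by (intro image_eqI[of _ _ "a \<otimes> b"]) (auto simp: pr_mult subset_iff)
qed

lemma subgroup_pr_preimage: "subgroup U G \<Longrightarrow> subgroup {x \<in> carrier G. pr S x \<in> U} G"
  by (intro subgroup.intro) (auto simp: pr_mult pr_inv subgroup.m_closed subgroup.m_inv_closed subgroup.one_closed)

text \<open>The fixed points of the idempotent \<open>pr S\<close> are the same as its range, and as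
  an equalizer they are visibly closed.\<close>

definition fac :: "'i set \<Rightarrow> 'a set" where
  "fac S = {x \<in> carrier G. pr S x = x}"

lemma facD: "x \<in> fac S \<Longrightarrow> x \<in> carrier G" "x \<in> fac S \<Longrightarrow> pr S x = x"
  by (auto simp: fac_def)

lemma fac_subset_carrier: "fac S \<subseteq> carrier G"
  by (auto simp: fac_def)

lemma pr_in_fac [simp]: "x \<in> carrier G \<Longrightarrow> pr S x \<in> fac S"
  by (simp add: fac_def pr_pr)

lemma pr_image_fac: "H \<subseteq> carrier G \<Longrightarrow> pr S ` H \<subseteq> fac S"
  by auto

lemma fac_I [simp]: "fac I = carrier G"
  by (auto simp: fac_def pr_all)

lemma pr_fac: "x \<in> fac S \<Longrightarrow> pr S' x = pr (S' \<inter> S) x"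
  using pr_pr[of x S' S] by (auto simp: fac_def)

lemma fac_mono: "S \<subseteq> S' \<Longrightarrow> fac S \<subseteq> fac S'"
  using pr_fac[of _ S S'] by (auto simp: fac_def Int_absorb1)

lemma fac_empty [simp]: "fac {} = {\<one>}"
  by (auto simp: fac_def pr_empty)

lemma fac_disjoint: "x \<in> fac S \<Longrightarrow> S' \<inter> S = {} \<Longrightarrow> pr S' x = \<one>"
  using pr_fac[of x S S'] pr_empty facD by auto

text \<open>Commutation of the factors is not postulated: it follows by expanding
  \<open>pr (S \<union> S')\<close> with \<open>pr_Un\<close> in both orders.\<close>

lemma fac_commute:
  assumes "x \<in> fac S" "y \<in> fac S'" "S \<inter> S' = {}"
  shows "x \<otimes> y = y \<otimes> x"
proof -
  have g: "x \<in> carrier G" "y \<in> carrier G" using assms facD by auto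
  have S: "pr S (x \<otimes> y) = x" "pr S' (x \<otimes> y) = y"
    using g assms facD fac_disjoint[OF assms(2), of S] fac_disjoint[OF assms(1), of S']
    by (auto simp: pr_mult Int_commute)
  have "x \<otimes> y = pr (S \<union> S') (x \<otimes> y)" using pr_Un[of "x \<otimes> y" S S'] S assms g by simp
  also have "\<dots> = pr (S' \<union> S) (x \<otimes> y)" by (simp add: Un_commute)
  also have "\<dots> = y \<otimes> x" using pr_Un[of "x \<otimes> y" S' S] S assms g by (simp add: Int_commute)
  finally show ?thesis .
qed

lemma fac_split:
  assumes "x \<in> fac S" "A \<union> B = S" "A \<inter> B = {}"
  shows "x = pr A x \<otimes> pr B x" "x = pr B x \<otimes> pr A x"
  using pr_Un[of x A B] pr_Un[of x B A] assms by (auto simp: facD Un_commute Int_commute)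

lemma subgroup_fac: "subgroup (fac S) G"
  by (rule subgroupI) (auto simp: fac_def pr_mult pr_inv intro!: exI[of _ \<one>])

lemma closedin_fac: "closedin T (fac S)"
proof -
  have "closedin T {x \<in> topspace T. pr S x = id x}"
    by (rule closedin_continuous_maps_eq[OF Hausdorff pr_cont continuous_map_id])
  then show ?thesis by (simp add: fac_def)
qed

lemma openin_pr_preimage: "openin T U \<Longrightarrow> openin T {x \<in> carrier G. pr S x \<in> U}"
  by (rule openin_preimage[OF pr_cont])

lemma closedin_pr_preimage: "closedin T U \<Longrightarrow> closedin T {x \<in> carrier G. pr S x \<in> U}"
  by (rule closedin_preimage[OF pr_cont])

lemma fac_eq_one_iff:
  assumes "x \<in> fac S" "finite S" "\<And>j. j \<in> S \<Longrightarrow> pr {j} x = \<one>"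
  shows "x = \<one>"
proof -
  have g: "x \<in> carrier G" using assms facD by auto
  have "pr S x = \<one>" using assms(2,3)
  proof induction
    case empty then show ?case using pr_empty g by simp
  next
    case (insert j S)
    then show ?case using pr_Un[OF g, of "{j}" S] by simp
  qed
  then show ?thesis using assms facD by simp
qed

text \<open>There are finitely many coordinates. If each projection were isolated at the identity,
  the preimages of the witnessing neighbourhoods would intersect in a neighbourhood that isolates
  the identity in \<open>M\<close>.\<close>

lemma nondiscr_pr:
  assumes "S \<subseteq> I" "M \<subseteq> fac S" "\<not> discr M"
  obtains j where "j \<in> S" "\<not> discr (pr {j} ` M)"
proof -
  have finS: "finite S" using assms(1) finite_I finite_subset by blast
  have "\<exists>j\<in>S. \<not> discr (pr {j} ` M)"
  proof (rule ccontr)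
    assume "\<not> ?thesis"
    then have "\<forall>j\<in>S. \<exists>U. openin T U \<and> \<one> \<in> U \<and> U \<inter> pr {j} ` M \<subseteq> {\<one>}" by (auto simp: discr_def)
    then obtain U where U: "\<And>j. j \<in> S \<Longrightarrow> openin T (U j) \<and> \<one> \<in> U j \<and> U j \<inter> pr {j} ` M \<subseteq> {\<one>}" by metis
    \<comment> \<open>The carrier is included for the case of empty \<open>S\<close>, in which the
      indexed intersection is the whole type.\<close>
    let ?O = "carrier G \<inter> (\<Inter>j\<in>S. {x \<in> carrier G. pr {j} x \<in> U j})"
    have "openin T ?O"
    proof (cases "S = {}")
      case True then show ?thesis using openin_topspace[of T] by simp
    next
      case False
      then have "openin T (\<Inter>j\<in>S. {x \<in> carrier G. pr {j} x \<in> U j})"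
        using finS U by (intro openin_Inter) (auto intro: openin_pr_preimage)
      then show ?thesis using openin_topspace[of T] by (intro openin_Int) auto
    qed
    moreover have "?O \<inter> M \<subseteq> {\<one>}"
    proof
      fix x assume x: "x \<in> ?O \<inter> M"
      have "pr {j} x = \<one>" if "j \<in> S" for j using U[OF that] x that by auto
      then show "x \<in> {\<one>}" using fac_eq_one_iff[of x S] x assms(2) finS by auto
    qed
    ultimately have "discr M" unfolding discr_def using U by (intro exI[of _ ?O]) auto
    then show False using assms(3) by simp
  qed
  then show ?thesis using that by blast
qed

lemma cocompact_in_pr:
  assumes "cocompact_in H X" "H \<subseteq> carrier G" "X \<subseteq> carrier G"
  shows "cocompact_in (pr S ` H) (pr S ` X)"
proof -
  obtain K where K: "compactin T K" "K \<subseteq> X" "\<And>x. x \<in> X \<Longrightarrow> \<exists>h\<in>H. \<exists>k\<in>K. x = h \<otimes> k"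
    using cocompact_inE[OF assms(1)] by blast
  show ?thesis
    unfolding cocompact_in_def
  proof (intro exI conjI ballI)
    show "compactin T (pr S ` K)" by (rule image_compactin[OF K(1) pr_cont])
    show "pr S ` K \<subseteq> pr S ` X" using K by auto
    fix y assume "y \<in> pr S ` X"
    then obtain x where x: "x \<in> X" "y = pr S x" by auto
    obtain h k where hk: "h \<in> H" "k \<in> K" "x = h \<otimes> k" using K(3)[OF x(1)] by blast
    have "h \<in> carrier G" "k \<in> carrier G" using hk assms K(2) by auto
    then have "y = pr S h \<otimes> pr S k" using x hk by (simp add: pr_mult)
    then show "\<exists>h\<in>pr S ` H. \<exists>k\<in>pr S ` K. y = h \<otimes> k" using hk by blast
  qed
qed

lemma pr_image_fac_eq: "A \<subseteq> S \<Longrightarrow> pr A ` fac S = fac A"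
  using fac_mono[of A S] facD by (force intro!: image_eqI)

text \<open>The slice of \<open>H\<close> over \<open>U\<close> is cocompact in the product of
  \<open>fac A\<close> with \<open>fac B \<inter> U\<close>, so it is compactly generated. Its
  subgroups lying over the open normal subgroups V of \<open>U\<close> are directed, and they
  intersect in the discrete group \<open>H \<inter> fac A\<close> because the open normal subgroups
  of the profinite group \<open>U\<close> intersect trivially. So
  \<open>residually_trivial_normalizes\<close> applies, and \<open>N \<inter> U1\<close> is the
  required \<open>W\<close>.\<close>

lemma slice_small_normal_subgroup:
  assumes AB: "A \<union> B = S" "A \<inter> B = {}"
    and H: "subgroup H G" "closedin T H" "H \<subseteq> fac S" "cocompact_in H (fac S)"
    and CA: "compactin T CA" "fac A = generate G CA" and D: "discr (H \<inter> fac A)"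
    and U: "compact_open_subgroup U" and O: "openin T O'" "\<one> \<in> O'"
  obtains W N where "subgroup W G" "compactin T W" "W \<subseteq> O'" "W \<subseteq> H"
    "normalizes {h \<in> H. pr B h \<in> U} W" "openin T N" "\<one> \<in> N" "H \<inter> N \<subseteq> W"
proof -
  note U' = compact_open_subgroupD[OF U]
  have HG: "H \<subseteq> carrier G" using H subgroup.subset by blast
  define PU where "PU = {x \<in> carrier G. pr B x \<in> U}"
  have PU: "subgroup PU G" "openin T PU" unfolding PU_def
    using subgroup_pr_preimage openin_pr_preimage U' by auto
  have cPU: "closedin T PU" by (rule open_subgroup_closedin[OF PU])
  define K where "K = H \<inter> PU"
  have K_eq: "{h \<in> H. pr B h \<in> U} = K" using HG by (auto simp: K_def PU_def)
  have K: "subgroup K G" "closedin T K" unfolding K_def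
    using subgroups_Inter_pair[OF H(1) PU(1)] closedin_Int[OF H(2) cPU] by auto
  have KG: "K \<subseteq> carrier G" using K subgroup.subset by blast
  have ccK: "cocompact_in K (fac S \<inter> PU)" unfolding K_def
    by (rule cocompact_in_Int_open[OF H(1,3) subgroup_fac closedin_fac H(4) PU])
  let ?C = "CA \<union> (fac B \<inter> U)"
  have C: "compactin T ?C" by (intro compactin_Un CA closed_Int_compactin closedin_fac U')
  have facPU: "fac S \<inter> PU = generate G ?C"
  proof
    show "fac S \<inter> PU \<subseteq> generate G ?C"
    proof
      fix x assume x: "x \<in> fac S \<inter> PU"
      have "pr A x \<in> fac A" "pr B x \<in> ?C" using x facD by (auto simp: PU_def)
      then have "pr A x \<in> generate G ?C" "pr B x \<in> generate G ?C"
        using CA(2) mono_generate[of CA ?C] by (auto intro: generate.incl)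
      then have "pr A x \<otimes> pr B x \<in> generate G ?C" by (rule generate.eng)
      then show "x \<in> generate G ?C" using fac_split(1)[of x S A B] x AB by simp
    qed
    show "generate G ?C \<subseteq> fac S \<inter> PU"
    proof (rule generate_subgroup_incl)
      show "subgroup (fac S \<inter> PU) G" by (rule subgroups_Inter_pair[OF subgroup_fac PU(1)])
      have "CA \<subseteq> fac A" unfolding CA(2) by (auto intro: generate.incl)
      moreover have "pr B x = \<one>" if "x \<in> fac A" for x
        using fac_disjoint[OF that, of B] AB by (simp add: Int_commute)
      ultimately have "CA \<subseteq> fac S \<inter> PU" using fac_mono[of A S] AB facD U'(5) by (auto simp: PU_def)
      moreover have "fac B \<inter> U \<subseteq> fac S \<inter> PU" using fac_mono[of B S] AB facD by (auto simp: PU_def)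
      ultimately show "?C \<subseteq> fac S \<inter> PU" by blast
    qed
  qed
  have KS: "K \<subseteq> fac S \<inter> PU" using H(3) by (auto simp: K_def)
  obtain C' where C': "compactin T C'" "K = generate G C'"
    using compact_generation_cocompact[OF C facPU K KS ccK] .
  define PV where "PV V = K \<inter> {x \<in> carrier G. pr B x \<in> V}" for V
  define \<N> where "\<N> = {PV V |V. subgroup V G \<and> openin T V \<and> V \<subseteq> U \<and> normalizes U V}"
  have "normalizes U U" unfolding normalizes_def
    using U'(1) by (simp add: subgroup.m_closed subgroup.m_inv_closed)
  then have ne: "\<N> \<noteq> {}" using U' by (auto simp: \<N>_def)
  have N1: "N \<subseteq> K \<and> closedin T N \<and> normalizes K N" if "N \<in> \<N>" for N
  proof -
    obtain V where V: "N = PV V" "subgroup V G" "openin T V" "V \<subseteq> U" "normalizes U V"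
      using \<open>N \<in> \<N>\<close> by (auto simp: \<N>_def)
    have "closedin T N" unfolding V(1) PV_def
      by (intro closedin_Int K closedin_pr_preimage open_subgroup_closedin V)
    moreover have "normalizes K N" unfolding normalizes_def
    proof (intro ballI)
      fix k x assume k: "k \<in> K" and x: "x \<in> N"
      have g: "k \<in> carrier G" "x \<in> carrier G" "x \<in> K" using k x KG by (auto simp: V PV_def)
      have "k \<otimes> x \<otimes> inv k \<in> K" using k g K(1) by (simp add: subgroup.m_closed subgroup.m_inv_closed)
      moreover have "pr B k \<otimes> pr B x \<otimes> inv (pr B k) \<in> V"
        by (rule normalizesD[OF V(5)]) (use k x in \<open>auto simp: K_def PU_def V PV_def\<close>)
      ultimately show "k \<otimes> x \<otimes> inv k \<in> N" using g by (simp add: V PV_def pr_conj)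
    qed
    ultimately show ?thesis by (auto simp: V PV_def)
  qed
  have dir: "\<exists>L\<in>\<N>. L \<subseteq> M \<inter> N" if M: "M \<in> \<N>" and N: "N \<in> \<N>" for M N
  proof -
    obtain V where V: "M = PV V" "subgroup V G" "openin T V" "V \<subseteq> U" "normalizes U V"
      using M by (auto simp: \<N>_def)
    obtain V' where V': "N = PV V'" "subgroup V' G" "openin T V'" "V' \<subseteq> U" "normalizes U V'"
      using N by (auto simp: \<N>_def)
    have "subgroup (V \<inter> V') G" "openin T (V \<inter> V')" "V \<inter> V' \<subseteq> U" "normalizes U (V \<inter> V')"
      using subgroups_Inter_pair[OF V(2) V'(2)] V V' by (auto simp: normalizes_def)
    then have "PV (V \<inter> V') \<in> \<N>" unfolding \<N>_def by blast
    then show ?thesis by (rule bexI[rotated]) (auto simp: V V' PV_def)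
  qed
  obtain U0 where U0: "compact_open_subgroup U0" "U0 \<inter> (H \<inter> fac A) \<subseteq> {\<one>}" using discrE[OF D] .
  obtain U1 where U1: "compact_open_subgroup U1" "U1 \<subseteq> U0 \<inter> O'"
    using van_Dantzig[of "U0 \<inter> O'"] compact_open_subgroupD[OF U0(1)] O by auto
  note U1' = compact_open_subgroupD[OF U1(1)]
  have U1N: "\<Inter>\<N> \<inter> U1 \<subseteq> {\<one>}"
  proof
    fix x assume x: "x \<in> \<Inter>\<N> \<inter> U1"
    have "x \<in> K" using x ne N1 by blast
    then have xG: "x \<in> carrier G" "x \<in> H" "x \<in> fac S" using KG H(3) by (auto simp: K_def)
    \<comment> \<open>If \<open>pr B x\<close> is not the identity, some open normal subgroup of
      \<open>U\<close> avoids it. It is obtained as the core of \<open>V0 \<inter> U\<close> in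
      \<open>U\<close>, where \<open>normal_core\<close> is used with the compact group
      \<open>U\<close> itself as \<open>C\<close> and a trivial \<open>P\<close>.\<close>
    have "pr B x = \<one>"
    proof (rule ccontr)
      assume ne1: "pr B x \<noteq> \<one>"
      have "closedin T {pr B x}" using xG by (intro compactin_closedin) auto
      then have "openin T (carrier G - {pr B x})" by (simp add: closedin_def)
      moreover have "\<one> \<in> carrier G - {pr B x}" using ne1 by auto
      ultimately obtain V0 where V0: "compact_open_subgroup V0" "V0 \<subseteq> carrier G - {pr B x}"
        by (rule van_Dantzig)
      note V0' = compact_open_subgroupD[OF V0(1)]
      have W: "subgroup (V0 \<inter> U) G" "closedin T (V0 \<inter> U)"
        by (rule subgroups_Inter_pair[OF V0'(1) U'(1)], rule closedin_Int[OF V0'(4) U'(4)])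
      have one: "{\<one>} \<subseteq> U" using U' by auto
      have dec: "\<exists>c\<in>U. \<exists>p\<in>{\<one>}. x = c \<otimes> p" if "x \<in> U" for x
        using that U'(6) by (intro bexI[of _ x] bexI[of _ \<one>]) auto
      have Q: "inv p \<otimes> q \<otimes> p \<in> V0 \<inter> U" if "p \<in> {\<one>}" "q \<in> U \<inter> V0" for p q
        using that U' by auto
      obtain V N where V: "subgroup V G" "V \<subseteq> V0 \<inter> U" "normalizes U V" "openin T N" "\<one> \<in> N" "U \<inter> N \<subseteq> V"
        by (rule normal_core[OF U'(1,3) order_refl one dec W \<open>normalizes U U\<close> U'(6) V0'(2,5) Q]) blast+
      have "openin T V" by (rule subgroup_openI[OF V(1), of "U \<inter> N"]) (use V U' in auto)
      then have "PV V \<in> \<N>" using V by (auto simp: \<N>_def)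
      then have "pr B x \<in> V" using x by (auto simp: PV_def)
      then show False using V(2) V0(2) by auto
    qed
    then have "x = pr A x" using fac_split(1)[OF xG(3) AB] xG by simp
    then have "x \<in> fac A" using xG by (metis pr_in_fac)
    then show "x \<in> {\<one>}" using x xG U0(2) U1(2) by auto
  qed
  obtain N where N: "N \<in> \<N>" "normalizes K (N \<inter> U1)"
    by (rule residually_trivial_normalizes[OF K(1) C'(2,1) ne N1 dir U1(1) U1N])
  obtain V where V: "N = PV V" "subgroup V G" "openin T V" "V \<subseteq> U" "normalizes U V"
    using N(1) by (auto simp: \<N>_def)
  show ?thesis
  proof (rule that[of "N \<inter> U1" "U1 \<inter> {x \<in> carrier G. pr B x \<in> V}"])
    show "subgroup (N \<inter> U1) G" unfolding V PV_def
      by (intro subgroups_Inter_pair K subgroup_pr_preimage V U1')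
    show "compactin T (N \<inter> U1)" using closed_Int_compactin[OF _ U1'(3)] N1[OF N(1)] by auto
    show "N \<inter> U1 \<subseteq> O'" using U1 by auto
    show "N \<inter> U1 \<subseteq> H" using N1[OF N(1)] by (auto simp: K_def)
    show "normalizes {h \<in> H. pr B h \<in> U} (N \<inter> U1)" unfolding K_eq by (rule N(2))
    show "openin T (U1 \<inter> {x \<in> carrier G. pr B x \<in> V})" by (intro openin_Int openin_pr_preimage V U1')
    show "\<one> \<in> U1 \<inter> {x \<in> carrier G. pr B x \<in> V}" using U1' subgroup.one_closed[OF V(2)] by auto
    show "H \<inter> (U1 \<inter> {x \<in> carrier G. pr B x \<in> V}) \<subseteq> N \<inter> U1"
      using V(4) by (auto simp: V(1) PV_def K_def PU_def)
  qed
qed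

end

context group begin

lemma subgroup_mult_normalized:
  assumes H: "subgroup H G" and V: "subgroup V G" and n: "normalizes H V"
  shows "subgroup {h \<otimes> v |h v. h \<in> H \<and> v \<in> V} G"
proof
  have HG: "H \<subseteq> carrier G" and VG: "V \<subseteq> carrier G" using H V subgroup.subset by blast+
  let ?A = "{h \<otimes> v |h v. h \<in> H \<and> v \<in> V}"
  show "?A \<subseteq> carrier G" using HG VG by auto
  have "\<one> = \<one> \<otimes> \<one>" by simp
  then show "\<one> \<in> ?A" using subgroup.one_closed[OF H] subgroup.one_closed[OF V] by blast
  fix x assume "x \<in> ?A"
  then obtain h v where x: "h \<in> H" "v \<in> V" "x = h \<otimes> v" by blast
  have g: "h \<in> carrier G" "v \<in> carrier G" using x HG VG by auto
  have "inv x = inv h \<otimes> (h \<otimes> inv v \<otimes> inv h)" using x g by (simp add: inv_mult_group m_assoc)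
  moreover have "h \<otimes> inv v \<otimes> inv h \<in> V" by (rule normalizesD[OF n x(1) subgroup.m_inv_closed[OF V x(2)]])
  ultimately show "inv x \<in> ?A" using subgroup.m_inv_closed[OF H x(1)] by blast
  fix y assume "y \<in> ?A"
  then obtain k w where y: "k \<in> H" "w \<in> V" "y = k \<otimes> w" by blast
  have g': "k \<in> carrier G" "w \<in> carrier G" using y HG VG by auto
  have "x \<otimes> y = (h \<otimes> k) \<otimes> ((inv k \<otimes> v \<otimes> k) \<otimes> w)" using x y g g' by (simp add: m_assoc)
  moreover have "(inv k \<otimes> v \<otimes> k) \<otimes> w \<in> V"
    by (rule subgroup.m_closed[OF V normalizesD_inv[OF n H y(1) x(2)] y(2)])
  ultimately show "x \<otimes> y \<in> ?A" using subgroup.m_closed[OF H x(1) y(1)] by blast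
qed

lemma normalizes_self: "subgroup H G \<Longrightarrow> normalizes H H"
  by (simp add: normalizes_def subgroup.m_closed subgroup.m_inv_closed)

lemma normalizes_Int: "normalizes X A \<Longrightarrow> normalizes X B \<Longrightarrow> normalizes X (A \<inter> B)"
  by (auto simp: normalizes_def)

lemma normalizes_subset: "normalizes X A \<Longrightarrow> Y \<subseteq> X \<Longrightarrow> normalizes Y A"
  by (auto simp: normalizes_def)

end

section \<open>Conjugation inside a product and compact normal subgroups\<close>

context tdlc_product begin

lemma conj_fac:
  assumes x: "x \<in> carrier G" and d: "d \<in> fac S'" and S: "S' \<subseteq> S"
  shows "pr S x \<otimes> d \<otimes> inv (pr S x) = pr S' x \<otimes> d \<otimes> inv (pr S' x)"
proof -
  have g: "d \<in> carrier G" using d facD by auto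
  have "S' \<union> (S - S') = S" using S by auto
  then have s: "pr S x = pr S' x \<otimes> pr (S - S') x" using pr_Un[OF x, of S' "S - S'"] by simp
  have c: "pr (S - S') x \<otimes> d = d \<otimes> pr (S - S') x" by (rule fac_commute[OF pr_in_fac[OF x] d]) auto
  have "pr S x \<otimes> d \<otimes> inv (pr S x) =
      pr S' x \<otimes> (pr (S - S') x \<otimes> d) \<otimes> inv (pr (S - S') x) \<otimes> inv (pr S' x)"
    unfolding s using x g by (simp add: m_assoc inv_mult_group)
  also have "\<dots> = pr S' x \<otimes> d \<otimes> inv (pr S' x)" unfolding c using x g by (simp add: m_assoc)
  finally show ?thesis .
qed

text \<open>Coordinates outside \<open>S'\<close> commute with \<open>fac S'\<close> and do not
  affect conjugation of \<open>D\<close>. This carries invariance under a projected lattice from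
  many coordinates to a single factor and back.\<close>

lemma normalizes_pr_image_fac:
  assumes "X \<subseteq> carrier G" "D \<subseteq> fac S'" "S' \<subseteq> S"
  shows "normalizes (pr S ` X) D \<longleftrightarrow> normalizes (pr S' ` X) D"
proof -
  have "pr S x \<otimes> d \<otimes> inv (pr S x) = pr S' x \<otimes> d \<otimes> inv (pr S' x)" if "x \<in> X" "d \<in> D" for x d
    using conj_fac[of x d S' S] that assms by auto
  then show ?thesis by (auto simp: normalizes_def)
qed

text \<open>By cocompactness \<open>H\<close> is a compact set times the slice \<open>KB\<close>
  times the slice \<open>KA\<close>. Each slice normalizes its own small compact subgroup. Choosing
  \<open>WB\<close> inside \<open>NA\<close>, hence inside \<open>WA\<close>, lets the two
  conjugations be performed one after the other: \<open>KB\<close> keeps an element in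
  \<open>WB\<close>, and \<open>KA\<close> then keeps it in \<open>WA\<close>. The core of
  \<open>WA\<close> in \<open>H\<close> is therefore still open in \<open>H\<close>.\<close>

lemma two_factors_compact_normal:
  assumes AB: "A \<union> B = S" "A \<inter> B = {}"
    and H: "subgroup H G" "closedin T H" "H \<subseteq> fac S" "cocompact_in H (fac S)"
    and CA: "compactin T CA" "fac A = generate G CA" and CB: "compactin T CB" "fac B = generate G CB"
    and D: "discr (H \<inter> fac A)" "discr (H \<inter> fac B)"
  obtains V N where "subgroup V G" "compactin T V" "V \<subseteq> H" "normalizes H V"
    "openin T N" "\<one> \<in> N" "H \<inter> N \<subseteq> V"
proof -
  have HG: "H \<subseteq> carrier G" using H subgroup.subset by blast
  have BA: "B \<union> A = S" "B \<inter> A = {}" using AB by auto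
  have facAB: "fac A \<subseteq> fac S" "fac B \<subseteq> fac S" using fac_mono[of A S] fac_mono[of B S] AB(1) by auto
  have prS: "pr A z \<in> fac S" "pr B z \<in> fac S" if "z \<in> carrier G" for z
    using subsetD[OF facAB(1) pr_in_fac[OF that]] subsetD[OF facAB(2) pr_in_fac[OF that]] by auto
  have prAB: "pr A (pr B z) = \<one>" "pr B (pr A z) = \<one>" if "z \<in> carrier G" for z
    using that by (simp_all add: pr_pr AB(2) BA(2) pr_empty)
  obtain U where U: "compact_open_subgroup U"
    by (rule van_Dantzig[of "carrier G"]) (use openin_topspace[of T] in auto)
  note U' = compact_open_subgroupD[OF U]
  define KB where "KB = H \<inter> {x \<in> carrier G. pr B x \<in> U}"
  define KA where "KA = H \<inter> {x \<in> carrier G. pr A x \<in> U}"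
  have KB_eq: "{h \<in> H. pr B h \<in> U} = KB" and KA_eq: "{h \<in> H. pr A h \<in> U} = KA"
    using HG by (auto simp: KB_def KA_def)
  have PU: "subgroup {x \<in> carrier G. pr E x \<in> U} G" "openin T {x \<in> carrier G. pr E x \<in> U}" for E
    by (rule subgroup_pr_preimage[OF U'(1)], rule openin_pr_preimage[OF U'(2)])
  have KBs: "subgroup KB G" and KAs: "subgroup KA G" unfolding KB_def KA_def
    by (rule subgroups_Inter_pair[OF H(1) PU(1)])+
  obtain WA NA where WA: "subgroup WA G" "compactin T WA" "WA \<subseteq> U" "WA \<subseteq> H" "normalizes KA WA"
    "openin T NA" "\<one> \<in> NA" "H \<inter> NA \<subseteq> WA"
    by (rule slice_small_normal_subgroup[OF BA H CB D(2) U U'(2,5), unfolded KA_eq])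
  obtain WB NB where WB: "subgroup WB G" "compactin T WB" "WB \<subseteq> NA" "WB \<subseteq> H" "normalizes KB WB"
    "openin T NB" "\<one> \<in> NB" "H \<inter> NB \<subseteq> WB"
    by (rule slice_small_normal_subgroup[OF AB H CA D(1) U WA(6,7), unfolded KB_eq])
  have "WB \<subseteq> WA" using WB(3,4) WA(8) by blast
  have ccB: "cocompact_in KB (fac S \<inter> {x \<in> carrier G. pr B x \<in> U})" unfolding KB_def
    by (rule cocompact_in_Int_open[OF H(1,3) subgroup_fac closedin_fac H(4) PU])
  obtain CB' where CB': "compactin T CB'" "CB' \<subseteq> fac S \<inter> {x \<in> carrier G. pr B x \<in> U}"
    "\<And>x. x \<in> fac S \<inter> {x \<in> carrier G. pr B x \<in> U} \<Longrightarrow> \<exists>h\<in>KB. \<exists>k\<in>CB'. x = h \<otimes> k"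
    using cocompact_inE[OF ccB] by blast
  have ccA: "cocompact_in KA (fac S \<inter> {x \<in> carrier G. pr A x \<in> U})" unfolding KA_def
    by (rule cocompact_in_Int_open[OF H(1,3) subgroup_fac closedin_fac H(4) PU])
  obtain CA' where CA': "compactin T CA'" "CA' \<subseteq> fac S \<inter> {x \<in> carrier G. pr A x \<in> U}"
    "\<And>x. x \<in> fac S \<inter> {x \<in> carrier G. pr A x \<in> U} \<Longrightarrow> \<exists>h\<in>KA. \<exists>k\<in>CA'. x = h \<otimes> k"
    using cocompact_inE[OF ccA] by blast
  define C where "C = H \<inter> (\<lambda>x. inv x) ` {c \<otimes> d |c d. c \<in> CB' \<and> d \<in> pr B ` CA'}"
  have C: "compactin T C" unfolding C_def
    by (intro closed_Int_compactin H compactin_inv compactin_mult CB' image_compactin[OF CA'(1) pr_cont])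
  define P where "P = {k \<otimes> l |k l. k \<in> KB \<and> l \<in> KA}"
  have dec: "\<exists>c\<in>C. \<exists>p\<in>P. h = c \<otimes> p" if h: "h \<in> H" for h
  proof -
    \<comment> \<open>An element l of \<open>KA\<close> absorbs \<open>pr B x\<close> up to the
      compact set \<open>CA'\<close>, then k in \<open>KB\<close> absorbs the
      \<open>A\<close>-coordinates of the rest y up to \<open>CB'\<close>. What remains is x = l k
      r, where r is the product of e and \<open>pr B c\<close>; it lies in \<open>H\<close> because
      x, l and k do. Inverting puts the compact factor first.\<close>
    define x where "x = inv h"
    have xH: "x \<in> H" using h subgroup.m_inv_closed[OF H(1)] by (simp add: x_def)
    have xS: "x \<in> fac S" "x \<in> carrier G" using xH H(3) HG by auto
    have "pr B x \<in> fac S \<inter> {x \<in> carrier G. pr A x \<in> U}" using U'(5) xS(2) prS prAB by simp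
    then obtain l c where l: "l \<in> KA" "c \<in> CA'" "pr B x = l \<otimes> c" using CA'(3) by blast
    have lg: "l \<in> carrier G" "c \<in> carrier G" "c \<in> fac S" "l \<in> H" using l HG CA'(2) by (auto simp: KA_def)
    define y where "y = c \<otimes> pr A x"
    have yS: "y \<in> fac S" unfolding y_def by (rule subgroup.m_closed[OF subgroup_fac lg(3) prS(1)[OF xS(2)]])
    have prBy: "pr B y = pr B c" unfolding y_def using lg(2) xS(2) by (simp add: pr_mult prAB)
    have yG: "y \<in> carrier G" using facD(1)[OF yS] .
    have "pr A y \<in> fac S \<inter> {x \<in> carrier G. pr B x \<in> U}" using U'(5) yG prS prAB by simp
    then obtain k e where k: "k \<in> KB" "e \<in> CB'" "pr A y = k \<otimes> e" using CB'(3) by blast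
    have kg: "k \<in> carrier G" "e \<in> carrier G" "k \<in> H" using k HG CB'(2) by (auto simp: KB_def)
    have "x = pr B x \<otimes> pr A x" by (rule fac_split(2)[OF xS(1) AB])
    also have "\<dots> = l \<otimes> y" unfolding l(3) y_def using lg xS by (simp add: m_assoc)
    also have "y = pr A y \<otimes> pr B y" by (rule fac_split(1)[OF yS AB])
    finally have x: "x = l \<otimes> (k \<otimes> e \<otimes> pr B c)" unfolding k(3) prBy .
    have eg: "e \<otimes> pr B c \<in> carrier G" using kg lg by auto
    have x': "x = (l \<otimes> k) \<otimes> (e \<otimes> pr B c)" unfolding x using kg lg by (simp add: m_assoc)
    have "h = inv x" unfolding x_def using h HG by auto
    also have "\<dots> = inv (e \<otimes> pr B c) \<otimes> (inv k \<otimes> inv l)"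
      unfolding x' using kg lg eg by (simp add: inv_mult_group)
    finally have hh: "h = inv (e \<otimes> pr B c) \<otimes> (inv k \<otimes> inv l)" .
    have "e \<otimes> pr B c = inv k \<otimes> inv l \<otimes> x" unfolding x' using kg lg by (simp add: m_assoc)
    moreover have "inv k \<otimes> inv l \<otimes> x \<in> H" using kg lg xH H(1) by (simp add: subgroup.m_closed subgroup.m_inv_closed)
    ultimately have "inv (e \<otimes> pr B c) \<in> H" using subgroup.m_inv_closed[OF H(1)] by simp
    then have "inv (e \<otimes> pr B c) \<in> C" unfolding C_def using k(2) l(2) by blast
    moreover have "inv k \<otimes> inv l \<in> P" unfolding P_def
      using subgroup.m_inv_closed[OF KBs k(1)] subgroup.m_inv_closed[OF KAs l(1)] by blast
    ultimately show ?thesis using hh by blast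
  qed
  have Q: "inv p \<otimes> q \<otimes> p \<in> WA" if p: "p \<in> P" and q: "q \<in> H \<inter> NB" for p q
  proof -
    obtain k l where kl: "k \<in> KB" "l \<in> KA" "p = k \<otimes> l" using p by (auto simp: P_def)
    have g: "k \<in> carrier G" "l \<in> carrier G" "q \<in> carrier G" using kl q HG by (auto simp: KB_def KA_def)
    have "inv k \<otimes> q \<otimes> k \<in> WB" by (rule normalizesD_inv[OF WB(5) KBs kl(1)]) (use q WB(8) in auto)
    then have "inv l \<otimes> (inv k \<otimes> q \<otimes> k) \<otimes> l \<in> WA"
      by (intro normalizesD_inv[OF WA(5) KAs kl(2)]) (use \<open>WB \<subseteq> WA\<close> in auto)
    then show ?thesis using g kl by (simp add: inv_mult_group m_assoc)
  qed
  have PH: "P \<subseteq> H" unfolding P_def using subgroup.m_closed[OF H(1)] by (auto simp: KA_def KB_def)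
  have CH: "C \<subseteq> H" by (auto simp: C_def)
  obtain V N where V: "subgroup V G" "V \<subseteq> WA" "normalizes H V" "closedin T V"
    "openin T N" "\<one> \<in> N" "H \<inter> N \<subseteq> V"
    by (rule normal_core[OF H(1) C CH PH dec WA(1) compactin_closedin[OF WA(2)] normalizes_self[OF H(1)] HG WB(6,7) Q]) blast+
  have "compactin T V"
    by (rule closed_compactin[OF WA(2) V(2,4)])
  then show ?thesis using that[OF V(1) _ _ V(3,5,6,7)] V(2) WA(4) by blast
qed

end

section \<open>Cocompact lattices in a product\<close>

locale product_lattice = tdlc_product G T I pr
  for G (structure) and T :: "'a topology" and I :: "'i set" and pr +
  fixes \<Gamma> :: "'a set"
  assumes subgroup_\<Gamma>: "subgroup \<Gamma> G" and discr_\<Gamma>: "discr \<Gamma>"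
    and cocompact_\<Gamma>: "cocompact_in \<Gamma> (carrier G)"
    and dense: "j \<in> I \<Longrightarrow> cl (pr {j} ` \<Gamma>) = fac {j}"
    and factor_compactly_generated: "j \<in> I \<Longrightarrow> \<exists>C. compactin T C \<and> fac {j} = generate G C"
    and factor_qjnc: "j \<in> I \<Longrightarrow> qjnc (fac {j})"
    and factor_nondiscr: "j \<in> I \<Longrightarrow> \<not> discr (fac {j})"
begin

lemma \<Gamma>_subset: "\<Gamma> \<subseteq> carrier G"
  using subgroup_\<Gamma> subgroup.subset by blast

lemma fac_compactly_generated:
  assumes "S \<subseteq> I"
  shows "\<exists>C. compactin T C \<and> fac S = generate G C"
proof -
  have "finite S" using assms finite_I finite_subset by blast
  then show ?thesis using assms
  proof induction
    case empty
    have "generate G {} = {\<one>}" by (rule generate_empty)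
    then show ?case by (intro exI[of _ "{}"]) simp
  next
    case (insert j S)
    obtain C where C: "compactin T C" "fac S = generate G C" using insert by auto
    obtain D where D: "compactin T D" "fac {j} = generate G D"
      using factor_compactly_generated[of j] insert by auto
    have CD: "C \<subseteq> fac S" "D \<subseteq> fac {j}" unfolding C(2) D(2) by (auto intro: generate.incl)
    have "fac (insert j S) \<subseteq> generate G (C \<union> D)"
    proof
      fix x assume x: "x \<in> fac (insert j S)"
      then have "pr {j} x \<in> generate G D" "pr S x \<in> generate G C" using C D facD by auto
      then have "pr {j} x \<in> generate G (C \<union> D)" "pr S x \<in> generate G (C \<union> D)"
        using mono_generate[of D "C \<union> D"] mono_generate[of C "C \<union> D"] by auto
      then have "pr {j} x \<otimes> pr S x \<in> generate G (C \<union> D)" by (rule generate.eng)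
      then show "x \<in> generate G (C \<union> D)" using fac_split(1)[OF x, of "{j}" S] insert by auto
    qed
    moreover have "generate G (C \<union> D) \<subseteq> fac (insert j S)"
      by (rule generate_subgroup_incl[OF _ subgroup_fac])
        (use CD fac_mono[of S "insert j S"] fac_mono[of "{j}" "insert j S"] in auto)
    ultimately show ?case using compactin_Un[OF C(1) D(1)] by blast
  qed
qed

text \<open>Density of the projection extends invariance from \<Gamma> to the whole factor. In this
  way closed subgroups built from \<Gamma> become normal in a factor, where quasi
  just-non-compactness can be applied.\<close>

lemma normalizes_factor:
  assumes "j \<in> I" "normalizes (pr {j} ` \<Gamma>) A"
  shows "normalizes (fac {j}) (cl A)"
  using normalizes_closure_of[OF assms(2)] dense[OF assms(1)] by simp

lemma normalizes_factor_closed: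
  assumes "j \<in> I" "normalizes (pr {j} ` \<Gamma>) A" "closedin T A"
  shows "normalizes (fac {j}) A"
  using normalizes_factor[OF assms(1,2)] assms(3) by (simp add: closure_of_closedin)

lemma cocompact_pr_\<Gamma>: "cocompact_in (pr S ` \<Gamma>) (fac S)"
proof -
  have "pr S ` carrier G = fac S"
  proof (intro equalityI subsetI)
    fix y assume "y \<in> fac S"
    then show "y \<in> pr S ` carrier G" using facD[of y S] by (intro image_eqI[of _ _ y]) auto
  qed auto
  then show ?thesis using cocompact_in_pr[OF cocompact_\<Gamma> \<Gamma>_subset order_refl, of S] by simp
qed

lemma cocompact_in_mono: "cocompact_in H X \<Longrightarrow> H \<subseteq> H' \<Longrightarrow> cocompact_in H' X"
  unfolding cocompact_in_def by blast

text \<open>The group \<open>H\<^sub>S\<close> of the overview, as a subgroup of the ambient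
  product.\<close>

definition closed_pr :: "'i set \<Rightarrow> 'a set" where
  "closed_pr S = cl (pr S ` \<Gamma>)"

lemma closed_pr:
  "subgroup (closed_pr S) G" "closedin T (closed_pr S)" "pr S ` \<Gamma> \<subseteq> closed_pr S" "closed_pr S \<subseteq> fac S"
  "cocompact_in (closed_pr S) (fac S)" "closed_pr S \<subseteq> carrier G"
proof -
  show s: "subgroup (closed_pr S) G" unfolding closed_pr_def
    by (rule subgroup_closure_of[OF subgroup_pr_image[OF subgroup_\<Gamma>]])
  show "closedin T (closed_pr S)" by (simp add: closed_pr_def)
  show p: "pr S ` \<Gamma> \<subseteq> closed_pr S" unfolding closed_pr_def
    by (rule closure_of_superset) (use \<Gamma>_subset in auto)
  show "closed_pr S \<subseteq> fac S" unfolding closed_pr_def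
    by (rule closure_of_minimal[OF _ closedin_fac]) (use \<Gamma>_subset in auto)
  show "cocompact_in (closed_pr S) (fac S)" by (rule cocompact_in_mono[OF cocompact_pr_\<Gamma> p])
  show "closed_pr S \<subseteq> carrier G" by (rule subgroup.subset[OF s])
qed

lemma closed_pr_Int_factor:
  assumes "S \<subseteq> I" "j \<in> S"
  shows "subgroup (closed_pr S \<inter> fac {j}) G" "closedin T (closed_pr S \<inter> fac {j})" "normalizes (fac {j}) (closed_pr S \<inter> fac {j})"
proof -
  show "subgroup (closed_pr S \<inter> fac {j}) G" by (rule subgroups_Inter_pair[OF closed_pr(1) subgroup_fac])
  show c: "closedin T (closed_pr S \<inter> fac {j})" by (rule closedin_Int[OF closed_pr(2) closedin_fac])
  have 1: "normalizes (pr S ` \<Gamma>) (closed_pr S)" by (rule normalizes_subset[OF normalizes_self[OF closed_pr(1)] closed_pr(3)])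
  have "normalizes (pr {j} ` \<Gamma>) (fac {j})"
    by (rule normalizes_subset[OF normalizes_self[OF subgroup_fac]]) (use \<Gamma>_subset in auto)
  then have "normalizes (pr S ` \<Gamma>) (fac {j})"
    using normalizes_pr_image_fac[OF \<Gamma>_subset order_refl, of "{j}" S] assms by simp
  with 1 have "normalizes (pr S ` \<Gamma>) (closed_pr S \<inter> fac {j})" by (rule normalizes_Int)
  then have "normalizes (pr {j} ` \<Gamma>) (closed_pr S \<inter> fac {j})"
    using normalizes_pr_image_fac[OF \<Gamma>_subset, of "closed_pr S \<inter> fac {j}" "{j}" S] assms by simp
  from normalizes_factor_closed[OF _ this c] show "normalizes (fac {j}) (closed_pr S \<inter> fac {j})"
    using assms by auto
qed

end

section \<open>Factors met cocompactly by a closed projection\<close>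

context product_lattice begin

text \<open>The quotient of \<open>fac {j}\<close> by \<open>closed_pr S \<inter> fac {j}\<close> is
  compact and totally disconnected, hence profinite, and \<open>V\<close> plays the role of the
  preimage of a small open normal subgroup. It is the core of the closed subgroup \<open>W\<close>,
  the product of \<open>D\<close> with a compact open subgroup of the factor.\<close>

lemma cocompact_closed_pr_neighbourhood:
  assumes j: "j \<in> S" "S \<subseteq> I" and cc: "cocompact_in (closed_pr S \<inter> fac {j}) (fac {j})"
    and U: "openin T U" "\<one> \<in> U"
  obtains V N where "subgroup V G" "closedin T V" "V \<subseteq> fac {j}" "normalizes (fac {j}) V"
    "closed_pr S \<inter> fac {j} \<subseteq> V" "\<forall>v\<in>V. \<exists>d\<in>closed_pr S \<inter> fac {j}. \<exists>u\<in>U. v = d \<otimes> u"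
    "openin T N" "\<one> \<in> N" "fac {j} \<inter> N \<subseteq> V"
proof -
  define D where "D = closed_pr S \<inter> fac {j}"
  have D: "subgroup D G" "closedin T D" "normalizes (fac {j}) D" "D \<subseteq> fac {j}"
    using closed_pr_Int_factor[OF j(2,1)] by (auto simp: D_def)
  have DG: "D \<subseteq> carrier G" using D subgroup.subset by blast
  have XG: "fac {j} \<subseteq> carrier G" by (rule fac_subset_carrier)
  obtain K where K: "compactin T K" "K \<subseteq> fac {j}" "\<And>x. x \<in> fac {j} \<Longrightarrow> \<exists>h\<in>D. \<exists>k\<in>K. x = h \<otimes> k"
    using cocompact_inE[OF cc] unfolding D_def by blast
  obtain V0 where V0: "compact_open_subgroup V0" "V0 \<subseteq> U" using van_Dantzig[OF U] .
  note V0' = compact_open_subgroupD[OF V0(1)]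
  define W where "W = {d \<otimes> u |d u. d \<in> D \<and> u \<in> V0 \<inter> fac {j}}"
  have sV0: "subgroup (V0 \<inter> fac {j}) G" by (rule subgroups_Inter_pair[OF V0'(1) subgroup_fac])
  have nD: "normalizes (V0 \<inter> fac {j}) D" by (rule normalizes_subset[OF D(3)]) auto
  \<comment> \<open>Since \<open>D\<close> is normal, the order of the two factors is immaterial.
    One order yields a subgroup by \<open>subgroup_mult_normalized\<close>, the other is closed as
    closed times compact.\<close>
  have "{u \<otimes> d |u d. u \<in> V0 \<inter> fac {j} \<and> d \<in> D} = W"
  proof (intro equalityI subsetI)
    fix x assume "x \<in> {u \<otimes> d |u d. u \<in> V0 \<inter> fac {j} \<and> d \<in> D}"
    then obtain u d where x: "u \<in> V0 \<inter> fac {j}" "d \<in> D" "x = u \<otimes> d" by blast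
    then have "x = (u \<otimes> d \<otimes> inv u) \<otimes> u" using DG XG by (auto simp: m_assoc subset_iff)
    then show "x \<in> W" unfolding W_def using normalizesD[OF nD x(1,2)] x(1) by blast
  next
    fix x assume "x \<in> W"
    then obtain u d where x: "u \<in> V0 \<inter> fac {j}" "d \<in> D" "x = d \<otimes> u" unfolding W_def by blast
    then have "x = u \<otimes> (inv u \<otimes> d \<otimes> u)" using DG XG by (auto simp: m_assoc subset_iff)
    then show "x \<in> {u \<otimes> d |u d. u \<in> V0 \<inter> fac {j} \<and> d \<in> D}"
      using normalizesD_inv[OF nD sV0 x(1,2)] x(1) by blast
  qed
  then have sW: "subgroup W G" using subgroup_mult_normalized[OF sV0 D(1) nD] by simp
  have "compactin T (V0 \<inter> fac {j})"
    using closed_Int_compactin[OF closedin_fac V0'(3)] by (simp add: Int_commute)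
  then have cW: "closedin T W" unfolding W_def by (rule closedin_mult_compactin[OF D(2)])
  have dec: "\<exists>c\<in>(\<lambda>x. inv x) ` K. \<exists>p\<in>D. x = c \<otimes> p" if x: "x \<in> fac {j}" for x
  proof -
    obtain d k where dk: "d \<in> D" "k \<in> K" "inv x = d \<otimes> k"
      using K(3)[OF subgroup.m_inv_closed[OF subgroup_fac x]] by blast
    have g: "d \<in> carrier G" "k \<in> carrier G" "x \<in> carrier G" using dk x DG XG K(2) by auto
    have "x = inv (d \<otimes> k)" unfolding dk(3)[symmetric] using g by simp
    then have "x = inv k \<otimes> inv d" using g by (simp add: inv_mult_group)
    then show ?thesis using dk subgroup.m_inv_closed[OF D(1)] by blast
  qed
  \<comment> \<open>Moving q to the right, p^-1 q p is an element of \<open>D\<close> times q, so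
    conjugation by \<open>D\<close> carries small elements into \<open>W\<close>.\<close>
  have Q: "inv p \<otimes> q \<otimes> p \<in> W" if p: "p \<in> D" and q: "q \<in> fac {j} \<inter> V0" for p q
  proof -
    have g: "p \<in> carrier G" "q \<in> carrier G" using p q DG XG by auto
    have "q \<otimes> p \<otimes> inv q \<in> D" using normalizesD[OF D(3) _ p] q by blast
    then have "inv p \<otimes> (q \<otimes> p \<otimes> inv q) \<in> D"
      using subgroup.m_closed[OF D(1)] subgroup.m_inv_closed[OF D(1) p] by blast
    moreover have "inv p \<otimes> q \<otimes> p = (inv p \<otimes> (q \<otimes> p \<otimes> inv q)) \<otimes> q" using g by (simp add: m_assoc)
    ultimately show ?thesis unfolding W_def using q by blast
  qed
  have CX: "(\<lambda>x. inv x) ` K \<subseteq> fac {j}" using K(2) subgroup.m_inv_closed[OF subgroup_fac] by auto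
  obtain V N where V: "subgroup V G" "V \<subseteq> W" "normalizes (fac {j}) V" "closedin T V"
    "openin T N" "\<one> \<in> N" "fac {j} \<inter> N \<subseteq> V"
    "\<forall>A. A \<subseteq> W \<and> normalizes (fac {j}) A \<longrightarrow> A \<subseteq> V"
    by (rule normal_core[OF subgroup_fac compactin_inv[OF K(1)] CX D(4) dec sW cW
          normalizes_self[OF subgroup_fac] XG V0'(2,5) Q])
  have "D \<subseteq> W"
  proof
    fix d assume d: "d \<in> D"
    then have "d = d \<otimes> \<one>" using DG by auto
    then show "d \<in> W" unfolding W_def using d subgroup.one_closed[OF sV0] by blast
  qed
  then have DV: "D \<subseteq> V" using V(8) D(3) by blast
  have Wf: "W \<subseteq> fac {j}" unfolding W_def using D(4) subgroup.m_closed[OF subgroup_fac] by auto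
  have "\<exists>d\<in>D. \<exists>u\<in>U. v = d \<otimes> u" if "v \<in> V" for v
  proof -
    have "v \<in> W" using that V(2) by blast
    then show ?thesis unfolding W_def using V0(2) by blast
  qed
  then show ?thesis
    using that[OF V(1) V(4) order_trans[OF V(2) Wf] V(3) _ _ V(5,6,7)] DV unfolding D_def by blast
qed

text \<open>
  Suppose that the intersection with the \<open>j\<close>-th factor is cocompact. The subgroups \<open>N V\<close> below, for
  open normal subgroups \<open>V\<close> of that factor containing the intersection, form a directed family of
  non-discrete normal subgroups of the \<open>i\<close>-th factor with intersection \<open>closed_pr S \<inter> fac {i}\<close>.
\<close>

lemma nondiscr_if_other_cocompact:
  assumes ij: "i \<in> S" "j \<in> S" "i \<noteq> j" "S \<subseteq> I"
    and cc: "cocompact_in (closed_pr S \<inter> fac {j}) (fac {j})"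
    and nd: "\<not> discr (closed_pr (S - {j}) \<inter> fac {i})"
  shows "\<not> discr (closed_pr S \<inter> fac {i})"
proof -
  define H where "H = closed_pr S"
  define D where "D = H \<inter> fac {j}"
  note H = closed_pr[of S, folded H_def]
  have D: "subgroup D G" "closedin T D" "normalizes (fac {j}) D" "D \<subseteq> fac {j}"
    using closed_pr_Int_factor[OF ij(4,2)] by (auto simp: D_def H_def)
  have I: "i \<in> I" "j \<in> I" using ij by auto
  have fG: "fac X \<subseteq> carrier G" for X by (rule fac_subset_carrier)
  obtain K where K: "compactin T K" "K \<subseteq> fac {j}" "\<And>x. x \<in> fac {j} \<Longrightarrow> \<exists>h\<in>D. \<exists>k\<in>K. x = h \<otimes> k"
    using cocompact_inE[OF cc] unfolding D_def H_def by blast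
  define HV where "HV V = {h \<otimes> v |h v. h \<in> H \<and> v \<in> V}" for V
  define \<V> where "\<V> = {V. subgroup V G \<and> closedin T V \<and> V \<subseteq> fac {j} \<and> normalizes (fac {j}) V \<and>
    D \<subseteq> V \<and> (\<exists>N. openin T N \<and> \<one> \<in> N \<and> fac {j} \<inter> N \<subseteq> V)}"
  have VD: "subgroup V G" "closedin T V" "V \<subseteq> fac {j}" "normalizes (fac {j}) V" "D \<subseteq> V"
    "\<exists>N. openin T N \<and> \<one> \<in> N \<and> fac {j} \<inter> N \<subseteq> V" if "V \<in> \<V>" for V
    using that unfolding \<V>_def by blast+
  have HnV: "normalizes H V" if V: "V \<in> \<V>" for V
  proof -
    have "pr {j} ` \<Gamma> \<subseteq> fac {j}" by (rule pr_image_fac[OF \<Gamma>_subset])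
    then have "normalizes (pr {j} ` \<Gamma>) V" by (rule normalizes_subset[OF VD(4)[OF V]])
    then have "normalizes (pr S ` \<Gamma>) V"
      using normalizes_pr_image_fac[OF \<Gamma>_subset VD(3)[OF V], of S] ij by simp
    then have "normalizes (cl (pr S ` \<Gamma>)) (cl V)" by (rule normalizes_closure_of)
    then show ?thesis using VD(2)[OF V] by (simp add: H_def closed_pr_def closure_of_closedin)
  qed
  have sHV: "subgroup (HV V) G" if V: "V \<in> \<V>" for V
    unfolding HV_def by (rule subgroup_mult_normalized[OF H(1) VD(1)[OF V] HnV[OF V]])
  have cHV: "closedin T (HV V)" if V: "V \<in> \<V>" for V
  proof -
    \<comment> \<open>As \<open>D\<close> lies in \<open>H\<close>, elements of \<open>V\<close>
      matter only modulo \<open>D\<close> and may be taken in the compact set \<open>K\<close>. This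
      makes \<open>HV V\<close> a closed set times a compact one.\<close>
    have "HV V = {h \<otimes> k |h k. h \<in> H \<and> k \<in> V \<inter> K}"
    proof (intro equalityI subsetI)
      fix x assume "x \<in> HV V"
      then obtain h v where x: "h \<in> H" "v \<in> V" "x = h \<otimes> v" unfolding HV_def by blast
      obtain d k where dk: "d \<in> D" "k \<in> K" "v = d \<otimes> k" using K(3)[of v] x(2) VD(3)[OF V] by blast
      have g: "h \<in> carrier G" "d \<in> carrier G" "k \<in> carrier G" using x dk H(6) D(4) K(2) fG by blast+
      have "k = inv d \<otimes> v" using dk g by simp
      then have "k \<in> V"
        using subgroup.m_closed[OF VD(1)[OF V]] subgroup.m_inv_closed[OF VD(1)[OF V]] dk(1) x(2) VD(5)[OF V] by auto
      moreover have "h \<otimes> d \<in> H" using x(1) dk(1) subgroup.m_closed[OF H(1)] by (simp add: D_def)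
      moreover have "x = (h \<otimes> d) \<otimes> k" using x dk g by (simp add: m_assoc)
      ultimately show "x \<in> {h \<otimes> k |h k. h \<in> H \<and> k \<in> V \<inter> K}" using dk(2) by blast
    qed (auto simp: HV_def)
    then show ?thesis
      using closedin_mult_compactin[OF H(2) closed_Int_compactin[OF VD(2)[OF V] K(1)]] by simp
  qed
  define N where "N V = HV V \<inter> fac {i}" for V
  have sN: "subgroup (N V) G" and cN: "closedin T (N V)" if V: "V \<in> \<V>" for V
    unfolding N_def using subgroups_Inter_pair[OF sHV[OF V] subgroup_fac] closedin_Int[OF cHV[OF V] closedin_fac]
    by auto
  have nN: "normalizes (fac {i}) (N V)" if V: "V \<in> \<V>" for V
  proof (rule normalizes_factor_closed[OF I(1) _ cN[OF V]])
    have "normalizes (pr S ` \<Gamma>) (HV V)" unfolding normalizes_def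
    proof (intro ballI)
      fix x y assume x: "x \<in> pr S ` \<Gamma>" and "y \<in> HV V"
      then obtain h v where y: "h \<in> H" "v \<in> V" "y = h \<otimes> v" unfolding HV_def by blast
      have xH: "x \<in> H" using x H(3) by blast
      have g: "x \<in> carrier G" "h \<in> carrier G" "v \<in> carrier G" using xH y H(6) VD(3)[OF V] fG by blast+
      have "x \<otimes> y \<otimes> inv x = (x \<otimes> h \<otimes> inv x) \<otimes> (x \<otimes> v \<otimes> inv x)" using g y by (simp add: m_assoc)
      then show "x \<otimes> y \<otimes> inv x \<in> HV V" unfolding HV_def
        using normalizesD[OF normalizes_self[OF H(1)] xH y(1)] normalizesD[OF HnV[OF V] xH y(2)] by blast
    qed
    moreover have "normalizes (pr {i} ` \<Gamma>) (fac {i})"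
      by (rule normalizes_subset[OF normalizes_self[OF subgroup_fac] pr_image_fac[OF \<Gamma>_subset]])
    then have "normalizes (pr S ` \<Gamma>) (fac {i})"
      using normalizes_pr_image_fac[OF \<Gamma>_subset order_refl, of "{i}" S] ij by simp
    ultimately have "normalizes (pr S ` \<Gamma>) (N V)" unfolding N_def by (rule normalizes_Int)
    then show "normalizes (pr {i} ` \<Gamma>) (N V)"
      using normalizes_pr_image_fac[OF \<Gamma>_subset, of "N V" "{i}" S] ij by (simp add: N_def)
  qed
  have fV: "fac {j} \<in> \<V>" unfolding \<V>_def
    using subgroup_fac closedin_fac D(4) normalizes_self[OF subgroup_fac] openin_topspace[of T] by auto
  \<comment> \<open>Dropping the coordinate j from a projected element of \<Gamma> means multiplying
    by an element of \<open>fac {j}\<close>. So the largest member \<open>N (fac {j})\<close>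
    contains the intersection assumed to be non-discrete.\<close>
  have "closed_pr (S - {j}) \<subseteq> HV (fac {j})" unfolding closed_pr_def
  proof (rule closure_of_minimal[OF _ cHV[OF fV]], rule image_subsetI)
    fix x assume x: "x \<in> \<Gamma>"
    then have xG: "x \<in> carrier G" using \<Gamma>_subset by blast
    have e: "(S - {j}) \<union> {j} = S" using ij by auto
    have "pr S x = pr (S - {j}) x \<otimes> pr {j} x" using pr_Un[OF xG, of "S - {j}" "{j}"] e by simp
    then have "pr (S - {j}) x = pr S x \<otimes> inv (pr {j} x)" using xG by (simp add: m_assoc)
    moreover have "pr S x \<in> H" using H(3) x by blast
    moreover have "inv (pr {j} x) \<in> fac {j}" using subgroup.m_inv_closed[OF subgroup_fac pr_in_fac[OF xG]] .
    ultimately show "pr (S - {j}) x \<in> HV (fac {j})" unfolding HV_def by blast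
  qed
  then have nE: "\<not> discr (N (fac {j}))" unfolding N_def
    using nd discr_subset[of "HV (fac {j}) \<inter> fac {i}" "closed_pr (S - {j}) \<inter> fac {i}"] by blast
  \<comment> \<open>\<open>V\<close> is open in \<open>fac {j}\<close> and contains the cocompact
    \<open>D\<close>, so finitely many translates of \<open>HV V\<close> cover
    \<open>HV (fac {j})\<close>. A discrete \<open>N V\<close> would make \<open>N (fac {j})\<close>
    discrete by \<open>discr_finite_extension\<close>.\<close>
  have nd: "\<not> discr (N V)" if V: "V \<in> \<V>" for V
  proof
    assume dN: "discr (N V)"
    obtain O' where O: "openin T O'" "\<one> \<in> O'" "fac {j} \<inter> O' \<subseteq> V" using VD(6)[OF V] by blast
    obtain U where U: "compact_open_subgroup U" "U \<subseteq> O'" using van_Dantzig[OF O(1,2)] .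
    obtain F where F: "finite F" "F \<subseteq> K" "\<And>k. k \<in> K \<Longrightarrow> \<exists>f\<in>F. k \<otimes> inv f \<in> U"
      using compact_finite_cosets[OF K(1) compact_open_subgroupD(1,2)[OF U(1)]] by blast
    let ?P = "\<lambda>f x. \<exists>h\<in>H. \<exists>v\<in>V. x = h \<otimes> v \<otimes> f"
    have cover: "\<exists>f\<in>F. ?P f x" if x: "x \<in> N (fac {j})" for x
    proof -
      obtain h v where v: "h \<in> H" "v \<in> fac {j}" "x = h \<otimes> v" using x unfolding N_def HV_def by blast
      obtain d k where dk: "d \<in> D" "k \<in> K" "v = d \<otimes> k" using K(3)[OF v(2)] by blast
      obtain f where f: "f \<in> F" "k \<otimes> inv f \<in> U" using F(3)[OF dk(2)] by blast
      have kf: "k \<in> fac {j}" "f \<in> fac {j}" using dk f F(2) K(2) by auto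
      have g: "h \<in> carrier G" "d \<in> carrier G" "k \<in> carrier G" "f \<in> carrier G"
        using v dk kf H(6) D(4) fG by blast+
      have "k \<otimes> inv f \<in> fac {j}" using kf subgroup_fac by (simp add: subgroup.m_closed subgroup.m_inv_closed)
      then have "k \<otimes> inv f \<in> V" using f(2) U(2) O(3) by blast
      then have "d \<otimes> (k \<otimes> inv f) \<in> V" using dk(1) VD(5)[OF V] subgroup.m_closed[OF VD(1)[OF V]] by blast
      moreover have "x = h \<otimes> (d \<otimes> (k \<otimes> inv f)) \<otimes> f" using v dk g by (simp add: m_assoc)
      ultimately show ?thesis using f(1) v(1) by blast
    qed
    have diff: "x \<otimes> inv y \<in> N V" if f: "f \<in> F" and x: "?P f x" and y: "?P f y"
      and xN: "x \<in> N (fac {j})" and yN: "y \<in> N (fac {j})" for f x y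
    proof -
      obtain h v where x': "h \<in> H" "v \<in> V" "x = h \<otimes> v \<otimes> f" using x by blast
      obtain k w where y': "k \<in> H" "w \<in> V" "y = k \<otimes> w \<otimes> f" using y by blast
      have "h \<otimes> v \<in> HV V" "k \<otimes> w \<in> HV V" using x' y' unfolding HV_def by blast+
      then have "(h \<otimes> v) \<otimes> inv (k \<otimes> w) \<in> HV V"
        using subgroup.m_closed[OF sHV[OF V]] subgroup.m_inv_closed[OF sHV[OF V]] by blast
      moreover have "h \<in> carrier G" "v \<in> carrier G" "k \<in> carrier G" "w \<in> carrier G" "f \<in> carrier G"
        using x' y' f F(2) K(2) H(6) VD(3)[OF V] fG by blast+
      then have "x \<otimes> inv y = (h \<otimes> v) \<otimes> inv (k \<otimes> w)" unfolding x'(3) y'(3)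
        by (simp add: m_assoc inv_mult_group)
      moreover have "x \<otimes> inv y \<in> fac {i}"
        by (intro subgroup.m_closed[OF subgroup_fac] subgroup.m_inv_closed[OF subgroup_fac])
          (use xN yN in \<open>auto simp: N_def\<close>)
      ultimately show ?thesis unfolding N_def by simp
    qed
    have EG: "N (fac {j}) \<subseteq> carrier G" unfolding N_def using fG by blast
    obtain C where C: "finite C" "C \<subseteq> N (fac {j})" "\<And>x. x \<in> N (fac {j}) \<Longrightarrow> \<exists>c\<in>C. x \<otimes> inv c \<in> N V"
    proof (rule subgroup_finite_cover[of "N V" F "N (fac {j})" ?P])
      show "subgroup (N V) G" "finite F" "N (fac {j}) \<subseteq> carrier G" by (rule sN[OF V], rule F(1), rule EG)
      show "\<exists>f\<in>F. ?P f x" if "x \<in> N (fac {j})" for x by (rule cover[OF that])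
      show "x \<otimes> inv y \<in> N V" if "f \<in> F" "?P f x" "?P f y" "x \<in> N (fac {j})" "y \<in> N (fac {j})" for f x y
        by (rule diff[OF that])
    qed (rule that)
    have "discr (N (fac {j}))"
      by (rule discr_finite_extension[OF sN[OF V] dN C(1) order_trans[OF C(2) EG] EG C(3)])
    then show False using nE by simp
  qed
  obtain C where C: "compactin T C" "fac {i} = generate G C" using factor_compactly_generated[OF I(1)] by blast
  have "\<not> discr (\<Inter>(N ` \<V>))"
  proof (rule qjnc_directed_Inter[OF factor_qjnc[OF I(1)] C(2,1)])
    show "N ` \<V> \<noteq> {}" using fV by blast
    show "subgroup M G \<and> M \<subseteq> fac {i} \<and> closedin T M \<and> normalizes (fac {i}) M \<and> \<not> discr M"
      if "M \<in> N ` \<V>" for M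
      using that sN cN nN nd by (auto simp: N_def)
    show "\<exists>L\<in>N ` \<V>. L \<subseteq> M \<inter> M'" if M: "M \<in> N ` \<V>" "M' \<in> N ` \<V>" for M M'
    proof -
      obtain V V' where V: "V \<in> \<V>" "V' \<in> \<V>" "M = N V" "M' = N V'" using M by blast
      obtain P P' where P: "openin T P" "\<one> \<in> P" "fac {j} \<inter> P \<subseteq> V" "openin T P'" "\<one> \<in> P'" "fac {j} \<inter> P' \<subseteq> V'"
        using VD(6)[OF V(1)] VD(6)[OF V(2)] by blast
      have "openin T (P \<inter> P') \<and> \<one> \<in> P \<inter> P' \<and> fac {j} \<inter> (P \<inter> P') \<subseteq> V \<inter> V'" using P by auto
      then have "V \<inter> V' \<in> \<V>" unfolding \<V>_def
        using subgroups_Inter_pair[OF VD(1)[OF V(1)] VD(1)[OF V(2)]] closedin_Int[OF VD(2)[OF V(1)] VD(2)[OF V(2)]]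
          VD(3,5)[OF V(1)] VD(5)[OF V(2)] normalizes_Int[OF VD(4)[OF V(1)] VD(4)[OF V(2)]] by blast
      moreover have "N (V \<inter> V') \<subseteq> M \<inter> M'" unfolding V(3,4) N_def HV_def by blast
      ultimately show ?thesis by blast
    qed
  qed
  moreover have "\<Inter>(N ` \<V>) \<subseteq> H \<inter> fac {i}"
  proof
    fix x assume x: "x \<in> \<Inter>(N ` \<V>)"
    have xN: "x \<in> N V" if "V \<in> \<V>" for V using x that by blast
    then have xi: "x \<in> fac {i}" using fV unfolding N_def by blast
    then have xG: "x \<in> carrier G" using fG by blast
    have "x \<in> H"
    proof (rule ccontr)
      assume xH: "x \<notin> H"
      \<comment> \<open>The elements y for which x y^-1 stays outside the closed set
        \<open>H\<close> form a neighbourhood of the identity. A \<open>V\<close> inside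
        \<open>D\<close> times this neighbourhood excludes x from \<open>HV V\<close>.\<close>
      let ?O = "{y \<in> carrier G. x \<otimes> inv y \<in> carrier G - H}"
      have "openin T (carrier G - H)" using H(2) by (auto simp: closedin_def)
      then have "openin T ?O" using xG by (intro openin_preimage continuous_intros) auto
      moreover have "\<one> \<in> ?O" using xG xH by auto
      ultimately obtain V N' where V: "subgroup V G" "closedin T V" "V \<subseteq> fac {j}" "normalizes (fac {j}) V"
        "D \<subseteq> V" "\<forall>v\<in>V. \<exists>d\<in>D. \<exists>u\<in>?O. v = d \<otimes> u" "openin T N'" "\<one> \<in> N'" "fac {j} \<inter> N' \<subseteq> V"
        unfolding D_def H_def by (rule cocompact_closed_pr_neighbourhood[OF ij(2,4) cc])
      have "V \<in> \<V>" unfolding \<V>_def using V by blast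
      then have "x \<in> HV V" using xN unfolding N_def by blast
      then obtain h v where hv: "h \<in> H" "v \<in> V" "x = h \<otimes> v" unfolding HV_def by blast
      obtain d u where du: "d \<in> D" "u \<in> ?O" "v = d \<otimes> u" using V(6) hv(2) by blast
      have g: "h \<in> carrier G" "d \<in> carrier G" "u \<in> carrier G" using hv du H(6) D(4) fG by blast+
      have "x \<otimes> inv u = h \<otimes> d" using hv du g by (simp add: m_assoc)
      moreover have "h \<otimes> d \<in> H" using hv du subgroup.m_closed[OF H(1)] by (auto simp: D_def)
      ultimately show False using du(2) by auto
    qed
    then show "x \<in> H \<inter> fac {i}" using xi by simp
  qed
  ultimately show ?thesis using discr_subset H_def by blast
qed

end

section \<open>Commutators and centralizers\<close>

context group begin

lemma commute_if_commutator_one: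
  assumes "x \<in> carrier G" "y \<in> carrier G" "x \<otimes> y \<otimes> inv x \<otimes> inv y = \<one>"
  shows "x \<otimes> y = y \<otimes> x"
proof -
  have "x \<otimes> y = (x \<otimes> y \<otimes> inv x \<otimes> inv y) \<otimes> (y \<otimes> x)" using assms(1,2) by (simp add: m_assoc)
  then show ?thesis unfolding assms(3) using assms(1,2) by simp
qed

lemma commutator_one_if_commute:
  assumes "x \<in> carrier G" "y \<in> carrier G" "x \<otimes> y = y \<otimes> x"
  shows "x \<otimes> y \<otimes> inv x \<otimes> inv y = \<one>"
  unfolding assms(3) using assms(1,2) by (simp add: m_assoc)

definition centralizer :: "'a set \<Rightarrow> 'a set" where
  "centralizer B = {x \<in> carrier G. \<forall>b\<in>B. x \<otimes> b = b \<otimes> x}"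

lemma subgroup_centralizer:
  assumes B: "B \<subseteq> carrier G"
  shows "subgroup (centralizer B) G"
proof
  show "centralizer B \<subseteq> carrier G" by (auto simp: centralizer_def)
  show "\<one> \<in> centralizer B" using B by (auto simp: centralizer_def subset_iff)
  fix x assume x: "x \<in> centralizer B"
  show "inv x \<in> centralizer B"
  proof -
    have "inv x \<otimes> b = b \<otimes> inv x" if b: "b \<in> B" for b
    proof -
      have g: "x \<in> carrier G" "b \<in> carrier G" "x \<otimes> b = b \<otimes> x" using x b B by (auto simp: centralizer_def)
      have "inv x \<otimes> b = inv x \<otimes> (b \<otimes> x) \<otimes> inv x" using g(1,2) by (simp add: m_assoc)
      also have "\<dots> = b \<otimes> inv x" unfolding g(3)[symmetric] using g(1,2) by (simp add: m_assoc)
      finally show ?thesis .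
    qed
    then show ?thesis using x by (auto simp: centralizer_def)
  qed
  fix y assume y: "y \<in> centralizer B"
  show "x \<otimes> y \<in> centralizer B"
  proof -
    have "x \<otimes> y \<otimes> b = b \<otimes> (x \<otimes> y)" if b: "b \<in> B" for b
    proof -
      have g: "x \<in> carrier G" "y \<in> carrier G" "b \<in> carrier G" "x \<otimes> b = b \<otimes> x" "y \<otimes> b = b \<otimes> y"
        using x y b B by (auto simp: centralizer_def)
      have "x \<otimes> y \<otimes> b = x \<otimes> (b \<otimes> y)" unfolding g(5)[symmetric] using g(1-3) by (simp add: m_assoc)
      also have "\<dots> = (b \<otimes> x) \<otimes> y" unfolding g(4)[symmetric] using g(1-3) by (simp add: m_assoc)
      finally show ?thesis using g(1-3) by (simp add: m_assoc)
    qed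
    then show ?thesis using x y by (auto simp: centralizer_def)
  qed
qed

lemma normalizes_centralizer:
  assumes X: "subgroup X G" and B: "B \<subseteq> carrier G" "normalizes X B"
  shows "normalizes X (centralizer B)"
  unfolding normalizes_def
proof (intro ballI)
  fix x c assume x: "x \<in> X" and c: "c \<in> centralizer B"
  have g: "x \<in> carrier G" "c \<in> carrier G" using subgroup.mem_carrier[OF X x] c by (auto simp: centralizer_def)
  have "x \<otimes> c \<otimes> inv x \<otimes> b = b \<otimes> (x \<otimes> c \<otimes> inv x)" if b: "b \<in> B" for b
  proof -
    have bG: "b \<in> carrier G" using b B by auto
    have "inv x \<otimes> b \<otimes> x \<in> B" by (rule normalizesD_inv[OF B(2) X x b])
    then have e: "c \<otimes> (inv x \<otimes> b \<otimes> x) = (inv x \<otimes> b \<otimes> x) \<otimes> c" using c by (simp add: centralizer_def)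
    have "x \<otimes> c \<otimes> inv x \<otimes> b = x \<otimes> (c \<otimes> (inv x \<otimes> b \<otimes> x)) \<otimes> inv x" using g bG by (simp add: m_assoc)
    also have "\<dots> = b \<otimes> (x \<otimes> c \<otimes> inv x)" unfolding e using g bG by (simp add: m_assoc)
    finally show ?thesis .
  qed
  then show "x \<otimes> c \<otimes> inv x \<in> centralizer B" using g by (simp add: centralizer_def)
qed

end

context tdlc_group begin

definition jnc :: "'a set \<Rightarrow> bool" where
  "jnc X \<longleftrightarrow> subgroup X G \<and> closedin T X \<and> \<not> compactin T X \<and>
     (\<forall>N. subgroup N G \<and> N \<subseteq> X \<and> closedin T N \<and> normalizes X N \<longrightarrow> N = {\<one>} \<or> cocompact_in N X)"

lemma discr_one: "discr {\<one>}"
  unfolding discr_def using openin_topspace[of T] by (intro exI[of _ "carrier G"]) auto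

lemma jnc_imp_qjnc: "jnc X \<Longrightarrow> qjnc X"
  unfolding jnc_def qjnc_def using discr_one by blast

lemma qjnc_no_central_product:
  assumes X: "qjnc X" and F: "subgroup F G" "F \<subseteq> X" "closedin T F" "normalizes X F" "\<not> discr F"
    and B: "B \<subseteq> X" "cocompact_in B X" and comm: "\<And>f b. f \<in> F \<Longrightarrow> b \<in> B \<Longrightarrow> f \<otimes> b = b \<otimes> f"
  shows False
  by (rule qjnc_no_centralized_neighbourhood[OF X F B, of "carrier G"])
    (use comm openin_topspace[of T] in auto)

lemma commute_closure_of:
  assumes "\<And>x y. x \<in> A \<Longrightarrow> y \<in> B \<Longrightarrow> x \<otimes> y = y \<otimes> x" "A \<subseteq> carrier G" "B \<subseteq> carrier G"
    and "a \<in> cl A" "b \<in> cl B"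
  shows "a \<otimes> b = b \<otimes> a"
proof (rule commute_if_commutator_one)
  show g: "a \<in> carrier G" "b \<in> carrier G" using assms(4,5) closure_of_subset_carrier by blast+
  have "x \<otimes> y \<otimes> inv x \<otimes> inv y \<in> {\<one>}" if "x \<in> A" "y \<in> B" for x y
    using commutator_one_if_commute[of x y] assms(1)[OF that] that assms(2,3) by auto
  then have "a \<otimes> b \<otimes> inv a \<otimes> inv b \<in> {\<one>}"
    by (rule commutators_closure_of[OF _ _ assms(4,5)]) (auto intro: compactin_closedin)
  then show "a \<otimes> b \<otimes> inv a \<otimes> inv b = \<one>" by simp
qed

end

context tdlc_product begin

lemma commutator_pr:
  assumes f: "f \<in> fac {j}" and c: "c \<in> carrier G"
  shows "f \<otimes> c \<otimes> inv f \<otimes> inv c = f \<otimes> pr {j} c \<otimes> inv f \<otimes> inv (pr {j} c)"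
proof -
  have fG: "f \<in> carrier G" using facD(1)[OF f] .
  \<comment> \<open>\<open>pr UNIV\<close> is the identity on the carrier, because only indices in
    \<open>I\<close> count. With it \<open>conj_fac\<close> applies to any index j.\<close>
  have "c \<otimes> inv f \<otimes> inv c = pr UNIV c \<otimes> inv f \<otimes> inv (pr UNIV c)"
    using pr_pr[OF c, of UNIV I] pr_pr[OF c, of I UNIV] pr_all by (simp add: c)
  also have "\<dots> = pr {j} c \<otimes> inv f \<otimes> inv (pr {j} c)"
    by (rule conj_fac[OF c subgroup.m_inv_closed[OF subgroup_fac f]]) simp
  finally have "f \<otimes> (c \<otimes> inv f \<otimes> inv c) = f \<otimes> (pr {j} c \<otimes> inv f \<otimes> inv (pr {j} c))" by simp
  then show ?thesis using fG c by (simp add: m_assoc)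
qed

end

section \<open>Non-discrete intersections of closed projections with the factors\<close>

context product_lattice begin

text \<open>For b = \<open>pr {j} m\<close> the commutator of f and b equals that of f and m. It
  lies in \<open>fac {j}\<close>, and also in \<open>M\<close> because \<open>closed_pr S\<close>
  normalizes \<open>M\<close>. So commutators turn projections of \<open>M\<close> to a factor into
  elements of \<open>M\<close> inside that factor; continuity extends this to the closure.\<close>

lemma closed_pr_commutators:
  assumes S: "j \<in> S" and M: "closedin T M" "M \<subseteq> carrier G" "subgroup M G" "normalizes (pr S ` \<Gamma>) M"
    and f: "f \<in> closed_pr S \<inter> fac {j}" and b: "b \<in> cl (pr {j} ` M)"
  shows "f \<otimes> b \<otimes> inv f \<otimes> inv b \<in> M \<inter> fac {j}"
proof (rule commutators_closure_of[of "closed_pr S \<inter> fac {j}" "pr {j} ` M"])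
  show "closedin T (M \<inter> fac {j})" by (rule closedin_Int[OF M(1) closedin_fac])
  have "closedin T (closed_pr S \<inter> fac {j})" by (rule closedin_Int[OF closed_pr(2) closedin_fac])
  then show "f \<in> cl (closed_pr S \<inter> fac {j})" using f by (simp add: closure_of_closedin)
  show "b \<in> cl (pr {j} ` M)" by (rule b)
  fix f b assume f: "f \<in> closed_pr S \<inter> fac {j}" and "b \<in> pr {j} ` M"
  then obtain m where m: "m \<in> M" "b = pr {j} m" by blast
  have mG: "m \<in> carrier G" using m M(2) by blast
  have "normalizes (closed_pr S) M"
    using normalizes_closure_of[OF M(4)] M(1) by (simp add: closed_pr_def closure_of_closedin)
  then have "f \<otimes> m \<otimes> inv f \<in> M" using normalizesD f m by blast
  then have "f \<otimes> m \<otimes> inv f \<otimes> inv m \<in> M" using m M(3) by (simp add: subgroup.m_closed subgroup.m_inv_closed)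
  then have "f \<otimes> b \<otimes> inv f \<otimes> inv b \<in> M" using commutator_pr[of f j m] f mG m(2) by simp
  moreover have "b \<in> fac {j}" using m(2) mG by simp
  then have "f \<otimes> b \<otimes> inv f \<otimes> inv b \<in> fac {j}"
    using f subgroup_fac by (simp add: subgroup.m_closed subgroup.m_inv_closed)
  ultimately show "f \<otimes> b \<otimes> inv f \<otimes> inv b \<in> M \<inter> fac {j}" by simp
qed

lemma factor_no_discrete_commutators:
  assumes j: "j \<in> I" and F: "subgroup F G" "F \<subseteq> fac {j}" "closedin T F" "normalizes (fac {j}) F" "\<not> discr F"
    and B: "subgroup B G" "B \<subseteq> fac {j}" "closedin T B" "cocompact_in B (fac {j})"
    and D: "discr D" "\<And>f b. f \<in> F \<Longrightarrow> b \<in> B \<Longrightarrow> f \<otimes> b \<otimes> inv f \<otimes> inv b \<in> D"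
  shows False
proof -
  obtain C where C: "compactin T C" "fac {j} = generate G C" using factor_compactly_generated[OF j] by blast
  show False by (rule qjnc_no_discrete_commutators[OF factor_qjnc[OF j] C(2,1) F B D])
qed

lemma closure_pr_factor:
  assumes j: "j \<in> I" "j \<in> S" and M: "subgroup M G" "M \<subseteq> carrier G" "normalizes (pr S ` \<Gamma>) M"
  shows "subgroup (cl (pr {j} ` M)) G" "cl (pr {j} ` M) \<subseteq> fac {j}" "closedin T (cl (pr {j} ` M))"
    "normalizes (fac {j}) (cl (pr {j} ` M))" "pr {j} ` M \<subseteq> cl (pr {j} ` M)"
proof -
  have MG: "pr {j} ` M \<subseteq> fac {j}" by (rule pr_image_fac[OF M(2)])
  show "subgroup (cl (pr {j} ` M)) G" by (rule subgroup_closure_of[OF subgroup_pr_image[OF M(1)]])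
  show "cl (pr {j} ` M) \<subseteq> fac {j}" by (rule closure_of_minimal[OF MG closedin_fac])
  show "closedin T (cl (pr {j} ` M))" by simp
  show "pr {j} ` M \<subseteq> cl (pr {j} ` M)"
    by (rule closure_of_superset[OF order_trans[OF MG fac_subset_carrier]])
  have "normalizes (pr {j} ` \<Gamma>) (pr {j} ` M)" unfolding normalizes_def
  proof (intro ballI)
    fix x y assume "x \<in> pr {j} ` \<Gamma>" "y \<in> pr {j} ` M"
    then obtain g m where g: "g \<in> \<Gamma>" "x = pr {j} g" "m \<in> M" "y = pr {j} m" by blast
    have gG: "g \<in> carrier G" "m \<in> carrier G" using g \<Gamma>_subset M(2) by auto
    have "pr S g \<otimes> m \<otimes> inv (pr S g) \<in> M" using normalizesD[OF M(3)] g by blast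
    then have "pr {j} (pr S g \<otimes> m \<otimes> inv (pr S g)) \<in> pr {j} ` M" by blast
    moreover have "pr {j} (pr S g \<otimes> m \<otimes> inv (pr S g)) = x \<otimes> y \<otimes> inv x"
      using gG j g by (simp add: pr_conj pr_pr)
    ultimately show "x \<otimes> y \<otimes> inv x \<in> pr {j} ` M" by simp
  qed
  then show "normalizes (fac {j}) (cl (pr {j} ` M))" by (rule normalizes_factor[OF j(1)])
qed

text \<open>The induction hypothesis enters twice: for \<open>S - {i}\<close> it provides the
  non-discrete group \<open>F\<close> whose commutators with the projection of \<open>M\<close> fall
  into \<open>H \<inter> fac {j}\<close>, and for \<open>S - {j}\<close> the non-discrete
  intersection with \<open>fac {i}\<close> that \<open>nondiscr_if_other_cocompact\<close> transfers
  to \<open>S\<close>. A singleton \<open>S\<close> falls under the case of discrete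
  \<open>M\<close>, as \<open>M\<close> is then trivial.\<close>

lemma nondiscr_closed_pr_Int_factor:
  assumes irr3: "\<And>S. S \<subset> I \<Longrightarrow> S \<noteq> {} \<Longrightarrow> \<not> discr (pr S ` \<Gamma>)" and S: "S \<subset> I"
  shows "\<forall>i\<in>S. \<not> discr (closed_pr S \<inter> fac {i})"
proof -
  have "finite S" using S finite_I finite_subset by blast
  then show ?thesis using S
  proof (induction rule: finite_psubset_induct)
    case (psubset S)
    show ?case
    proof (intro ballI notI)
      fix i assume i: "i \<in> S" and Di: "discr (closed_pr S \<inter> fac {i})"
      have SI: "S \<subseteq> I" "i \<in> I" "S - {i} \<subset> I" using psubset.prems i by auto
      define H where "H = closed_pr S"
      note H = closed_pr[of S, folded H_def]
      define M where "M = H \<inter> fac (S - {i})"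
      have "\<not> discr (pr S ` \<Gamma>)" using irr3 psubset.prems i by blast
      then have ndH: "\<not> discr H" using discr_subset H(3) by blast
      have nHH: "normalizes (pr S ` \<Gamma>) H" by (rule normalizes_subset[OF normalizes_self[OF H(1)] H(3)])
      have sM: "subgroup M G" "closedin T M" unfolding M_def
        using subgroups_Inter_pair[OF H(1) subgroup_fac] closedin_Int[OF H(2) closedin_fac] by auto
      have MG: "M \<subseteq> carrier G" using sM(1) subgroup.subset by blast
      have "normalizes (pr (S - {i}) ` \<Gamma>) (fac (S - {i}))"
        by (rule normalizes_subset[OF normalizes_self[OF subgroup_fac] pr_image_fac[OF \<Gamma>_subset]])
      then have "normalizes (pr S ` \<Gamma>) (fac (S - {i}))"
        using normalizes_pr_image_fac[OF \<Gamma>_subset order_refl, of "S - {i}" S] by blast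
      with nHH have "normalizes (pr S ` \<Gamma>) M" unfolding M_def by (rule normalizes_Int)
      \<comment> \<open>Elements of \<open>M\<close> have trivial coordinate i, so the coordinate i
        of \<Gamma> does not act on them and \<open>M\<close> is invariant under the smaller
        projection.\<close>
      then have nM': "normalizes (pr (S - {i}) ` \<Gamma>) M"
        using normalizes_pr_image_fac[OF \<Gamma>_subset, of M "S - {i}" S] by (auto simp: M_def)
      show False
      proof (cases "discr M")
        case True
        obtain CA CB where C: "compactin T CA" "fac {i} = generate G CA" "compactin T CB" "fac (S - {i}) = generate G CB"
          using fac_compactly_generated[of "{i}"] fac_compactly_generated[of "S - {i}"] SI by blast
        have AB: "{i} \<union> (S - {i}) = S" "{i} \<inter> (S - {i}) = {}" using i by auto
        obtain V N where V: "subgroup V G" "compactin T V" "V \<subseteq> H" "normalizes H V"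
            "openin T N" "\<one> \<in> N" "H \<inter> N \<subseteq> V"
          by (rule two_factors_compact_normal[OF AB H(1,2,4,5) C Di[folded H_def] True[unfolded M_def]])
        have "\<not> discr V" using discr_if_locally_contained[OF _ V(5,6,7)] ndH by blast
        then obtain j where j: "j \<in> S" "\<not> discr (pr {j} ` V)"
          using nondiscr_pr[OF SI(1) order_trans[OF V(3) H(4)]] by blast
        have jI: "j \<in> I" using j SI by auto
        have VG: "V \<subseteq> carrier G" using V(1) subgroup.subset by blast
        have c: "compactin T (pr {j} ` V)" by (rule image_compactin[OF V(2) pr_cont])
        then have e: "cl (pr {j} ` V) = pr {j} ` V" by (intro closure_of_closedin compactin_closedin)
        note P = closure_pr_factor[OF jI j(1) V(1) VG normalizes_subset[OF V(4) H(3)], unfolded e]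
        show False using qjnc_compact_normal[OF factor_qjnc[OF jI] P(1,2) c P(4)] j(2) by simp
      next
        case False
        have MS: "M \<subseteq> fac (S - {i})" by (simp add: M_def)
        obtain j where j: "j \<in> S - {i}" "\<not> discr (pr {j} ` M)"
          using nondiscr_pr[of "S - {i}" M] SI MS False by blast
        have jI: "j \<in> I" "j \<in> S" "S - {i} \<subset> S" "S - {j} \<subset> S" "S - {j} \<subset> I" "i \<in> S - {j}" "S - {i} \<subseteq> I"
          using j SI i by auto
        define F where "F = closed_pr (S - {i}) \<inter> fac {j}"
        have nF: "\<not> discr F" using psubset.IH[OF jI(3) SI(3)] j(1) unfolding F_def by blast
        note F = closed_pr_Int_factor[OF jI(7) j(1), folded F_def]
        note P = closure_pr_factor[OF jI(1) j(1) sM(1) MG nM']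
        have "\<not> discr (cl (pr {j} ` M))" using discr_subset[OF _ P(5)] j(2) by blast
        then have cP: "cocompact_in (cl (pr {j} ` M)) (fac {j})"
          by (rule qjncD(5)[OF factor_qjnc[OF jI(1)] P(1-4)])
        have Fj: "F \<subseteq> fac {j}" by (simp add: F_def)
        have "\<not> discr (H \<inter> fac {j})"
        proof
          assume d: "discr (H \<inter> fac {j})"
          have "f \<otimes> b \<otimes> inv f \<otimes> inv b \<in> H \<inter> fac {j}" if "f \<in> F" "b \<in> cl (pr {j} ` M)" for f b
            using closed_pr_commutators[OF j(1) sM(2) MG sM(1) nM' _ that(2)] that(1) by (auto simp: F_def M_def)
          then show False
            by (rule factor_no_discrete_commutators[OF jI(1) F(1) Fj F(2,3) nF P(1,2,3) cP d])
        qed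
        then have "cocompact_in (H \<inter> fac {j}) (fac {j})"
          using qjncD(5)[OF factor_qjnc[OF jI(1)] closed_pr_Int_factor(1)[OF SI(1) jI(2)] _
              closed_pr_Int_factor(2,3)[OF SI(1) jI(2)]] by (simp add: H_def)
        moreover have "\<not> discr (closed_pr (S - {j}) \<inter> fac {i})"
          using psubset.IH[OF jI(4,5)] jI(6) by blast
        moreover have "i \<noteq> j" using j by auto
        ultimately show False
          using nondiscr_if_other_cocompact[OF i jI(2) _ SI(1)] Di unfolding H_def by blast
      qed
    qed
  qed
qed

section \<open>Virtual product decompositions of the lattice\<close>

definition finite_index_in :: "'a set \<Rightarrow> bool" where
  "finite_index_in \<Lambda> \<longleftrightarrow> (\<exists>F. finite F \<and> F \<subseteq> \<Gamma> \<and> (\<forall>x\<in>\<Gamma>. \<exists>f\<in>F. x \<otimes> inv f \<in> \<Lambda>))"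

definition product_part :: "'i set \<Rightarrow> 'i set \<Rightarrow> 'a set" where
  "product_part P S = {a \<otimes> b |a b. a \<in> fac P \<inter> \<Gamma> \<and> b \<in> fac S \<inter> \<Gamma>}"

text \<open>Finitely many translates of \<open>\<Lambda>\<close> cover \<Gamma>, so
  \<open>\<Lambda>\<close> is cocompact in the product and its projection is cocompact in the
  factor. A trivial projection would make the non-compact factor compact.\<close>

lemma pr_finite_index_nontrivial:
  assumes \<Lambda>: "finite_index_in \<Lambda>" "\<Lambda> \<subseteq> \<Gamma>" and j: "j \<in> I"
  shows "\<not> pr {j} ` \<Lambda> \<subseteq> {\<one>}"
proof
  assume tr: "pr {j} ` \<Lambda> \<subseteq> {\<one>}"
  obtain F where F: "finite F" "F \<subseteq> \<Gamma>" "\<And>x. x \<in> \<Gamma> \<Longrightarrow> \<exists>f\<in>F. x \<otimes> inv f \<in> \<Lambda>"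
    using \<Lambda>(1) unfolding finite_index_in_def by blast
  obtain K where K: "compactin T K" "K \<subseteq> carrier G" "\<And>x. x \<in> carrier G \<Longrightarrow> \<exists>h\<in>\<Gamma>. \<exists>k\<in>K. x = h \<otimes> k"
    using cocompact_inE[OF cocompact_\<Gamma>] by blast
  have FG: "F \<subseteq> carrier G" using F \<Gamma>_subset by blast
  have "cocompact_in \<Lambda> (carrier G)" unfolding cocompact_in_def
  proof (intro exI conjI ballI)
    have "compactin T F" using F(1) FG by (simp add: finite_imp_compactin)
    then show c: "compactin T {f \<otimes> k |f k. f \<in> F \<and> k \<in> K}" by (rule compactin_mult[OF _ K(1)])
    then show "{f \<otimes> k |f k. f \<in> F \<and> k \<in> K} \<subseteq> carrier G" by (rule compactin_subset_carrier)
    fix x assume x: "x \<in> carrier G"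
    obtain h k where hk: "h \<in> \<Gamma>" "k \<in> K" "x = h \<otimes> k" using K(3)[OF x] by blast
    obtain f where f: "f \<in> F" "h \<otimes> inv f \<in> \<Lambda>" using F(3)[OF hk(1)] by blast
    have "h \<in> carrier G" "f \<in> carrier G" "k \<in> carrier G" using hk f FG K(2) \<Gamma>_subset by auto
    then have "x = (h \<otimes> inv f) \<otimes> (f \<otimes> k)" using hk by (simp add: m_assoc)
    then show "\<exists>h\<in>\<Lambda>. \<exists>k\<in>{f \<otimes> k |f k. f \<in> F \<and> k \<in> K}. x = h \<otimes> k" using f hk by blast
  qed
  then have "cocompact_in (pr {j} ` \<Lambda>) (pr {j} ` carrier G)"
    using \<Lambda>(2) \<Gamma>_subset by (intro cocompact_in_pr) auto
  moreover have "pr {j} ` carrier G = fac {j}" using pr_image_fac_eq[of "{j}" I] j by simp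
  ultimately have "cocompact_in {\<one>} (fac {j})" using cocompact_in_mono[OF _ tr] by simp
  then have "compactin T (fac {j})"
    using compactin_if_cocompact_in[of "{\<one>}" "fac {j}"] closedin_fac by simp
  then show False using qjncD(3)[OF factor_qjnc[OF j]] by simp
qed

text \<open>Let \<open>U\<close> meet the discrete projection trivially. Elements of \<Gamma>
  projecting into \<open>U\<close> then have trivial coordinates in \<open>S\<close>, so over
  \<open>U\<close> the lattice consists of its elements in \<open>fac (I - S)\<close>. Intersecting
  with the open preimage of \<open>U\<close> preserves cocompactness by
  \<open>cocompact_in_Int_open\<close>.\<close>

lemma cocompact_kernel:
  assumes S: "S \<subseteq> I" and d: "discr (pr S ` \<Gamma>)"
  shows "cocompact_in (fac (I - S) \<inter> \<Gamma>) (fac (I - S))"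
proof -
  obtain U where U: "compact_open_subgroup U" "U \<inter> pr S ` \<Gamma> \<subseteq> {\<one>}" using discrE[OF d] .
  note U' = compact_open_subgroupD[OF U(1)]
  define PU where "PU = {x \<in> carrier G. pr S x \<in> U}"
  have PU: "subgroup PU G" "openin T PU" unfolding PU_def
    by (rule subgroup_pr_preimage[OF U'(1)], rule openin_pr_preimage[OF U'(2)])
  have "closedin T (carrier G)" using closedin_topspace[of T] by simp
  then have "cocompact_in (\<Gamma> \<inter> PU) (carrier G \<inter> PU)"
    by (rule cocompact_in_Int_open[OF subgroup_\<Gamma> \<Gamma>_subset subgroup_self _ cocompact_\<Gamma> PU])
  then have "cocompact_in (pr (I - S) ` (\<Gamma> \<inter> PU)) (pr (I - S) ` (carrier G \<inter> PU))"
    by (rule cocompact_in_pr) (use \<Gamma>_subset in auto)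
  moreover have "pr (I - S) ` (carrier G \<inter> PU) = fac (I - S)"
  proof (intro equalityI subsetI)
    fix y assume y: "y \<in> fac (I - S)"
    then have "pr S y = \<one>" by (rule fac_disjoint) auto
    then show "y \<in> pr (I - S) ` (carrier G \<inter> PU)"
      using facD[OF y] U'(5) by (intro image_eqI[of _ _ y]) (auto simp: PU_def)
  qed auto
  moreover have "pr (I - S) ` (\<Gamma> \<inter> PU) \<subseteq> fac (I - S) \<inter> \<Gamma>"
  proof (rule image_subsetI)
    fix g assume g: "g \<in> \<Gamma> \<inter> PU"
    then have gG: "g \<in> carrier G" and 1: "pr S g = \<one>" using \<Gamma>_subset U(2) by (auto simp: PU_def)
    have e: "S \<union> (I - S) = I" using S by auto
    have "g = pr S g \<otimes> pr (I - S) g" using pr_Un[OF gG, of S "I - S"] e pr_all[OF gG] by simp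
    then have "pr (I - S) g = g" using 1 gG by simp
    then show "pr (I - S) g \<in> fac (I - S) \<inter> \<Gamma>" using pr_in_fac[OF gG, of "I - S"] g by auto
  qed
  ultimately show ?thesis using cocompact_in_mono by simp
qed

text \<open>Splitting both projections of x gives x = (a b)(k l) with a b in the product part and k
  l in a compact set. Since k l is also in \<Gamma>, it is one of finitely many elements.\<close>

lemma finite_index_product_part:
  assumes PS: "P \<union> S = I" "P \<inter> S = {}"
    and cc: "cocompact_in (fac P \<inter> \<Gamma>) (fac P)" "cocompact_in (fac S \<inter> \<Gamma>) (fac S)"
  shows "finite_index_in (product_part P S)"
proof -
  obtain K where K: "compactin T K" "K \<subseteq> fac P" "\<And>x. x \<in> fac P \<Longrightarrow> \<exists>h\<in>fac P \<inter> \<Gamma>. \<exists>k\<in>K. x = h \<otimes> k"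
    using cocompact_inE[OF cc(1)] by blast
  obtain L where L: "compactin T L" "L \<subseteq> fac S" "\<And>x. x \<in> fac S \<Longrightarrow> \<exists>h\<in>fac S \<inter> \<Gamma>. \<exists>k\<in>L. x = h \<otimes> k"
    using cocompact_inE[OF cc(2)] by blast
  have fin: "finite (\<Gamma> \<inter> {k \<otimes> l |k l. k \<in> K \<and> l \<in> L})"
    by (rule finite_discr_Int_compact[OF subgroup_\<Gamma> discr_\<Gamma> compactin_mult[OF K(1) L(1)]])
  have "\<exists>f\<in>\<Gamma> \<inter> {k \<otimes> l |k l. k \<in> K \<and> l \<in> L}. x \<otimes> inv f \<in> product_part P S" if x: "x \<in> \<Gamma>" for x
  proof -
    have xG: "x \<in> carrier G" using x \<Gamma>_subset by blast
    obtain a k where ak: "a \<in> fac P \<inter> \<Gamma>" "k \<in> K" "pr P x = a \<otimes> k" using K(3)[OF pr_in_fac[OF xG]] by blast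
    obtain b l where bl: "b \<in> fac S \<inter> \<Gamma>" "l \<in> L" "pr S x = b \<otimes> l" using L(3)[OF pr_in_fac[OF xG]] by blast
    have g: "a \<in> carrier G" "k \<in> carrier G" "b \<in> carrier G" "l \<in> carrier G"
      using ak bl K(2) L(2) fac_subset_carrier by blast+
    have kb: "k \<otimes> b = b \<otimes> k" by (rule fac_commute[OF _ _ PS(2)]) (use ak bl K(2) in auto)
    have "x = pr P x \<otimes> pr S x" using pr_Un[OF xG PS(2)] PS(1) pr_all[OF xG] by simp
    also have "\<dots> = a \<otimes> (k \<otimes> b) \<otimes> l" unfolding ak(3) bl(3) using g by (simp add: m_assoc)
    also have "\<dots> = (a \<otimes> b) \<otimes> (k \<otimes> l)" unfolding kb using g by (simp add: m_assoc)
    finally have xe: "x = (a \<otimes> b) \<otimes> (k \<otimes> l)" .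
    have ab: "a \<otimes> b \<in> product_part P S" unfolding product_part_def using ak bl by blast
    have "a \<otimes> b \<in> \<Gamma>" using ak bl subgroup.m_closed[OF subgroup_\<Gamma>] by blast
    then have "inv (a \<otimes> b) \<otimes> x \<in> \<Gamma>"
      using x subgroup.m_closed[OF subgroup_\<Gamma>] subgroup.m_inv_closed[OF subgroup_\<Gamma>] by blast
    moreover have "inv (a \<otimes> b) \<otimes> x = k \<otimes> l" using xe g by simp
    ultimately have "k \<otimes> l \<in> \<Gamma> \<inter> {k \<otimes> l |k l. k \<in> K \<and> l \<in> L}" using ak(2) bl(2) by auto
    moreover have "x \<otimes> inv (k \<otimes> l) = a \<otimes> b" using xe g by (simp add: m_assoc)
    ultimately show ?thesis using ab by (metis (no_types, lifting))
  qed
  then show ?thesis unfolding finite_index_in_def using fin by blast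
qed

lemma fac_Int_\<Gamma>:
  "subgroup (fac S \<inter> \<Gamma>) G" "closedin T (fac S \<inter> \<Gamma>)" "discr (fac S \<inter> \<Gamma>)"
  using subgroups_Inter_pair[OF subgroup_fac subgroup_\<Gamma>] discr_subset[OF discr_\<Gamma>]
    closedin_Int[OF closedin_fac discr_subgroup_closedin[OF subgroup_\<Gamma> discr_\<Gamma>]] by auto

lemma normalizes_fac_Int_\<Gamma>:
  assumes "S \<subseteq> I"
  shows "normalizes (pr S ` \<Gamma>) (fac S \<inter> \<Gamma>)"
proof -
  have "pr I x = x" if "x \<in> \<Gamma>" for x using pr_all[OF subsetD[OF \<Gamma>_subset that]] .
  then have "pr I ` \<Gamma> = \<Gamma>" by simp
  then have "normalizes (pr I ` \<Gamma>) \<Gamma>" using normalizes_self[OF subgroup_\<Gamma>] by simp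
  moreover have "normalizes (pr S ` \<Gamma>) (fac S)"
    by (rule normalizes_subset[OF normalizes_self[OF subgroup_fac] pr_image_fac[OF \<Gamma>_subset]])
  then have "normalizes (pr I ` \<Gamma>) (fac S)"
    using normalizes_pr_image_fac[OF \<Gamma>_subset order_refl assms] by simp
  ultimately have "normalizes (pr I ` \<Gamma>) (fac S \<inter> \<Gamma>)" by (intro normalizes_Int)
  then show ?thesis using normalizes_pr_image_fac[OF \<Gamma>_subset Int_lower1 assms, of \<Gamma>] by simp
qed

lemma discr_complement:
  assumes S: "S \<subseteq> I" and d: "discr (pr S ` \<Gamma>)"
  shows "discr (pr (I - S) ` \<Gamma>)"
proof (rule ccontr)
  define P where "P = I - S"
  assume nd: "\<not> discr (pr (I - S) ` \<Gamma>)"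
  define B where "B = fac P \<inter> \<Gamma>"
  have B: "subgroup B G" "closedin T B" "B \<subseteq> fac P" "discr B"
    unfolding B_def using fac_Int_\<Gamma> by auto
  have BG: "B \<subseteq> carrier G" using B(1) subgroup.subset by blast
  have cB: "cocompact_in B (fac P)" unfolding B_def P_def by (rule cocompact_kernel[OF S d])
  obtain C0 where C0: "compactin T C0" "fac P = generate G C0"
    using fac_compactly_generated[of P] by (auto simp: P_def)
  obtain C where C: "compactin T C" "B = generate G C"
    using compact_generation_cocompact[OF C0 B(1,2,3) cB] .
  have sP: "subgroup (pr P ` \<Gamma>) G" by (rule subgroup_pr_image[OF subgroup_\<Gamma>])
  have PG: "pr P ` \<Gamma> \<subseteq> carrier G" using sP subgroup.subset by blast
  have nB: "normalizes (pr P ` \<Gamma>) B" unfolding B_def by (rule normalizes_fac_Int_\<Gamma>) (simp add: P_def)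
  have CB: "C \<subseteq> B" unfolding C(2) by (auto intro: generate.incl)
  \<comment> \<open>\<open>B\<close> is normalized by the projection of \<Gamma>, so commutators
    with it fall into \<open>B\<close>, which is discrete. Elements of the projection close to the
    identity therefore centralize \<open>B\<close>.\<close>
  have comm: "f \<otimes> c \<otimes> inv f \<otimes> inv c \<in> B" if "f \<in> pr P ` \<Gamma>" "c \<in> C" for f c
    using normalizesD[OF nB that(1), of c] that CB subgroup.m_closed[OF B(1)] subgroup.m_inv_closed[OF B(1)] by blast
  obtain U where U: "openin T U" "\<one> \<in> U" "\<And>f b. f \<in> pr P ` \<Gamma> \<inter> U \<Longrightarrow> b \<in> generate G C \<Longrightarrow> f \<otimes> b = b \<otimes> f"
  proof (rule commuting_neighbourhood[OF C(1) B(4) PG])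
    show "f \<otimes> c \<otimes> inv f \<otimes> inv c \<in> B" if "f \<in> pr P ` \<Gamma>" "c \<in> C" for f c by (rule comm[OF that])
  qed (rule that)
  define M where "M = pr P ` \<Gamma> \<inter> centralizer B"
  have M: "subgroup M G" "normalizes (pr P ` \<Gamma>) M"
    unfolding M_def
    by (rule subgroups_Inter_pair[OF sP subgroup_centralizer[OF BG]],
        rule normalizes_Int[OF normalizes_self[OF sP] normalizes_centralizer[OF sP BG nB]])
  have MG: "M \<subseteq> carrier G" using M(1) subgroup.subset by blast
  have "pr P ` \<Gamma> \<inter> U \<subseteq> M" using U(3) PG C(2) unfolding M_def centralizer_def by blast
  then have ndM: "\<not> discr M" using discr_if_locally_contained[OF _ U(1,2)] nd unfolding P_def by blast
  have "M \<subseteq> fac P" unfolding M_def using pr_image_fac[OF \<Gamma>_subset] by blast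
  \<comment> \<open>Quasi just-non-compactness is available only for single factors, so
    \<open>M\<close> is projected to a coordinate where it remains non-discrete.\<close>
  then obtain j where j: "j \<in> P" "\<not> discr (pr {j} ` M)" using nondiscr_pr[of P M] ndM by (auto simp: P_def)
  have jI: "j \<in> I" "{j} \<subseteq> P" using j by (auto simp: P_def)
  note Q = closure_pr_factor[OF jI(1) j(1) M(1) MG M(2)]
  have ndQ: "\<not> discr (cl (pr {j} ` M))" using discr_subset[OF _ Q(5)] j(2) by blast
  have cj: "cocompact_in (pr {j} ` B) (fac {j})"
    using cocompact_in_pr[OF cB BG fac_subset_carrier, of "{j}"] pr_image_fac_eq[OF jI(2)] by simp
  have Bj: "pr {j} ` B \<subseteq> fac {j}" by (rule pr_image_fac[OF BG])
  have "f \<otimes> b = b \<otimes> f" if f: "f \<in> cl (pr {j} ` M)" and b: "b \<in> pr {j} ` B" for f b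
  proof (rule commute_closure_of[OF _ _ _ f])
    show "x \<otimes> y = y \<otimes> x" if x: "x \<in> pr {j} ` M" and y: "y \<in> pr {j} ` B" for x y
    proof -
      obtain m c where mc: "m \<in> M" "x = pr {j} m" "c \<in> B" "y = pr {j} c" using x y by blast
      have "m \<in> carrier G" "c \<in> carrier G" "m \<otimes> c = c \<otimes> m" using mc MG BG unfolding M_def centralizer_def by blast+
      then show ?thesis unfolding mc(2,4) by (metis pr_mult)
    qed
    show "pr {j} ` M \<subseteq> carrier G" "pr {j} ` B \<subseteq> carrier G" using MG BG by auto
    then show "b \<in> cl (pr {j} ` B)" using b closure_of_superset by blast
  qed
  then show False
    by (rule qjnc_no_central_product[OF factor_qjnc[OF jI(1)] Q(1-4) ndQ Bj cj])
qed

lemma finite_index_if_discr: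
  assumes S: "S \<subseteq> I" and d: "discr (pr S ` \<Gamma>)"
  shows "finite_index_in (product_part (I - S) S)"
proof (rule finite_index_product_part)
  have e: "I - (I - S) = S" using S by auto
  show "(I - S) \<union> S = I" using S by auto
  show "cocompact_in (fac (I - S) \<inter> \<Gamma>) (fac (I - S))" by (rule cocompact_kernel[OF S d])
  show "cocompact_in (fac S \<inter> \<Gamma>) (fac S)"
    using cocompact_kernel[OF _ discr_complement[OF S d]] unfolding e by simp
qed auto

text \<open>Up to finitely many translates, the projection of \<Gamma> to \<open>S\<close> is that
  of the product part, which is contained in the discrete group
  \<open>fac S \<inter> \<Gamma>\<close>.\<close>

lemma discr_if_finite_index:
  assumes PS: "P \<inter> S = {}" and fi: "finite_index_in (product_part P S)"
  shows "discr (pr S ` \<Gamma>)"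
proof -
  obtain F where F: "finite F" "F \<subseteq> \<Gamma>" "\<And>x. x \<in> \<Gamma> \<Longrightarrow> \<exists>f\<in>F. x \<otimes> inv f \<in> product_part P S"
    using fi unfolding finite_index_in_def by blast
  show ?thesis
  proof (rule discr_finite_extension)
    show "subgroup (fac S \<inter> \<Gamma>) G" by (rule subgroups_Inter_pair[OF subgroup_fac subgroup_\<Gamma>])
    show "discr (fac S \<inter> \<Gamma>)" by (rule discr_subset[OF discr_\<Gamma>]) auto
    show "finite (pr S ` F)" using F(1) by simp
    show "pr S ` F \<subseteq> carrier G" "pr S ` \<Gamma> \<subseteq> carrier G" using F(2) \<Gamma>_subset by auto
    fix x assume "x \<in> pr S ` \<Gamma>"
    then obtain g where g: "g \<in> \<Gamma>" "x = pr S g" by blast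
    obtain f where f: "f \<in> F" "g \<otimes> inv f \<in> product_part P S" using F(3)[OF g(1)] by blast
    obtain a b where ab: "a \<in> fac P \<inter> \<Gamma>" "b \<in> fac S \<inter> \<Gamma>" "g \<otimes> inv f = a \<otimes> b"
      using f(2) unfolding product_part_def by blast
    have G: "g \<in> carrier G" "f \<in> carrier G" "a \<in> carrier G" "b \<in> carrier G"
      using g f ab F(2) \<Gamma>_subset by auto
    have "pr S a = \<one>" by (rule fac_disjoint[of a P]) (use ab PS in auto)
    moreover have "pr S b = b" using ab facD by auto
    ultimately have "pr S (a \<otimes> b) = b" using G by (simp add: pr_mult)
    moreover have "pr S (g \<otimes> inv f) = x \<otimes> inv (pr S f)" using G g by (simp add: pr_mult pr_inv)
    ultimately have "x \<otimes> inv (pr S f) = b" using ab(3) by simp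
    then show "\<exists>c\<in>pr S ` F. x \<otimes> inv c \<in> fac S \<inter> \<Gamma>" using ab(2) f(1) by blast
  qed
qed

lemma product_part_nontrivial:
  assumes "P \<union> S = I" "P \<inter> S = {}" "P \<noteq> {}" and fi: "finite_index_in (product_part P S)"
  shows "\<not> fac P \<inter> \<Gamma> \<subseteq> {\<one>}"
proof
  assume tr: "fac P \<inter> \<Gamma> \<subseteq> {\<one>}"
  obtain j where j: "j \<in> P" using assms by blast
  have "product_part P S \<subseteq> fac S \<inter> \<Gamma>"
  proof
    fix x assume "x \<in> product_part P S"
    then obtain a b where ab: "a \<in> fac P \<inter> \<Gamma>" "b \<in> fac S \<inter> \<Gamma>" "x = a \<otimes> b" unfolding product_part_def by blast
    have "b \<in> carrier G" using ab(2) \<Gamma>_subset by auto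
    then show "x \<in> fac S \<inter> \<Gamma>" using ab tr by auto
  qed
  moreover from this have "pr {j} ` product_part P S \<subseteq> {\<one>}"
    using fac_disjoint[of _ S "{j}"] j assms(2) by blast
  ultimately show False using pr_finite_index_nontrivial[OF fi, of j] j assms(1) by blast
qed

end

section \<open>Just-non-compact factors\<close>

context product_lattice begin

text \<open>Let \<open>B\<close> consist of the elements of \<Gamma> with trivial coordinate i, and
  let j be a coordinate in which g is non-trivial. The discrete normal subgroup \<open>D\<close> of
  \<open>fac {j}\<close> cannot be cocompact, hence is trivial. Commutators of \<open>N\<close> with
  the closure of the projection of \<open>B\<close> lie in \<open>D\<close>, so these two subgroups
  commute; but the first is non-discrete and the second, being non-trivial, is cocompact.\<close>

lemma injective_if_projections_nondiscr:
  assumes jnc: "\<And>j. j \<in> I \<Longrightarrow> jnc (fac {j})"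
    and irr3: "\<And>S. S \<subset> I \<Longrightarrow> S \<noteq> {} \<Longrightarrow> \<not> discr (pr S ` \<Gamma>)"
    and g: "i \<in> I" "g \<in> \<Gamma>" "pr {i} g = \<one>"
  shows "g = \<one>"
proof (rule ccontr)
  assume g1: "g \<noteq> \<one>"
  define P where "P = I - {i}"
  have P: "P \<subset> I" "P \<subseteq> I" "finite P" using g(1) finite_I by (auto simp: P_def)
  define B where "B = fac P \<inter> \<Gamma>"
  note B = fac_Int_\<Gamma>[of P, folded B_def] and nB = normalizes_fac_Int_\<Gamma>[OF P(2), folded B_def]
  have BG: "B \<subseteq> carrier G" using B(1) subgroup.subset by blast
  have gG: "g \<in> carrier G" using g(2) \<Gamma>_subset by blast
  have e: "{i} \<union> P = I" using g(1) by (auto simp: P_def)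
  have "g = pr {i} g \<otimes> pr P g" using pr_Un[OF gG, of "{i}" P] e pr_all[OF gG] by (simp add: P_def)
  then have gP: "g = pr P g" using g(3) gG by simp
  have gB: "g \<in> B" unfolding B_def using pr_in_fac[OF gG, of P, folded gP] g(2) by blast
  obtain j where j: "j \<in> P" "pr {j} g \<noteq> \<one>" using fac_eq_one_iff[of g P] gB P(3) g1 by (auto simp: B_def)
  have jI: "j \<in> I" using j P by auto
  define D where "D = fac {j} \<inter> \<Gamma>"
  note D = fac_Int_\<Gamma>[of "{j}", folded D_def]
  have nD: "normalizes (fac {j}) D"
    using normalizes_factor_closed[OF jI normalizes_fac_Int_\<Gamma>[of "{j}"]] jI D(2) unfolding D_def by simp
  have Dj: "D \<subseteq> fac {j}" by (simp add: D_def)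
  have "\<not> cocompact_in D (fac {j})"
  proof
    assume cc: "cocompact_in D (fac {j})"
    have "f \<otimes> b \<otimes> inv f \<otimes> inv b \<in> D" if "f \<in> fac {j}" "b \<in> D" for f b
      using normalizesD[OF nD that] that(2) by (simp add: subgroup.m_closed[OF D(1)] subgroup.m_inv_closed[OF D(1)])
    then show False
      by (rule factor_no_discrete_commutators[OF jI subgroup_fac order_refl closedin_fac
            normalizes_self[OF subgroup_fac] factor_nondiscr[OF jI] D(1) Dj D(2) cc D(3)])
  qed
  then have D1: "D = {\<one>}" using jnc[OF jI] D nD Dj unfolding jnc_def by blast
  define N where "N = closed_pr P \<inter> fac {j}"
  note N = closed_pr_Int_factor[OF P(2) j(1), folded N_def]
  have Nj: "N \<subseteq> fac {j}" by (simp add: N_def)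
  have nN: "\<not> discr N" using nondiscr_closed_pr_Int_factor[OF irr3 P(1)] j(1) unfolding N_def by blast
  note A = closure_pr_factor[OF jI j(1) B(1) BG nB]
  have "cl (pr {j} ` B) \<noteq> {\<one>}" using A(5) gB j(2) by blast
  then have cA: "cocompact_in (cl (pr {j} ` B)) (fac {j})"
    using jnc[OF jI] A unfolding jnc_def by blast
  have "f \<otimes> a = a \<otimes> f" if f: "f \<in> N" and a: "a \<in> cl (pr {j} ` B)" for f a
  proof (rule commute_if_commutator_one)
    show "f \<in> carrier G" "a \<in> carrier G" using f a A(2) fac_subset_carrier unfolding N_def by blast+
    have "f \<otimes> a \<otimes> inv f \<otimes> inv a \<in> B \<inter> fac {j}"
      by (rule closed_pr_commutators[OF j(1) B(2) BG B(1) nB f[unfolded N_def] a])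
    then have "f \<otimes> a \<otimes> inv f \<otimes> inv a \<in> D" unfolding B_def D_def by blast
    then show "f \<otimes> a \<otimes> inv f \<otimes> inv a = \<one>" unfolding D1 by simp
  qed
  then show False
    by (rule qjnc_no_central_product[OF factor_qjnc[OF jI] N(1) Nj N(2,3) nN A(2) cA])
qed

text \<open>In the closure \<open>X\<close> of the projection of \<open>\<Lambda>\<close> both
  \<open>A'\<close> and \<open>B'\<close> are non-trivial closed normal subgroups by injectivity,
  hence cocompact. If \<open>A'\<close> is non-discrete, it commutes with the cocompact
  \<open>B'\<close>. If it is discrete, it contains all commutators of the non-discrete
  \<open>X\<close> with the cocompact \<open>A'\<close>. Both are impossible.\<close>

lemma no_commuting_normal_subgroups:
  assumes i: "i \<in> I"
    and hj: "\<And>X. subgroup X G \<Longrightarrow> X \<subseteq> fac {i} \<Longrightarrow> closedin T X \<Longrightarrow>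
      \<exists>F. finite F \<and> F \<subseteq> fac {i} \<and> (\<forall>x\<in>fac {i}. \<exists>f\<in>F. x \<otimes> inv f \<in> X) \<Longrightarrow> jnc X"
    and inj: "\<And>g. g \<in> \<Gamma> \<Longrightarrow> pr {i} g = \<one> \<Longrightarrow> g = \<one>"
    and \<Lambda>: "subgroup \<Lambda> G" "\<Lambda> \<subseteq> \<Gamma>" "finite_index_in \<Lambda>"
    and A: "subgroup A G" "A \<subseteq> \<Lambda>" "normalizes \<Lambda> A" "\<not> A \<subseteq> {\<one>}"
    and B: "subgroup B G" "B \<subseteq> \<Lambda>" "normalizes \<Lambda> B" "\<not> B \<subseteq> {\<one>}"
    and comm: "\<And>a b. a \<in> A \<Longrightarrow> b \<in> B \<Longrightarrow> a \<otimes> b = b \<otimes> a"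
  shows False
proof -
  have \<Lambda>G: "\<Lambda> \<subseteq> carrier G" using \<Lambda>(2) \<Gamma>_subset by blast
  define X where "X = cl (pr {i} ` \<Lambda>)"
  have closure: "subgroup (cl (pr {i} ` M)) G" "cl (pr {i} ` M) \<subseteq> X" "closedin T (cl (pr {i} ` M))"
      "normalizes X (cl (pr {i} ` M))" "pr {i} ` M \<subseteq> cl (pr {i} ` M)"
    if M: "subgroup M G" "M \<subseteq> \<Lambda>" "normalizes \<Lambda> M" for M
  proof -
    show "subgroup (cl (pr {i} ` M)) G" by (rule subgroup_closure_of[OF subgroup_pr_image[OF M(1)]])
    show "cl (pr {i} ` M) \<subseteq> X" unfolding X_def by (rule closure_of_mono[OF image_mono[OF M(2)]])
    show "closedin T (cl (pr {i} ` M))" by simp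
    show "pr {i} ` M \<subseteq> cl (pr {i} ` M)" by (rule closure_of_superset) (use M(2) \<Lambda>G in auto)
    have "normalizes (pr {i} ` \<Lambda>) (pr {i} ` M)" unfolding normalizes_def
    proof (intro ballI)
      fix x y assume "x \<in> pr {i} ` \<Lambda>" "y \<in> pr {i} ` M"
      then obtain l m where l: "l \<in> \<Lambda>" "x = pr {i} l" "m \<in> M" "y = pr {i} m" by blast
      have "l \<otimes> m \<otimes> inv l \<in> M" by (rule normalizesD[OF M(3) l(1,3)])
      moreover have "pr {i} (l \<otimes> m \<otimes> inv l) = x \<otimes> y \<otimes> inv x" using l \<Lambda>G M(2) pr_conj[of l m "{i}"] by blast
      ultimately show "x \<otimes> y \<otimes> inv x \<in> pr {i} ` M" by (metis imageI)
    qed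
    then show "normalizes X (cl (pr {i} ` M))" unfolding X_def by (rule normalizes_closure_of)
  qed
  note cX = closure[OF \<Lambda>(1) order_refl normalizes_self[OF \<Lambda>(1)], folded X_def]
  have Xi: "X \<subseteq> fac {i}" unfolding X_def by (rule closure_of_minimal[OF pr_image_fac[OF \<Lambda>G] closedin_fac])
  obtain F where F: "finite F" "F \<subseteq> \<Gamma>" "\<And>x. x \<in> \<Gamma> \<Longrightarrow> \<exists>f\<in>F. x \<otimes> inv f \<in> \<Lambda>"
    using \<Lambda>(3) unfolding finite_index_in_def by blast
  have FG: "F \<subseteq> carrier G" using F(2) \<Gamma>_subset by blast
  \<comment> \<open>A finite union of cosets of the closed group \<open>X\<close>. It contains the
    projection of \<Gamma>, so by density it contains the factor, and \<open>X\<close> has finite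
    index there.\<close>
  define Y where "Y = (\<Union>f\<in>pr {i} ` F. {x \<in> carrier G. x \<otimes> inv f \<in> X})"
  have "closedin T {x \<in> carrier G. x \<otimes> inv f \<in> X}" if "f \<in> pr {i} ` F" for f
    using that FG cX(3) by (intro closedin_preimage continuous_intros) auto
  then have cY: "closedin T Y" unfolding Y_def using F(1) by (intro closedin_Union) auto
  have "pr {i} ` \<Gamma> \<subseteq> Y"
  proof (rule image_subsetI)
    fix g assume g: "g \<in> \<Gamma>"
    obtain f where f: "f \<in> F" "g \<otimes> inv f \<in> \<Lambda>" using F(3)[OF g] by blast
    have G: "g \<in> carrier G" "f \<in> carrier G" using g f FG \<Gamma>_subset by auto
    have "pr {i} (g \<otimes> inv f) \<in> X" using cX(5) f(2) by blast
    then have "pr {i} g \<otimes> inv (pr {i} f) \<in> X" using G by (simp add: pr_mult pr_inv)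
    then show "pr {i} g \<in> Y" unfolding Y_def using f(1) G by auto
  qed
  then have "cl (pr {i} ` \<Gamma>) \<subseteq> Y" by (rule closure_of_minimal[OF _ cY])
  then have iY: "fac {i} \<subseteq> Y" using dense[OF i] by simp
  have Ff: "pr {i} ` F \<subseteq> fac {i}" by (rule pr_image_fac[OF FG])
  have cov: "\<exists>f\<in>pr {i} ` F. x \<otimes> inv f \<in> X" if "x \<in> fac {i}" for x
    using iY that unfolding Y_def by blast
  have "finite (pr {i} ` F) \<and> pr {i} ` F \<subseteq> fac {i} \<and> (\<forall>x\<in>fac {i}. \<exists>f\<in>pr {i} ` F. x \<otimes> inv f \<in> X)"
    by (intro conjI ballI finite_imageI F(1) Ff cov)
  then have jX: "jnc X" by (intro hj[OF cX(1) Xi cX(3)] exI)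
  note qX = jnc_imp_qjnc[OF jX]
  have pFG: "pr {i} ` F \<subseteq> carrier G" using FG by auto
  have ndX: "\<not> discr X"
    using discr_finite_extension[OF cX(1) _ finite_imageI[OF F(1)] pFG fac_subset_carrier cov]
      factor_nondiscr[OF i] by blast
  have "cocompact_in X (fac {i})" unfolding cocompact_in_def
  proof (intro exI conjI ballI)
    show "compactin T (pr {i} ` F)" using F(1) pFG by (simp add: finite_imp_compactin)
    show "pr {i} ` F \<subseteq> fac {i}" by (rule Ff)
    fix x assume x: "x \<in> fac {i}"
    obtain f where f: "f \<in> pr {i} ` F" "x \<otimes> inv f \<in> X" using cov[OF x] by blast
    have "x \<in> carrier G" "f \<in> carrier G" using facD(1)[OF x] f pFG by auto
    then have "x = (x \<otimes> inv f) \<otimes> f" by (simp add: m_assoc)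
    then show "\<exists>h\<in>X. \<exists>k\<in>pr {i} ` F. x = h \<otimes> k" using f by blast
  qed
  moreover obtain C where C: "compactin T C" "fac {i} = generate G C" using factor_compactly_generated[OF i] by blast
  ultimately obtain CX where CX: "compactin T CX" "X = generate G CX"
    using compact_generation_cocompact[OF C cX(1,3) Xi] by blast
  define A' where "A' = cl (pr {i} ` A)"
  define B' where "B' = cl (pr {i} ` B)"
  note cA = closure[OF A(1-3), folded A'_def] and cB = closure[OF B(1-3), folded B'_def]
  have cc: "cocompact_in (cl (pr {i} ` M)) X"
    if M: "subgroup M G" "M \<subseteq> \<Lambda>" "normalizes \<Lambda> M" "\<not> M \<subseteq> {\<one>}" for M
  proof -
    obtain m where m: "m \<in> M" "m \<noteq> \<one>" using M(4) by blast
    then have "pr {i} m \<noteq> \<one>" using inj M(2) \<Lambda>(2) by blast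
    then have "cl (pr {i} ` M) \<noteq> {\<one>}" using closure(5)[OF M(1-3)] m(1) by blast
    then show ?thesis using jX closure[OF M(1-3)] unfolding jnc_def by blast
  qed
  have ccA: "cocompact_in A' X" and ccB: "cocompact_in B' X"
    unfolding A'_def B'_def by (rule cc[OF A], rule cc[OF B])
  show False
  proof (cases "discr A'")
    case True
    have "f \<otimes> b \<otimes> inv f \<otimes> inv b \<in> A'" if "f \<in> X" "b \<in> A'" for f b
      using normalizesD[OF cA(4) that] that(2) by (simp add: subgroup.m_closed[OF cA(1)] subgroup.m_inv_closed[OF cA(1)])
    then show False
      by (rule qjnc_no_discrete_commutators[OF qX CX(2,1) cX(1) order_refl cX(3)
            normalizes_self[OF cX(1)] ndX cA(1-3) ccA True])
  next
    case False
    have "f \<otimes> b = b \<otimes> f" if f: "f \<in> A'" and b: "b \<in> B'" for f b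
    proof (rule commute_closure_of[OF _ _ _ f[unfolded A'_def] b[unfolded B'_def]])
      show "pr {i} ` A \<subseteq> carrier G" "pr {i} ` B \<subseteq> carrier G" using A(2) B(2) \<Lambda>G by auto
      fix x y assume "x \<in> pr {i} ` A" "y \<in> pr {i} ` B"
      then obtain a b where ab: "a \<in> A" "x = pr {i} a" "b \<in> B" "y = pr {i} b" by blast
      have "a \<in> carrier G" "b \<in> carrier G" using ab A(2) B(2) \<Lambda>G by auto
      then show "x \<otimes> y = y \<otimes> x" unfolding ab(2,4) by (metis pr_mult comm ab(1,3))
    qed
    then show False by (rule qjnc_no_central_product[OF qX cA(1-4) False cB(2) ccB])
  qed
qed

lemma subgroup_product_part:
  assumes "P \<inter> S = {}"
  shows "subgroup (product_part P S) G" "product_part P S \<subseteq> \<Gamma>"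
proof -
  have "normalizes (fac P \<inter> \<Gamma>) (fac S \<inter> \<Gamma>)" unfolding normalizes_def
  proof (intro ballI)
    fix x y assume x: "x \<in> fac P \<inter> \<Gamma>" and y: "y \<in> fac S \<inter> \<Gamma>"
    have c: "x \<otimes> y = y \<otimes> x" by (rule fac_commute[OF _ _ assms]) (use x y in auto)
    have "x \<in> carrier G" "y \<in> carrier G" using x y \<Gamma>_subset by auto
    then have "x \<otimes> y \<otimes> inv x = y" unfolding c by (simp add: m_assoc)
    then show "x \<otimes> y \<otimes> inv x \<in> fac S \<inter> \<Gamma>" using y by simp
  qed
  then show "subgroup (product_part P S) G"
    unfolding product_part_def by (rule subgroup_mult_normalized[OF fac_Int_\<Gamma>(1) fac_Int_\<Gamma>(1)])
  show "product_part P S \<subseteq> \<Gamma>"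
    unfolding product_part_def using subgroup.m_closed[OF subgroup_\<Gamma>] by blast
qed

end

section \<open>Comparison with the external notions of index, discreteness and cocompactness\<close>

context group begin

lemma finite_index_iff:
  assumes K: "subgroup K G" and H: "subgroup H G" "H \<subseteq> K"
  shows "finite_index (G\<lparr>carrier := K\<rparr>) H \<longleftrightarrow>
    (\<exists>F. finite F \<and> F \<subseteq> K \<and> (\<forall>x\<in>K. \<exists>f\<in>F. x \<otimes> inv f \<in> H))"
proof -
  have KG: "K \<subseteq> carrier G" and HG: "H \<subseteq> carrier G" using K H subgroup.subset by blast+
  have e: "rcosets\<^bsub>G\<lparr>carrier := K\<rparr>\<^esub> H = (\<lambda>x. H #> x) ` K"
    by (auto simp: RCOSETS_def r_coset_def)
  show ?thesis unfolding finite_index_def e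
  proof
    assume "finite ((\<lambda>x. H #> x) ` K)"
    then obtain F where F: "F \<subseteq> K" "finite F" "(\<lambda>x. H #> x) ` K = (\<lambda>x. H #> x) ` F"
      using finite_subset_image[of "(\<lambda>x. H #> x) ` K" "\<lambda>x. H #> x" K] by blast
    have "\<exists>f\<in>F. x \<otimes> inv f \<in> H" if x: "x \<in> K" for x
    proof -
      have xG: "x \<in> carrier G" using x KG by blast
      obtain f where f: "f \<in> F" "H #> x = H #> f" using F(3) x by blast
      have fG: "f \<in> carrier G" using f F KG by blast
      have "x \<in> H #> f" using rcos_self[OF xG H(1)] f(2) by simp
      then obtain h where h: "h \<in> H" "x = h \<otimes> f" by (auto simp: r_coset_def)
      then have "x \<otimes> inv f = h" using fG HG by (auto simp: m_assoc subset_iff)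
      then show ?thesis using f h by blast
    qed
    then show "\<exists>F. finite F \<and> F \<subseteq> K \<and> (\<forall>x\<in>K. \<exists>f\<in>F. x \<otimes> inv f \<in> H)" using F by blast
  next
    assume "\<exists>F. finite F \<and> F \<subseteq> K \<and> (\<forall>x\<in>K. \<exists>f\<in>F. x \<otimes> inv f \<in> H)"
    then obtain F where F: "finite F" "F \<subseteq> K" "\<forall>x\<in>K. \<exists>f\<in>F. x \<otimes> inv f \<in> H" by blast
    have "(\<lambda>x. H #> x) ` K \<subseteq> (\<lambda>x. H #> x) ` F"
    proof (rule image_subsetI)
      fix x assume x: "x \<in> K"
      obtain f where f: "f \<in> F" "x \<otimes> inv f \<in> H" using F(3) x by blast
      have g: "x \<in> carrier G" "f \<in> carrier G" using x f F KG by auto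
      have "x = (x \<otimes> inv f) \<otimes> f" using g by (simp add: m_assoc)
      then have "x \<in> H #> f" using f(2) by (auto simp: r_coset_def)
      then have "H #> x = H #> f" using repr_independence[OF _ g(2) H(1)] by simp
      then show "H #> x \<in> (\<lambda>x. H #> x) ` F" using f(1) by blast
    qed
    then show "finite ((\<lambda>x. H #> x) ` K)" using F(1) finite_subset by blast
  qed
qed

end

context topological_group begin

lemma discr_iff_discretein:
  assumes H: "subgroup H G"
  shows "discretein T H \<longleftrightarrow> discr H"
proof
  assume "discretein T H"
  then have "openin (subtopology T H) {\<one>}"
    using subgroup.one_closed[OF H] by (simp add: discretein_def)
  then obtain U where U: "openin T U" "{\<one>} = U \<inter> H" by (auto simp: openin_subtopology)
  then have "\<one> \<in> U" "U \<inter> H \<subseteq> {\<one>}" by auto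
  then show "discr H" unfolding discr_def using U(1) by blast
next
  have HG: "H \<subseteq> carrier G" using H subgroup.subset by blast
  assume "discr H"
  then obtain U where U: "openin T U" "\<one> \<in> U" "U \<inter> H \<subseteq> {\<one>}" by (auto simp: discr_def)
  have o: "openin (subtopology T H) {x}" if x: "x \<in> H" for x
  proof -
    have xG: "x \<in> carrier G" using x HG by auto
    have "(\<lambda>u. x \<otimes> u) ` U \<inter> H = {x}"
    proof (intro equalityI subsetI)
      fix y assume y: "y \<in> (\<lambda>u. x \<otimes> u) ` U \<inter> H"
      then obtain u where u: "u \<in> U" "y = x \<otimes> u" by blast
      have uG: "u \<in> carrier G" using u openin_subset_carrier[OF U(1)] by blast
      have "u = inv x \<otimes> y" using u uG xG by simp
      then have "u \<in> H" using y x subgroup.m_closed[OF H] subgroup.m_inv_closed[OF H] by blast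
      then have "u = \<one>" using u U(3) by blast
      then show "y \<in> {x}" using u xG by simp
    next
      fix y assume "y \<in> {x}"
      then show "y \<in> (\<lambda>u. x \<otimes> u) ` U \<inter> H" using x xG U(2) by (auto intro!: image_eqI[of _ _ \<one>])
    qed
    then show ?thesis using openin_l_translate[OF U(1) xG] unfolding openin_subtopology by metis
  qed
  have "topspace (subtopology T H) = H" using HG by auto
  then have "discrete_topology H = subtopology T H"
    using o discrete_topology_unique[of H "subtopology T H"] by blast
  then show "discretein T H" unfolding discretein_def by simp
qed

end

lemma discretein_inj_preimage:
  assumes f: "continuous_map X Y f" and A: "A \<subseteq> topspace X" "inj_on f A" and d: "discretein Y (f ` A)"
  shows "discretein X A"
proof -
  have "openin (subtopology X A) {x}" if x: "x \<in> A" for x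
  proof -
    have "openin (subtopology Y (f ` A)) {f x}" using d x by (simp add: discretein_def)
    then obtain U where U: "openin Y U" "{f x} = U \<inter> f ` A" by (auto simp: openin_subtopology)
    have "{x} = {z \<in> topspace X. f z \<in> U} \<inter> A"
    proof (intro equalityI subsetI)
      fix y assume "y \<in> {x}" then show "y \<in> {z \<in> topspace X. f z \<in> U} \<inter> A" using x A(1) U(2) by blast
    next
      fix y assume y: "y \<in> {z \<in> topspace X. f z \<in> U} \<inter> A"
      then have "f y = f x" using U(2) by blast
      then show "y \<in> {x}" using A(2) x y by (auto dest: inj_onD)
    qed
    then show ?thesis using openin_continuous_map_preimage[OF f U(1)] unfolding openin_subtopology by blast
  qed
  moreover have "topspace (subtopology X A) = A" using A(1) by auto
  ultimately have "discrete_topology A = subtopology X A"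
    using discrete_topology_unique[of A "subtopology X A"] by blast
  then show ?thesis unfolding discretein_def by simp
qed

context locally_compact_group begin

text \<open>Images of the translates U x of a relatively compact open set \<open>U\<close> are open
  in the coset space, and finitely many of them cover it. Their centres \<open>F\<close> give the
  compact set of representatives K F.\<close>

lemma cocompact_imp_cocompact_in:
  assumes H: "subgroup H G" and cc: "cocompact G T H"
  shows "cocompact_in H (carrier G)"
proof -
  have HG: "H \<subseteq> carrier G" using H subgroup.subset by blast
  have "\<one> \<in> topspace T" by simp
  then obtain U K where U: "openin T U" "compactin T K" "\<one> \<in> U" "U \<subseteq> K"
    using locally_compact unfolding locally_compact_space_def by meson
  have UG: "U \<subseteq> carrier G" using openin_subset_carrier[OF U(1)] .
  define V where "V x = (\<lambda>u. H #> (u \<otimes> x)) ` U" for x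
  have oV: "openin (coset_space G T H) (V x)" if x: "x \<in> carrier G" for x
  proof -
    \<comment> \<open>Openness of \<open>V x\<close> in the quotient topology is thereby reduced to
      openness of the saturated set H U x, a union of translates of \<open>U\<close>.\<close>
    have "{y \<in> topspace T. H #> y \<in> V x} = (\<Union>h\<in>H. (\<lambda>z. h \<otimes> z) ` (\<lambda>u. u \<otimes> x) ` U)"
    proof (intro equalityI subsetI)
      fix y assume "y \<in> {y \<in> topspace T. H #> y \<in> V x}"
      then obtain u where u: "y \<in> carrier G" "u \<in> U" "H #> y = H #> (u \<otimes> x)" by (auto simp: V_def)
      then have "y \<in> H #> (u \<otimes> x)" using rcos_self[OF u(1) H] by simp
      then show "y \<in> (\<Union>h\<in>H. (\<lambda>z. h \<otimes> z) ` (\<lambda>u. u \<otimes> x) ` U)" using u(2) by (auto simp: r_coset_def)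
    next
      fix y assume "y \<in> (\<Union>h\<in>H. (\<lambda>z. h \<otimes> z) ` (\<lambda>u. u \<otimes> x) ` U)"
      then obtain h u where hu: "h \<in> H" "u \<in> U" "y = h \<otimes> (u \<otimes> x)" by blast
      have g: "u \<otimes> x \<in> carrier G" "y \<in> carrier G" using hu x HG UG by auto
      have "y \<in> H #> (u \<otimes> x)" using hu by (auto simp: r_coset_def)
      then have "H #> y = H #> (u \<otimes> x)" using repr_independence[OF _ g(1) H] by simp
      then show "y \<in> {y \<in> topspace T. H #> y \<in> V x}" using hu(2) g(2) unfolding V_def by auto
    qed
    moreover have "openin T (\<Union>h\<in>H. (\<lambda>z. h \<otimes> z) ` (\<lambda>u. u \<otimes> x) ` U)"
      using HG x U(1) by (intro openin_Union) (auto intro!: openin_l_translate openin_r_translate)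
    moreover have "V x \<subseteq> rcosets H"
      using x UG by (auto simp: V_def RCOSETS_def)
    ultimately show ?thesis by (simp add: openin_coset_space)
  qed
  have "compactin (coset_space G T H) (rcosets H)"
    using cc by (simp add: cocompact_def compact_space_def)
  moreover have "rcosets H \<subseteq> \<Union>(V ` carrier G)"
  proof
    fix c assume "c \<in> rcosets H"
    then obtain x where x: "x \<in> carrier G" "c = H #> x" by (auto simp: RCOSETS_def)
    then have "c \<in> V x" using U(3) unfolding V_def by (intro image_eqI[of _ _ \<one>]) auto
    then show "c \<in> \<Union>(V ` carrier G)" using x by blast
  qed
  ultimately obtain \<F> where \<F>: "finite \<F>" "\<F> \<subseteq> V ` carrier G" "rcosets H \<subseteq> \<Union>\<F>"
    unfolding compactin_def using oV by (metis (no_types, lifting) imageE)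
  obtain F where F: "F \<subseteq> carrier G" "finite F" "\<F> = V ` F" using finite_subset_image[OF \<F>(1,2)] by blast
  show ?thesis unfolding cocompact_in_def
  proof (intro exI conjI ballI)
    have "compactin T F" using F by (simp add: finite_imp_compactin)
    then show c: "compactin T {k \<otimes> f |k f. k \<in> K \<and> f \<in> F}" by (rule compactin_mult[OF U(2)])
    then show "{k \<otimes> f |k f. k \<in> K \<and> f \<in> F} \<subseteq> carrier G" by (rule compactin_subset_carrier)
    fix y assume y: "y \<in> carrier G"
    then have "H #> y \<in> rcosets H" by (auto simp: RCOSETS_def)
    then obtain f where f: "f \<in> F" "H #> y \<in> V f" using \<F>(3) F(3) by blast
    then obtain u where u: "u \<in> U" "H #> y = H #> (u \<otimes> f)" by (auto simp: V_def)
    then have "y \<in> H #> (u \<otimes> f)" using rcos_self[OF y H] by simp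
    then obtain h where "h \<in> H" "y = h \<otimes> (u \<otimes> f)" by (auto simp: r_coset_def)
    then show "\<exists>h\<in>H. \<exists>k\<in>{k \<otimes> f |k f. k \<in> K \<and> f \<in> F}. y = h \<otimes> k" using u(1) f(1) U(4) by blast
  qed
qed

end

context topological_group begin

text \<open>The complement of \<open>H\<close> is the union of the finitely many other cosets, each
  of them closed.\<close>

lemma closed_finite_index_openin:
  assumes H: "subgroup H G" "closedin T H" and F: "finite F" "F \<subseteq> carrier G"
    and cov: "\<And>x. x \<in> carrier G \<Longrightarrow> \<exists>f\<in>F. x \<otimes> inv f \<in> H"
  shows "openin T H"
proof -
  have HG: "H \<subseteq> carrier G" using H subgroup.subset by blast
  define Y where "Y = (\<Union>f\<in>F - H. {x \<in> carrier G. x \<otimes> inv f \<in> H})"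
  have "closedin T {x \<in> carrier G. x \<otimes> inv f \<in> H}" if "f \<in> F - H" for f
    using that F(2) H(2) by (intro closedin_preimage continuous_intros) auto
  then have cY: "closedin T Y" unfolding Y_def using F(1) by (intro closedin_Union) auto
  have "H = carrier G - Y"
  proof (intro equalityI subsetI)
    fix x assume x: "x \<in> H"
    have "x \<otimes> inv f \<notin> H" if f: "f \<in> F - H" for f
    proof
      assume "x \<otimes> inv f \<in> H"
      then have "inv (x \<otimes> inv f) \<otimes> x \<in> H" using x H(1) by (simp add: subgroup.m_closed subgroup.m_inv_closed)
      moreover have "inv (x \<otimes> inv f) \<otimes> x = f" using x f F(2) HG by (auto simp: inv_mult_group m_assoc subset_iff)
      ultimately show False using f by auto
    qed
    then show "x \<in> carrier G - Y" using x HG by (auto simp: Y_def)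
  next
    fix x assume x: "x \<in> carrier G - Y"
    obtain f where f: "f \<in> F" "x \<otimes> inv f \<in> H" using cov x by blast
    have "f \<in> H" using x f by (auto simp: Y_def)
    then have "x \<otimes> inv f \<otimes> f \<in> H" using f(2) subgroup.m_closed[OF H(1)] by blast
    moreover have "x \<otimes> inv f \<otimes> f = x" using x f F(2) by (auto simp: m_assoc subset_iff)
    ultimately show "x \<in> H" by simp
  qed
  then show ?thesis using cY openin_diff[OF openin_topspace cY] by simp
qed

end

section \<open>Products of families of groups\<close>

text \<open>A topological isomorphism onto a closed subgroup of the ambient group, with
  \<open>r\<close> as its continuous inverse on the image. It transfers (quasi) just-non-compactness
  to the internal notions, both for a factor \<open>G i\<close> and for a finite index subgroup of
  it.\<close>

locale closed_embedding = tdlc_group G T + H: locally_compact_group G1 T1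
  for G :: "('a, 'b) monoid_scheme" (structure) and T :: "'a topology" and G1 :: "('c, 'd) monoid_scheme"
    and T1 :: "'c topology" +
  fixes e :: "'c \<Rightarrow> 'a" and r :: "'a \<Rightarrow> 'c"
  assumes e_hom: "e \<in> hom G1 G" and e_cont: "continuous_map T1 T e"
    and r_e: "x \<in> carrier G1 \<Longrightarrow> r (e x) = x"
    and r_cont: "continuous_map (subtopology T (e ` carrier G1)) T1 r"
    and closedin_image: "closedin T (e ` carrier G1)"
begin

interpretation e: group_hom G1 G e
  by (intro group_hom.intro group_hom_axioms.intro H.group_axioms group_axioms e_hom)

lemma subgroup_image: "subgroup (e ` carrier G1) G"
  by (rule e.img_is_subgroup)

lemma not_compactin_image:
  assumes "\<not> compact_space T1"
  shows "\<not> compactin T (e ` carrier G1)"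
proof
  assume "compactin T (e ` carrier G1)"
  then have "compactin (subtopology T (e ` carrier G1)) (e ` carrier G1)" by (simp add: compactin_subtopology)
  then have "compactin T1 (r ` e ` carrier G1)" by (rule image_compactin[OF _ r_cont])
  moreover have "r ` e ` carrier G1 = topspace T1" using r_e by (force simp: image_image)
  ultimately show False using assms by (simp add: compact_space_def)
qed

lemma preimage:
  assumes N: "subgroup N G" "N \<subseteq> e ` carrier G1" "closedin T N" "normalizes (e ` carrier G1) N"
  defines "M \<equiv> {x \<in> carrier G1. e x \<in> N}"
  shows "M \<lhd> G1" "closedin T1 M" "e ` M = N"
    "discretein T1 M \<Longrightarrow> discr N" "M = {\<one>\<^bsub>G1\<^esub>} \<Longrightarrow> N = {\<one>}"
    "cocompact G1 T1 M \<Longrightarrow> cocompact_in N (e ` carrier G1)"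
proof -
  show n: "M \<lhd> G1"
    unfolding H.normal_inv_iff
  proof (intro conjI ballI)
    show "subgroup M G1"
    proof
      show "M \<subseteq> carrier G1" by (auto simp: M_def)
      show "\<one>\<^bsub>G1\<^esub> \<in> M" using subgroup.one_closed[OF N(1)] by (simp add: M_def)
      show "x \<otimes>\<^bsub>G1\<^esub> y \<in> M" if "x \<in> M" "y \<in> M" for x y
        using that subgroup.m_closed[OF N(1)] by (simp add: M_def)
      show "inv\<^bsub>G1\<^esub> x \<in> M" if "x \<in> M" for x
        using that subgroup.m_inv_closed[OF N(1)] by (simp add: M_def)
    qed
    show "x \<otimes>\<^bsub>G1\<^esub> h \<otimes>\<^bsub>G1\<^esub> inv\<^bsub>G1\<^esub> x \<in> M" if "x \<in> carrier G1" "h \<in> M" for x h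
      using that normalizesD[OF N(4), of "e x" "e h"] by (auto simp: M_def)
  qed
  then have sM: "subgroup M G1" by (rule normal_imp_subgroup)
  show "closedin T1 M" using closedin_continuous_map_preimage[OF e_cont N(3)] by (simp add: M_def)
  show eM: "e ` M = N" using N(2) by (auto simp: M_def)
  show "N = {\<one>}" if "M = {\<one>\<^bsub>G1\<^esub>}" using eM that by auto
  show "discr N" if d: "discretein T1 M"
  proof -
    obtain U where U: "openin T1 U" "\<one>\<^bsub>G1\<^esub> \<in> U" "U \<inter> M \<subseteq> {\<one>\<^bsub>G1\<^esub>}"
      using H.discr_iff_discretein[OF sM] d unfolding H.discr_def by blast
    have "openin (subtopology T (e ` carrier G1)) {x \<in> topspace (subtopology T (e ` carrier G1)). r x \<in> U}"
      by (rule openin_continuous_map_preimage[OF r_cont U(1)])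
    then obtain V where V: "openin T V" "{x \<in> topspace (subtopology T (e ` carrier G1)). r x \<in> U} = V \<inter> e ` carrier G1"
      by (auto simp: openin_subtopology)
    have "\<one> \<in> V"
    proof -
      have "e \<one>\<^bsub>G1\<^esub> \<in> {x \<in> topspace (subtopology T (e ` carrier G1)). r x \<in> U}"
        using U(2) r_e[of "\<one>\<^bsub>G1\<^esub>"] by (auto intro!: image_eqI[of _ _ "\<one>\<^bsub>G1\<^esub>"])
      then show ?thesis using V(2) by auto
    qed
    moreover have "V \<inter> N \<subseteq> {\<one>}"
    proof
      fix x assume x: "x \<in> V \<inter> N"
      then obtain m where m: "m \<in> M" "x = e m" using eM by blast
      then have mG: "m \<in> carrier G1" by (simp add: M_def)
      then have "r x \<in> U" using V(2) x m by auto
      then have "m = \<one>\<^bsub>G1\<^esub>" using U(3) m r_e[OF mG] by auto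
      then show "x \<in> {\<one>}" using m by simp
    qed
    ultimately show ?thesis unfolding discr_def using V(1) by blast
  qed
  show "cocompact_in N (e ` carrier G1)" if c: "cocompact G1 T1 M"
  proof -
    obtain K where K: "compactin T1 K" "K \<subseteq> carrier G1" "\<And>x. x \<in> carrier G1 \<Longrightarrow> \<exists>h\<in>M. \<exists>k\<in>K. x = h \<otimes>\<^bsub>G1\<^esub> k"
      using H.cocompact_inE[OF H.cocompact_imp_cocompact_in[OF sM c]] by blast
    show ?thesis unfolding cocompact_in_def
    proof (intro exI conjI ballI)
      show "compactin T (e ` K)" by (rule image_compactin[OF K(1) e_cont])
      show "e ` K \<subseteq> e ` carrier G1" using K(2) by blast
      fix y assume "y \<in> e ` carrier G1"
      then obtain x where x: "x \<in> carrier G1" "y = e x" by blast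
      obtain h k where hk: "h \<in> M" "k \<in> K" "x = h \<otimes>\<^bsub>G1\<^esub> k" using K(3)[OF x(1)] by blast
      have "h \<in> carrier G1" "k \<in> carrier G1" using hk K(2) by (auto simp: M_def)
      then have "y = e h \<otimes> e k" using x hk by simp
      then show "\<exists>h\<in>N. \<exists>k\<in>e ` K. y = h \<otimes> k" using hk eM by blast
    qed
  qed
qed

lemma qjnc_image:
  assumes "quasi_just_non_compact G1 T1"
  shows "qjnc (e ` carrier G1)"
  unfolding qjnc_def
proof (intro conjI allI impI)
  show "\<not> compactin T (e ` carrier G1)"
    using assms by (intro not_compactin_image) (simp add: quasi_just_non_compact_def)
  fix N assume "subgroup N G \<and> N \<subseteq> e ` carrier G1 \<and> closedin T N \<and> normalizes (e ` carrier G1) N"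
  then have N: "subgroup N G" "N \<subseteq> e ` carrier G1" "closedin T N" "normalizes (e ` carrier G1) N" by auto
  note P = preimage[OF N]
  show "discr N \<or> cocompact_in N (e ` carrier G1)"
    using assms P(1,2,4,6) unfolding quasi_just_non_compact_def by blast
qed (rule subgroup_image closedin_image)+

lemma jnc_image:
  assumes "just_non_compact G1 T1"
  shows "jnc (e ` carrier G1)"
  unfolding jnc_def
proof (intro conjI allI impI)
  show "\<not> compactin T (e ` carrier G1)"
    using assms by (intro not_compactin_image) (simp add: just_non_compact_def)
  fix N assume "subgroup N G \<and> N \<subseteq> e ` carrier G1 \<and> closedin T N \<and> normalizes (e ` carrier G1) N"
  then have N: "subgroup N G" "N \<subseteq> e ` carrier G1" "closedin T N" "normalizes (e ` carrier G1) N" by auto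
  note P = preimage[OF N]
  show "N = {\<one>} \<or> cocompact_in N (e ` carrier G1)"
    using assms P(1,2,5,6) unfolding just_non_compact_def by blast
qed (rule subgroup_image closedin_image)+

end

lemma totally_disconnected_space_product_topology:
  assumes "\<And>i. i \<in> I \<Longrightarrow> totally_disconnected_space (X i)"
  shows "totally_disconnected_space (product_topology X I)"
  unfolding totally_disconnected_space_def
proof (intro allI impI)
  fix S assume S: "connectedin (product_topology X I) S"
  have "x = y" if x: "x \<in> S" and y: "y \<in> S" for x y
  proof
    fix i
    have PiE: "x \<in> (\<Pi>\<^sub>E i\<in>I. topspace (X i))" "y \<in> (\<Pi>\<^sub>E i\<in>I. topspace (X i))"
      using connectedin_subset_topspace[OF S] x y by auto
    show "x i = y i"
    proof (cases "i \<in> I")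
      case True
      have "connectedin (X i) ((\<lambda>x. x i) ` S)"
        by (rule connectedin_continuous_map_image[OF _ S]) (simp add: True)
      then obtain a where "(\<lambda>x. x i) ` S \<subseteq> {a}"
        using assms[OF True] unfolding totally_disconnected_space_def by blast
      then show ?thesis using x y by blast
    next
      case False
      then show ?thesis using PiE_arb[OF PiE(1) False] PiE_arb[OF PiE(2) False] by simp
    qed
  qed
  then show "\<exists>x. S \<subseteq> {x}" by blast
qed

text \<open>The concrete \<open>pr\<close>. In contrast to \<open>restrict x S\<close> the result
  stays in the full product, so the projection becomes an endomorphism.\<close>

definition coord_pr :: "'i set \<Rightarrow> ('i \<Rightarrow> ('a, 'b) monoid_scheme) \<Rightarrow> 'i set \<Rightarrow> ('i \<Rightarrow> 'a) \<Rightarrow> 'i \<Rightarrow> 'a" where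
  "coord_pr I G S x = (\<lambda>i\<in>I. if i \<in> S then x i else \<one>\<^bsub>G i\<^esub>)"

lemma tdlc_product_group:
  assumes fin: "finite I" and tdlc: "\<And>i. i \<in> I \<Longrightarrow> tdlc_group (G i) (T i)"
  shows "tdlc_product (product_group I G) (product_topology T I) I (coord_pr I G)"
proof -
  have grp: "group (G i)" and ts: "topspace (T i) = carrier (G i)"
    and cm: "continuous_map (prod_topology (T i) (T i)) (T i) (\<lambda>(x, y). x \<otimes>\<^bsub>G i\<^esub> y)"
    and ci: "continuous_map (T i) (T i) (\<lambda>x. inv\<^bsub>G i\<^esub> x)"
    and h: "Hausdorff_space (T i)" and lc: "locally_compact_space (T i)"
    and td: "totally_disconnected_space (T i)" if "i \<in> I" for i
  proof -
    interpret tdlc_group "G i" "T i" by (rule tdlc[OF that])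
    show "group (G i)" by (rule group_axioms)
    show "topspace (T i) = carrier (G i)" by simp
    show "continuous_map (prod_topology (T i) (T i)) (T i) (\<lambda>(x, y). x \<otimes>\<^bsub>G i\<^esub> y)" by (rule continuous_mult)
    show "continuous_map (T i) (T i) (\<lambda>x. inv\<^bsub>G i\<^esub> x)" by (rule continuous_inv)
    show "Hausdorff_space (T i)" by (rule Hausdorff)
    show "locally_compact_space (T i)" by (rule locally_compact)
    show "totally_disconnected_space (T i)" by (rule totally_disconnected)
  qed
  let ?G = "product_group I G" and ?T = "product_topology T I"
  have ts': "topspace ?T = carrier ?G" using ts by (auto simp: PiE_iff)
  interpret group ?G using grp by (rule product_group)
  have coord: "continuous_map ?T (T i) (\<lambda>x. x i)" if "i \<in> I" for i using that by simp
  have tg: "topological_group ?G ?T"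
  proof
    show "topspace ?T = carrier ?G" by (rule ts')
    show "continuous_map (prod_topology ?T ?T) ?T (\<lambda>(x, y). x \<otimes>\<^bsub>?G\<^esub> y)"
    proof (rule continuous_map_coordinatewise_then_product)
      fix i assume i: "i \<in> I"
      have "continuous_map (prod_topology ?T ?T) (prod_topology (T i) (T i)) (\<lambda>p. (fst p i, snd p i))"
        by (intro continuous_map_pairedI continuous_map_compose[OF continuous_map_fst coord[OF i], unfolded o_def]
            continuous_map_compose[OF continuous_map_snd coord[OF i], unfolded o_def])
      from continuous_map_compose[OF this cm[OF i]]
      show "continuous_map (prod_topology ?T ?T) (T i) (\<lambda>p. (case p of (x, y) \<Rightarrow> x \<otimes>\<^bsub>?G\<^esub> y) i)"
        using i by (simp add: o_def case_prod_unfold)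
    qed (auto simp: case_prod_unfold)
    have "continuous_map ?T ?T (\<lambda>x. \<lambda>i\<in>I. inv\<^bsub>G i\<^esub> (x i))"
    proof (rule continuous_map_coordinatewise_then_product)
      fix i assume i: "i \<in> I"
      show "continuous_map ?T (T i) (\<lambda>x. (\<lambda>i\<in>I. inv\<^bsub>G i\<^esub> (x i)) i)"
        using continuous_map_compose[OF coord[OF i] ci[OF i]] i by (simp add: o_def)
    qed auto
    then show "continuous_map ?T ?T (\<lambda>x. inv\<^bsub>?G\<^esub> x)"
      by (rule continuous_map_eq) (use ts' grp in auto)
  qed
  have lcg: "locally_compact_group ?G ?T"
    by (intro locally_compact_group.intro tg locally_compact_group_axioms.intro)
      (use h lc fin in \<open>auto simp: Hausdorff_space_product_topology locally_compact_space_product_topology\<close>)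
  have "tdlc_group ?G ?T"
    by (intro tdlc_group.intro lcg tdlc_group_axioms.intro totally_disconnected_space_product_topology td)
  moreover have "tdlc_product_axioms ?G ?T I (coord_pr I G)"
  proof
    show "finite I" by (rule fin)
    have one: "\<one>\<^bsub>G i\<^esub> \<in> carrier (G i)" if "i \<in> I" for i
      using grp[OF that] by (simp add: group.is_monoid monoid.one_closed)
    have r1: "\<one>\<^bsub>G i\<^esub> \<otimes>\<^bsub>G i\<^esub> y = y" "y \<otimes>\<^bsub>G i\<^esub> \<one>\<^bsub>G i\<^esub> = y" if "i \<in> I" "y \<in> carrier (G i)" for i y
      using grp[OF that(1)] that(2) by (simp_all add: group.is_monoid monoid.l_one monoid.r_one)
    fix x S S' assume x: "x \<in> carrier ?G"
    show "coord_pr I G S (x \<otimes>\<^bsub>?G\<^esub> y) = coord_pr I G S x \<otimes>\<^bsub>?G\<^esub> coord_pr I G S y" for y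
      by (auto simp: coord_pr_def r1 one intro!: restrict_ext)
    show "coord_pr I G S (coord_pr I G S' x) = coord_pr I G (S \<inter> S') x"
      by (auto simp: coord_pr_def intro!: restrict_ext)
    show "coord_pr I G I x = x" using x by (auto simp: coord_pr_def PiE_iff extensional_def)
    show "coord_pr I G {} x = \<one>\<^bsub>?G\<^esub>" by (simp add: coord_pr_def)
    show "coord_pr I G (S \<union> S') x = coord_pr I G S x \<otimes>\<^bsub>?G\<^esub> coord_pr I G S' x" if "S \<inter> S' = {}"
      using x that by (auto simp: coord_pr_def r1 one PiE_iff intro!: restrict_ext)
  next
    fix S
    show "continuous_map ?T ?T (coord_pr I G S)"
    proof (rule continuous_map_coordinatewise_then_product)
      fix i assume i: "i \<in> I"
      have "\<one>\<^bsub>G i\<^esub> \<in> topspace (T i)" using grp[OF i] ts[OF i] by (simp add: group.is_monoid monoid.one_closed)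
      then show "continuous_map ?T (T i) (\<lambda>x. coord_pr I G S x i)"
        using i coord[OF i] by (cases "i \<in> S") (simp_all add: coord_pr_def)
    qed (simp add: coord_pr_def)
  qed
  ultimately show ?thesis by (rule tdlc_product.intro)
qed

locale tdlc_family =
  fixes I :: "'i set" and G :: "'i \<Rightarrow> ('a, 'b) monoid_scheme" and T :: "'i \<Rightarrow> 'a topology"
  assumes finite_index_set: "finite I" and tdlc: "i \<in> I \<Longrightarrow> tdlc_group (G i) (T i)"
begin

abbreviation "GG \<equiv> product_group I G"
abbreviation "TT \<equiv> product_topology T I"

sublocale tdlc_product GG TT I "coord_pr I G"
  by (rule tdlc_product_group[OF finite_index_set tdlc])

definition emb :: "'i \<Rightarrow> 'a \<Rightarrow> 'i \<Rightarrow> 'a" where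
  "emb i x = (\<lambda>j\<in>I. if j = i then x else \<one>\<^bsub>G j\<^esub>)"

lemma fam: "i \<in> I \<Longrightarrow> group (G i)" "i \<in> I \<Longrightarrow> topspace (T i) = carrier (G i)"
  "i \<in> I \<Longrightarrow> \<one>\<^bsub>G i\<^esub> \<in> carrier (G i)" "i \<in> I \<Longrightarrow> \<one>\<^bsub>G i\<^esub> \<otimes>\<^bsub>G i\<^esub> \<one>\<^bsub>G i\<^esub> = \<one>\<^bsub>G i\<^esub>"
proof -
  assume "i \<in> I"
  then interpret F: tdlc_group "G i" "T i" by (rule tdlc)
  show "group (G i)" "topspace (T i) = carrier (G i)"
    "\<one>\<^bsub>G i\<^esub> \<in> carrier (G i)" "\<one>\<^bsub>G i\<^esub> \<otimes>\<^bsub>G i\<^esub> \<one>\<^bsub>G i\<^esub> = \<one>\<^bsub>G i\<^esub>"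
    using F.group_axioms by auto
qed

lemma emb_in: "i \<in> I \<Longrightarrow> x \<in> carrier (G i) \<Longrightarrow> emb i x \<in> carrier GG"
  by (simp add: emb_def fam(3))

lemma emb_hom: "i \<in> I \<Longrightarrow> emb i \<in> hom (G i) GG"
proof (rule homI)
  assume i: "i \<in> I"
  show "emb i x \<in> carrier GG" if "x \<in> carrier (G i)" for x by (rule emb_in[OF i that])
  show "emb i (x \<otimes>\<^bsub>G i\<^esub> y) = emb i x \<otimes>\<^bsub>GG\<^esub> emb i y" for x y
    by (auto simp: emb_def fam(4) intro!: restrict_ext)
qed

lemma emb_apply: "i \<in> I \<Longrightarrow> emb i x i = x"
  by (simp add: emb_def)

lemma emb_cont: "i \<in> I \<Longrightarrow> continuous_map (T i) TT (emb i)"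
proof (rule continuous_map_coordinatewise_then_product)
  fix j assume i: "i \<in> I" and j: "j \<in> I"
  have "\<one>\<^bsub>G j\<^esub> \<in> topspace (T j)" using fam[OF j] by simp
  then show "continuous_map (T i) (T j) (\<lambda>x. emb i x j)"
    using j by (cases "j = i") (simp_all add: emb_def)
qed (simp add: emb_def)

lemma coord_in: "i \<in> I \<Longrightarrow> x \<in> carrier GG \<Longrightarrow> x i \<in> carrier (G i)"
  by auto

lemma coord_pr_single: "coord_pr I G {i} x = emb i (x i)"
  by (auto simp: coord_pr_def emb_def intro!: restrict_ext)

lemma emb_in_fac: "i \<in> I \<Longrightarrow> x \<in> carrier (G i) \<Longrightarrow> emb i x \<in> fac {i}"
  using emb_in[of i x] emb_apply[of i x] unfolding fac_def coord_pr_single by simp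

lemma fac_single: assumes "i \<in> I" shows "emb i ` carrier (G i) = fac {i}"
proof (intro equalityI subsetI)
  fix y assume y: "y \<in> fac {i}"
  then have yG: "y \<in> carrier GG" "y = emb i (y i)" using facD[of y "{i}"] unfolding coord_pr_single by auto
  then show "y \<in> emb i ` carrier (G i)" using coord_in[OF assms yG(1)] by blast
qed (use emb_in_fac[OF assms] in blast)

lemma fac_eq: "fac S = {x \<in> carrier GG. \<forall>i\<in>I - S. x i = \<one>\<^bsub>G i\<^esub>}"
proof (intro equalityI subsetI)
  fix x assume x: "x \<in> fac S"
  have xG: "x \<in> carrier GG" and e: "coord_pr I G S x = x" using facD[OF x] by auto
  have "x i = \<one>\<^bsub>G i\<^esub>" if "i \<in> I - S" for i
    using fun_cong[OF e, of i] that by (simp add: coord_pr_def)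
  then show "x \<in> {x \<in> carrier GG. \<forall>i\<in>I - S. x i = \<one>\<^bsub>G i\<^esub>}" using xG by blast
next
  fix x assume "x \<in> {x \<in> carrier GG. \<forall>i\<in>I - S. x i = \<one>\<^bsub>G i\<^esub>}"
  then have x: "x \<in> carrier GG" "\<And>i. i \<in> I - S \<Longrightarrow> x i = \<one>\<^bsub>G i\<^esub>" by blast+
  have "coord_pr I G S x = x"
  proof
    fix i show "coord_pr I G S x i = x i"
      using x by (cases "i \<in> I") (auto simp: coord_pr_def PiE_iff extensional_def)
  qed
  then show "x \<in> fac S" using x(1) unfolding fac_def by blast
qed

lemma coord_cont: "i \<in> I \<Longrightarrow> continuous_map TT (T i) (\<lambda>x. x i)"
  by simp

lemma closed_embedding_factor:
  assumes i: "i \<in> I"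
  shows "closed_embedding GG TT (G i) (T i) (emb i) (\<lambda>x. x i)"
proof (intro closed_embedding.intro closed_embedding_axioms.intro)
  show "tdlc_group GG TT" by (rule tdlc_group_axioms)
  show "locally_compact_group (G i) (T i)" using tdlc[OF i] by (rule tdlc_group.axioms)
  show "continuous_map (subtopology TT (emb i ` carrier (G i))) (T i) (\<lambda>x. x i)"
    by (rule continuous_map_from_subtopology[OF coord_cont[OF i]])
  show "closedin TT (emb i ` carrier (G i))" unfolding fac_single[OF i] by (rule closedin_fac)
qed (use emb_hom emb_cont emb_apply i in auto)

lemma closed_embedding_subgroup:
  assumes i: "i \<in> I" and X: "X \<subseteq> fac {i}" "closedin TT X"
    and H: "H = {x \<in> carrier (G i). emb i x \<in> X}"
    and lc: "locally_compact_group (G i\<lparr>carrier := H\<rparr>) (subtopology (T i) H)"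
  shows "closed_embedding GG TT (G i\<lparr>carrier := H\<rparr>) (subtopology (T i) H) (emb i) (\<lambda>x. x i)" "emb i ` H = X"
proof -
  show e: "emb i ` H = X" unfolding H using X(1) unfolding fac_single[OF i, symmetric] by auto
  show "closed_embedding GG TT (G i\<lparr>carrier := H\<rparr>) (subtopology (T i) H) (emb i) (\<lambda>x. x i)"
  proof (intro closed_embedding.intro closed_embedding_axioms.intro)
    show "tdlc_group GG TT" by (rule tdlc_group_axioms)
    show "locally_compact_group (G i\<lparr>carrier := H\<rparr>) (subtopology (T i) H)" by (rule lc)
    have HG: "H \<subseteq> carrier (G i)" unfolding H by blast
    show "emb i \<in> hom (G i\<lparr>carrier := H\<rparr>) GG"
    proof (rule homI)
      show "emb i x \<in> carrier GG" if "x \<in> carrier (G i\<lparr>carrier := H\<rparr>)" for x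
        by (rule emb_in[OF i]) (use that HG in auto)
      fix x y assume "x \<in> carrier (G i\<lparr>carrier := H\<rparr>)" "y \<in> carrier (G i\<lparr>carrier := H\<rparr>)"
      then have "x \<in> carrier (G i)" "y \<in> carrier (G i)" using HG by auto
      from hom_mult[OF emb_hom[OF i] this]
      show "emb i (x \<otimes>\<^bsub>G i\<lparr>carrier := H\<rparr>\<^esub> y) = emb i x \<otimes>\<^bsub>GG\<^esub> emb i y" by simp
    qed
    show "continuous_map (subtopology (T i) H) TT (emb i)"
      by (rule continuous_map_from_subtopology[OF emb_cont[OF i]])
    show "closedin TT (emb i ` carrier (G i\<lparr>carrier := H\<rparr>))" using e X(2) by simp
    have "continuous_map (subtopology TT X) (subtopology (T i) H) (\<lambda>x. x i)"
    proof (rule continuous_map_into_subtopology)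
      show "continuous_map (subtopology TT X) (T i) (\<lambda>x. x i)"
        by (rule continuous_map_from_subtopology[OF coord_cont[OF i]])
      show "(\<lambda>x. x i) \<in> topspace (subtopology TT X) \<rightarrow> H"
        using e emb_apply[OF i] by auto
    qed
    then show "continuous_map (subtopology TT (emb i ` carrier (G i\<lparr>carrier := H\<rparr>))) (subtopology (T i) H) (\<lambda>x. x i)"
      using e by simp
  qed (use emb_apply[OF i] in auto)
qed

end

section \<open>Direct decompositions of subgroups\<close>

context group begin

lemma iso_image_normal:
  assumes \<Lambda>: "subgroup \<Lambda> G" and K: "group K" and \<phi>: "\<phi> \<in> iso K (G\<lparr>carrier := \<Lambda>\<rparr>)"
    and N: "N \<lhd> K" "\<not> N \<subseteq> {\<one>\<^bsub>K\<^esub>}"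
  shows "subgroup (\<phi> ` N) G" "\<phi> ` N \<subseteq> \<Lambda>" "normalizes \<Lambda> (\<phi> ` N)" "\<not> \<phi> ` N \<subseteq> {\<one>}"
proof -
  interpret K: group K by (rule K)
  have \<Lambda>g: "group (G\<lparr>carrier := \<Lambda>\<rparr>)" by (rule subgroup_imp_group[OF \<Lambda>])
  have hom: "\<phi> \<in> hom K (G\<lparr>carrier := \<Lambda>\<rparr>)" and bij: "bij_betw \<phi> (carrier K) \<Lambda>"
    using \<phi> by (auto simp: iso_def)
  have \<Lambda>G: "\<Lambda> \<subseteq> carrier G" using \<Lambda> subgroup.subset by blast
  have im: "\<phi> ` carrier K = \<Lambda>" using bij by (simp add: bij_betw_def)
  have homG: "\<phi> \<in> hom K G"
  proof (rule homI)
    show "\<phi> x \<in> carrier G" if "x \<in> carrier K" for x using that im \<Lambda>G by blast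
    show "\<phi> (x \<otimes>\<^bsub>K\<^esub> y) = \<phi> x \<otimes> \<phi> y" if "x \<in> carrier K" "y \<in> carrier K" for x y
      using hom_mult[OF hom that] by simp
  qed
  interpret h: group_hom K G \<phi>
    by (intro group_hom.intro group_hom_axioms.intro K group_axioms homG)
  have sN: "subgroup N K" by (rule normal_imp_subgroup[OF N(1)])
  have NK: "N \<subseteq> carrier K" using sN subgroup.subset by blast
  show "subgroup (\<phi> ` N) G" by (rule h.subgroup_img_is_subgroup[OF sN])
  show "\<phi> ` N \<subseteq> \<Lambda>" using NK im by blast
  show "normalizes \<Lambda> (\<phi> ` N)" unfolding normalizes_def
  proof (intro ballI)
    fix x y assume "x \<in> \<Lambda>" "y \<in> \<phi> ` N"
    then obtain k m where km: "k \<in> carrier K" "x = \<phi> k" "m \<in> N" "y = \<phi> m" using im by blast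
    have mK: "m \<in> carrier K" using km NK by blast
    have "k \<otimes>\<^bsub>K\<^esub> m \<otimes>\<^bsub>K\<^esub> inv\<^bsub>K\<^esub> k \<in> N" using N(1) km K.normal_inv_iff by blast
    moreover have "\<phi> (k \<otimes>\<^bsub>K\<^esub> m \<otimes>\<^bsub>K\<^esub> inv\<^bsub>K\<^esub> k) = x \<otimes> y \<otimes> inv x" using km mK by simp
    ultimately show "x \<otimes> y \<otimes> inv x \<in> \<phi> ` N" by (metis imageI)
  qed
  show "\<not> \<phi> ` N \<subseteq> {\<one>}"
  proof
    assume s: "\<phi> ` N \<subseteq> {\<one>}"
    obtain m where m: "m \<in> N" "m \<noteq> \<one>\<^bsub>K\<^esub>" using N(2) by blast
    then have "\<phi> m = \<phi> \<one>\<^bsub>K\<^esub>" using s by auto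
    then have "m = \<one>\<^bsub>K\<^esub>"
      using inj_onD[OF bij_betw_imp_inj_on[OF bij], of m "\<one>\<^bsub>K\<^esub>"] m(1) NK by auto
    then show False using m by simp
  qed
qed

text \<open>The two subgroups are the images of the coordinate subgroups of the abstract product;
  they are all that the argument for (Irr4) retains of the decomposition.\<close>

lemma direct_product_commuting_normal_subgroups:
  assumes \<Lambda>: "subgroup \<Lambda> G" and AB: "group A" "group B" "\<not> trivial_group A" "\<not> trivial_group B"
    and i: "G\<lparr>carrier := \<Lambda>\<rparr> \<cong> A \<times>\<times> B"
  obtains A' B' where "subgroup A' G" "A' \<subseteq> \<Lambda>" "normalizes \<Lambda> A'" "\<not> A' \<subseteq> {\<one>}"
    "subgroup B' G" "B' \<subseteq> \<Lambda>" "normalizes \<Lambda> B'" "\<not> B' \<subseteq> {\<one>}"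
    "\<forall>a\<in>A'. \<forall>b\<in>B'. a \<otimes> b = b \<otimes> a"
proof -
  interpret A: group A by fact
  interpret B: group B by fact
  have K: "group (A \<times>\<times> B)" by (rule DirProd_group[OF AB(1,2)])
  obtain \<phi> where \<phi>: "\<phi> \<in> iso (A \<times>\<times> B) (G\<lparr>carrier := \<Lambda>\<rparr>)"
    using group.iso_sym[OF subgroup_imp_group[OF \<Lambda>] i] by (auto simp: is_iso_def)
  have NA: "carrier A \<times> {\<one>\<^bsub>B\<^esub>} \<lhd> A \<times>\<times> B" by (rule A.DirProd_normal[OF AB(2) A.normal_self B.one_is_normal])
  have NB: "{\<one>\<^bsub>A\<^esub>} \<times> carrier B \<lhd> A \<times>\<times> B" by (rule A.DirProd_normal[OF AB(2) A.one_is_normal B.normal_self])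
  have tA: "\<not> carrier A \<times> {\<one>\<^bsub>B\<^esub>} \<subseteq> {\<one>\<^bsub>A \<times>\<times> B\<^esub>}"
    using AB(1,3) unfolding trivial_group_def by auto
  have tB: "\<not> {\<one>\<^bsub>A\<^esub>} \<times> carrier B \<subseteq> {\<one>\<^bsub>A \<times>\<times> B\<^esub>}"
    using AB(2,4) unfolding trivial_group_def by auto
  note a = iso_image_normal[OF \<Lambda> K \<phi> NA tA] and b = iso_image_normal[OF \<Lambda> K \<phi> NB tB]
  have hom: "\<phi> \<in> hom (A \<times>\<times> B) (G\<lparr>carrier := \<Lambda>\<rparr>)" using \<phi> by (simp add: iso_def)
  have "\<phi> (x, \<one>\<^bsub>B\<^esub>) \<otimes> \<phi> (\<one>\<^bsub>A\<^esub>, y) = \<phi> (\<one>\<^bsub>A\<^esub>, y) \<otimes> \<phi> (x, \<one>\<^bsub>B\<^esub>)"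
    if "x \<in> carrier A" "y \<in> carrier B" for x y
    using hom_mult[OF hom, of "(x, \<one>\<^bsub>B\<^esub>)" "(\<one>\<^bsub>A\<^esub>, y)"] hom_mult[OF hom, of "(\<one>\<^bsub>A\<^esub>, y)" "(x, \<one>\<^bsub>B\<^esub>)"] that by simp
  then have "\<forall>a\<in>\<phi> ` (carrier A \<times> {\<one>\<^bsub>B\<^esub>}). \<forall>b\<in>\<phi> ` ({\<one>\<^bsub>A\<^esub>} \<times> carrier B). a \<otimes> b = b \<otimes> a" by blast
  with a b show ?thesis by (rule that)
qed

end

section \<open>Internal forms of the conditions\<close>

context product_lattice begin

lemma product_part_commute: "P \<inter> S = {} \<Longrightarrow> product_part P S = product_part S P"
  unfolding product_part_def using fac_commute[of _ P _ S] by (metis (no_types, lifting) IntE)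

lemma product_part_iso:
  assumes PS: "P \<inter> S = {}"
  shows "(\<lambda>(a, b). a \<otimes> b) \<in> iso (G\<lparr>carrier := fac P \<inter> \<Gamma>\<rparr> \<times>\<times> G\<lparr>carrier := fac S \<inter> \<Gamma>\<rparr>)
    (G\<lparr>carrier := product_part P S\<rparr>)"
proof (rule isoI)
  show "(\<lambda>(a, b). a \<otimes> b) \<in> hom (G\<lparr>carrier := fac P \<inter> \<Gamma>\<rparr> \<times>\<times> G\<lparr>carrier := fac S \<inter> \<Gamma>\<rparr>)
      (G\<lparr>carrier := product_part P S\<rparr>)"
  proof (rule homI)
    fix x assume "x \<in> carrier (G\<lparr>carrier := fac P \<inter> \<Gamma>\<rparr> \<times>\<times> G\<lparr>carrier := fac S \<inter> \<Gamma>\<rparr>)"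
    then show "(\<lambda>(a, b). a \<otimes> b) x \<in> carrier (G\<lparr>carrier := product_part P S\<rparr>)"
      unfolding product_part_def by auto
    fix y assume y: "y \<in> carrier (G\<lparr>carrier := fac P \<inter> \<Gamma>\<rparr> \<times>\<times> G\<lparr>carrier := fac S \<inter> \<Gamma>\<rparr>)"
    assume x: "x \<in> carrier (G\<lparr>carrier := fac P \<inter> \<Gamma>\<rparr> \<times>\<times> G\<lparr>carrier := fac S \<inter> \<Gamma>\<rparr>)"
    obtain a b where ab: "x = (a, b)" "a \<in> fac P" "b \<in> fac S" using x by auto
    obtain c d where cd: "y = (c, d)" "c \<in> fac P" "d \<in> fac S" using y by auto
    have g: "a \<in> carrier G" "b \<in> carrier G" "c \<in> carrier G" "d \<in> carrier G" using ab cd facD by auto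
    have "(a \<otimes> c) \<otimes> (b \<otimes> d) = a \<otimes> (c \<otimes> b) \<otimes> d" using g by (simp add: m_assoc)
    also have "\<dots> = (a \<otimes> b) \<otimes> (c \<otimes> d)" unfolding fac_commute[OF cd(2) ab(3) PS] using g by (simp add: m_assoc)
    finally show "(\<lambda>(a, b). a \<otimes> b) (x \<otimes>\<^bsub>G\<lparr>carrier := fac P \<inter> \<Gamma>\<rparr> \<times>\<times> G\<lparr>carrier := fac S \<inter> \<Gamma>\<rparr>\<^esub> y) =
        (\<lambda>(a, b). a \<otimes> b) x \<otimes>\<^bsub>G\<lparr>carrier := product_part P S\<rparr>\<^esub> (\<lambda>(a, b). a \<otimes> b) y"
      unfolding ab(1) cd(1) by simp
  qed
  have pr: "pr P (a \<otimes> b) = a" "pr S (a \<otimes> b) = b" if "a \<in> fac P" "b \<in> fac S" for a b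
  proof -
    have g: "a \<in> carrier G" "b \<in> carrier G" using that facD by auto
    have SP: "S \<inter> P = {}" using PS by auto
    show "pr P (a \<otimes> b) = a" "pr S (a \<otimes> b) = b"
      using g facD(2)[OF that(1)] facD(2)[OF that(2)] fac_disjoint[OF that(2) PS] fac_disjoint[OF that(1) SP]
      by (simp_all add: pr_mult)
  qed
  show "bij_betw (\<lambda>(a, b). a \<otimes> b) (carrier (G\<lparr>carrier := fac P \<inter> \<Gamma>\<rparr> \<times>\<times> G\<lparr>carrier := fac S \<inter> \<Gamma>\<rparr>))
      (carrier (G\<lparr>carrier := product_part P S\<rparr>))"
    unfolding bij_betw_def
  proof
    show "inj_on (\<lambda>(a, b). a \<otimes> b) (carrier (G\<lparr>carrier := fac P \<inter> \<Gamma>\<rparr> \<times>\<times> G\<lparr>carrier := fac S \<inter> \<Gamma>\<rparr>))"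
    proof (rule inj_onI, clarsimp)
      fix a b c d assume *: "a \<in> fac P" "c \<in> fac P" "b \<in> fac S" "d \<in> fac S" "a \<otimes> b = c \<otimes> d"
      show "a = c \<and> b = d"
        using pr[OF *(1,3)] pr[OF *(2,4)] unfolding *(5) by simp
    qed
    show "(\<lambda>(a, b). a \<otimes> b) ` carrier (G\<lparr>carrier := fac P \<inter> \<Gamma>\<rparr> \<times>\<times> G\<lparr>carrier := fac S \<inter> \<Gamma>\<rparr>) =
        carrier (G\<lparr>carrier := product_part P S\<rparr>)"
      unfolding product_part_def by auto
  qed
qed

lemma inj_on_pr_iff: "inj_on (pr S) \<Gamma> \<longleftrightarrow> (\<forall>g\<in>\<Gamma>. pr S g = \<one> \<longrightarrow> g = \<one>)"
proof
  assume inj: "inj_on (pr S) \<Gamma>"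
  show "\<forall>g\<in>\<Gamma>. pr S g = \<one> \<longrightarrow> g = \<one>"
    using inj_onD[OF inj, of _ \<one>] subgroup.one_closed[OF subgroup_\<Gamma>] by auto
next
  assume tr: "\<forall>g\<in>\<Gamma>. pr S g = \<one> \<longrightarrow> g = \<one>"
  show "inj_on (pr S) \<Gamma>"
  proof (rule inj_onI)
    fix x y assume x: "x \<in> \<Gamma>" and y: "y \<in> \<Gamma>" and e: "pr S x = pr S y"
    have g: "x \<in> carrier G" "y \<in> carrier G" using x y \<Gamma>_subset by auto
    have "x \<otimes> inv y \<in> \<Gamma>" using x y subgroup_\<Gamma> by (simp add: subgroup.m_closed subgroup.m_inv_closed)
    moreover have "pr S (x \<otimes> inv y) = \<one>" using g e by (simp add: pr_mult pr_inv)
    ultimately have "x \<otimes> inv y = \<one>" using tr by blast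
    then have "x \<otimes> inv y \<otimes> y = y" using g by simp
    then show "x = y" using g by (simp add: m_assoc)
  qed
qed

text \<open>(Irr3) in internal form, see \<open>irr3_iff\<close>.\<close>

definition irreducible_projections :: bool where
  "irreducible_projections \<longleftrightarrow> (\<forall>S. S \<subset> I \<and> S \<noteq> {} \<longrightarrow> \<not> discr (pr S ` \<Gamma>))"

text \<open>This compares (Irr3) with (Irr0). A virtual product has a discrete projection by
  \<open>discr_if_finite_index\<close>; conversely a discrete projection to \<open>S\<close> gives
  the product part for \<open>I - S\<close> and \<open>S\<close> finite index by
  \<open>finite_index_if_discr\<close>.\<close>

lemma irreducible_projections_iff:
  "irreducible_projections \<longleftrightarrow> (\<forall>P S. P \<union> S = I \<and> P \<inter> S = {} \<and> P \<noteq> {} \<and> S \<noteq> {} \<longrightarrow>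
    \<not> finite_index_in (product_part P S))"
proof
  assume irr: irreducible_projections
  show "\<forall>P S. P \<union> S = I \<and> P \<inter> S = {} \<and> P \<noteq> {} \<and> S \<noteq> {} \<longrightarrow> \<not> finite_index_in (product_part P S)"
  proof (intro allI impI notI, elim conjE)
    fix P S assume PS: "P \<union> S = I" "P \<inter> S = {}" "P \<noteq> {}" "S \<noteq> {}" "finite_index_in (product_part P S)"
    have "S \<subset> I" using PS by auto
    then show False using discr_if_finite_index[OF PS(2,5)] irr PS(4) unfolding irreducible_projections_def by blast
  qed
next
  assume irr: "\<forall>P S. P \<union> S = I \<and> P \<inter> S = {} \<and> P \<noteq> {} \<and> S \<noteq> {} \<longrightarrow> \<not> finite_index_in (product_part P S)"
  show irreducible_projections unfolding irreducible_projections_def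
  proof (intro allI impI notI, elim conjE)
    fix S assume S: "S \<subset> I" "S \<noteq> {}" "discr (pr S ` \<Gamma>)"
    have "(I - S) \<union> S = I \<and> (I - S) \<inter> S = {} \<and> I - S \<noteq> {} \<and> S \<noteq> {}" using S by auto
    moreover have "finite_index_in (product_part (I - S) S)" using finite_index_if_discr[OF _ S(3)] S(1) by blast
    ultimately show False using irr by blast
  qed
qed

lemma product_parts_nontrivial:
  assumes PS: "P \<union> S = I" "P \<inter> S = {}" "P \<noteq> {}" "S \<noteq> {}" and fi: "finite_index_in (product_part P S)"
  shows "\<not> fac P \<inter> \<Gamma> \<subseteq> {\<one>}" "\<not> fac S \<inter> \<Gamma> \<subseteq> {\<one>}"
proof -
  show "\<not> fac P \<inter> \<Gamma> \<subseteq> {\<one>}" by (rule product_part_nontrivial[OF PS(1,2,3) fi])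
  have SP: "S \<union> P = I" "S \<inter> P = {}" using PS by auto
  show "\<not> fac S \<inter> \<Gamma> \<subseteq> {\<one>}"
    by (rule product_part_nontrivial[OF SP PS(4)]) (use fi product_part_commute[OF PS(2)] in simp)
qed

text \<open>Elements of \<Gamma> in \<open>fac P\<close> have trivial coordinates in
  \<open>S\<close>, so injectivity makes them trivial, whereas both parts of a virtual product are
  non-trivial.\<close>

lemma irreducible_if_injective:
  assumes inj: "\<And>i. i \<in> I \<Longrightarrow> inj_on (pr {i}) \<Gamma>"
  shows irreducible_projections
  unfolding irreducible_projections_iff
proof (intro allI impI notI, elim conjE)
  fix P S assume PS: "P \<union> S = I" "P \<inter> S = {}" "P \<noteq> {}" "S \<noteq> {}" and fi: "finite_index_in (product_part P S)"
  obtain j where j: "j \<in> S" using PS by blast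
  have "fac P \<inter> \<Gamma> \<subseteq> {\<one>}"
  proof
    fix g assume g: "g \<in> fac P \<inter> \<Gamma>"
    then have "pr {j} g = \<one>" using fac_disjoint[of g P "{j}"] j PS(2) by blast
    then show "g \<in> {\<one>}" using inj[of j] g j PS(1) unfolding inj_on_pr_iff by blast
  qed
  then show False using product_parts_nontrivial(1)[OF PS fi] by simp
qed

lemma injective_if_irreducible:
  assumes "\<And>j. j \<in> I \<Longrightarrow> jnc (fac {j})" irreducible_projections "i \<in> I"
  shows "inj_on (pr {i}) \<Gamma>"
  unfolding inj_on_pr_iff
proof (intro ballI impI)
  fix g assume "g \<in> \<Gamma>" "pr {i} g = \<one>"
  from injective_if_projections_nondiscr[OF assms(1) _ assms(3) this]
  show "g = \<one>" using assms(2) unfolding irreducible_projections_def by blast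
qed

end

section \<open>The irreducibility conditions\<close>

locale lattice_family = tdlc_family I G T + product_lattice "product_group I G" "product_topology T I" I "coord_pr I G" \<Gamma>
  for I :: "nat set" and G :: "nat \<Rightarrow> 'a monoid" and T :: "nat \<Rightarrow> 'a topology" and \<Gamma> +
  fixes n :: nat
  assumes I_eq: "I = {1..n}"
begin

lemma subproduct_eq: "subproduct n G S = fac S"
  unfolding subproduct_def I_eq[symmetric] fac_eq ..

lemma finite_index_in_iff:
  assumes "subgroup \<Lambda> GG" "\<Lambda> \<subseteq> \<Gamma>"
  shows "finite_index (GG\<lparr>carrier := \<Gamma>\<rparr>) \<Lambda> \<longleftrightarrow> finite_index_in \<Lambda>"
  unfolding finite_index_iff[OF subgroup_\<Gamma> assms] finite_index_in_def ..

lemma irr0_iff: "irr0 n G \<Gamma> \<longleftrightarrow> irreducible_projections"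
proof -
  have "(subproduct n G P \<inter> \<Gamma>) <#>\<^bsub>GG\<^esub> (subproduct n G S \<inter> \<Gamma>) = product_part P S" for P S
    unfolding subproduct_eq set_mult_def product_part_def by blast
  then show ?thesis
    unfolding irr0_def irreducible_projections_iff I_eq[symmetric]
    using finite_index_in_iff[OF subgroup_product_part] by (metis (no_types, lifting))
qed

text \<open>A continuous section of restriction to \<open>S\<close>. It identifies the product over
  \<open>S\<close>, in which the conditions are formulated, with \<open>fac S\<close> in the full
  product.\<close>

definition extend_one :: "nat set \<Rightarrow> (nat \<Rightarrow> 'a) \<Rightarrow> nat \<Rightarrow> 'a" where
  "extend_one S y = (\<lambda>i\<in>I. if i \<in> S then y i else \<one>\<^bsub>G i\<^esub>)"

lemma restrict_cont:
  assumes "S \<subseteq> I"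
  shows "continuous_map TT (product_topology T S) (\<lambda>x. restrict x S)"
proof (rule continuous_map_coordinatewise_then_product)
  fix i assume i: "i \<in> S"
  then show "continuous_map TT (T i) (\<lambda>x. restrict x S i)" using coord_cont[of i] assms by auto
qed simp

lemma extend_one_cont: "continuous_map (product_topology T S) TT (extend_one S)"
proof (rule continuous_map_coordinatewise_then_product)
  fix i assume i: "i \<in> I"
  have "\<one>\<^bsub>G i\<^esub> \<in> topspace (T i)" using fam[OF i] by simp
  then show "continuous_map (product_topology T S) (T i) (\<lambda>x. extend_one S x i)"
    using i by (cases "i \<in> S") (simp_all add: extend_one_def)
qed (simp add: extend_one_def)

lemma extend_one_restrict: "extend_one S (restrict x S) = coord_pr I G S x"
  by (auto simp: extend_one_def coord_pr_def)

lemma restrict_coord_pr: "S \<subseteq> I \<Longrightarrow> restrict (coord_pr I G S x) S = restrict x S"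
  by (auto simp: coord_pr_def fun_eq_iff restrict_def)

text \<open>Restriction and \<open>extend_one\<close> are continuous and injective on the two sets
  concerned and map each onto the other, so discreteness can be pulled back in both
  directions.\<close>

lemma discretein_restrict_iff:
  assumes S: "S \<subseteq> I"
  shows "discretein (product_topology T S) ((\<lambda>x. restrict x S) ` \<Gamma>) \<longleftrightarrow> discr (coord_pr I G S ` \<Gamma>)"
proof -
  have sP: "subgroup (coord_pr I G S ` \<Gamma>) GG" by (rule subgroup_pr_image[OF subgroup_\<Gamma>])
  have PT: "coord_pr I G S ` \<Gamma> \<subseteq> topspace TT"
    using subgroup.subset[OF sP] unfolding topspace_eq_carrier .
  have \<Gamma>T: "\<Gamma> \<subseteq> topspace TT" using \<Gamma>_subset unfolding topspace_eq_carrier .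
  have r: "(\<lambda>x. restrict x S) ` coord_pr I G S ` \<Gamma> = (\<lambda>x. restrict x S) ` \<Gamma>"
    by (simp only: image_image restrict_coord_pr[OF S])
  have e: "extend_one S ` (\<lambda>x. restrict x S) ` \<Gamma> = coord_pr I G S ` \<Gamma>"
    by (simp only: image_image extend_one_restrict)
  have rT: "(\<lambda>x. restrict x S) ` \<Gamma> \<subseteq> topspace (product_topology T S)"
    using continuous_map_image_subset_topspace[OF restrict_cont[OF S]] \<Gamma>T by blast
  have "inj_on (\<lambda>x. restrict x S) (coord_pr I G S ` \<Gamma>)"
  proof (rule inj_onI)
    fix x y assume "x \<in> coord_pr I G S ` \<Gamma>" "y \<in> coord_pr I G S ` \<Gamma>" and e: "restrict x S = restrict y S"
    then obtain a b where ab: "x = coord_pr I G S a" "y = coord_pr I G S b" by blast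
    then have "restrict a S = restrict b S" using e restrict_coord_pr[OF S] by simp
    then show "x = y" unfolding ab extend_one_restrict[symmetric] by simp
  qed
  then have 1: "discr (coord_pr I G S ` \<Gamma>)" if "discretein (product_topology T S) ((\<lambda>x. restrict x S) ` \<Gamma>)"
    using discretein_inj_preimage[OF restrict_cont[OF S] PT] that discr_iff_discretein[OF sP] unfolding r by blast
  have "inj_on (extend_one S) ((\<lambda>x. restrict x S) ` \<Gamma>)"
  proof (rule inj_onI)
    fix x y assume "x \<in> (\<lambda>x. restrict x S) ` \<Gamma>" "y \<in> (\<lambda>x. restrict x S) ` \<Gamma>" and e: "extend_one S x = extend_one S y"
    then obtain a b where ab: "x = restrict a S" "y = restrict b S" by blast
    then have "coord_pr I G S a = coord_pr I G S b" using e extend_one_restrict by simp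
    then show "x = y" using restrict_coord_pr[OF S, of a] restrict_coord_pr[OF S, of b] ab by simp
  qed
  then have 2: "discretein (product_topology T S) ((\<lambda>x. restrict x S) ` \<Gamma>)" if "discr (coord_pr I G S ` \<Gamma>)"
    using discretein_inj_preimage[OF extend_one_cont rT] that discr_iff_discretein[OF sP] unfolding e by blast
  show ?thesis using 1 2 by blast
qed

lemma irr3_iff: "irr3 n T \<Gamma> \<longleftrightarrow> irreducible_projections"
proof -
  have "discretein (product_topology T S) ((\<lambda>x. restrict x S) ` \<Gamma>) \<longleftrightarrow> discr (coord_pr I G S ` \<Gamma>)"
    if "S \<subset> I" for S using discretein_restrict_iff that by blast
  then show ?thesis unfolding irr3_def irreducible_projections_def I_eq[symmetric] by blast
qed

lemma irr2_iff: "irr2 n \<Gamma> \<longleftrightarrow> (\<forall>i\<in>I. inj_on (coord_pr I G {i}) \<Gamma>)"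
proof
  assume irr: "irr2 n \<Gamma>"
  show "\<forall>i\<in>I. inj_on (coord_pr I G {i}) \<Gamma>"
  proof (intro ballI inj_onI)
    fix i x y assume i: "i \<in> I" and xy: "x \<in> \<Gamma>" "y \<in> \<Gamma>" "coord_pr I G {i} x = coord_pr I G {i} y"
    have s: "{i} \<subseteq> I" using i by simp
    have "restrict x {i} = restrict y {i}"
      using xy(3) restrict_coord_pr[OF s, of x] restrict_coord_pr[OF s, of y] by simp
    moreover have "inj_on (\<lambda>x. restrict x {i}) \<Gamma>" using irr s unfolding irr2_def I_eq by blast
    ultimately show "x = y" using xy(1,2) by (auto dest: inj_onD)
  qed
next
  assume inj: "\<forall>i\<in>I. inj_on (coord_pr I G {i}) \<Gamma>"
  show "irr2 n \<Gamma>" unfolding irr2_def I_eq[symmetric]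
  proof (intro allI impI inj_onI, elim conjE)
    fix S x y assume S: "S \<subseteq> I" "S \<noteq> {}" and xy: "x \<in> \<Gamma>" "y \<in> \<Gamma>" "restrict x S = restrict y S"
    obtain i where i: "i \<in> S" using S by blast
    have "x i = y i" using fun_cong[OF xy(3), of i] i by simp
    then have "coord_pr I G {i} x = coord_pr I G {i} y" unfolding coord_pr_single by simp
    then show "x = y" using inj i S(1) xy(1,2) by (blast dest: inj_onD)
  qed
qed

lemma restrict_mem_closure:
  assumes S: "S \<subseteq> I" and x: "x \<in> closed_pr S"
  shows "restrict x S \<in> product_topology T S closure_of ((\<lambda>x. restrict x S) ` \<Gamma>)"
proof -
  have "(\<lambda>x. restrict x S) ` (TT closure_of (coord_pr I G S ` \<Gamma>)) \<subseteq>
      product_topology T S closure_of ((\<lambda>x. restrict x S) ` coord_pr I G S ` \<Gamma>)"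
    by (rule continuous_map_image_closure_subset[OF restrict_cont[OF S]])
  moreover have "(\<lambda>x. restrict x S) ` coord_pr I G S ` \<Gamma> = (\<lambda>x. restrict x S) ` \<Gamma>"
    by (simp only: image_image restrict_coord_pr[OF S])
  ultimately show ?thesis using x unfolding closed_pr_def by auto
qed

text \<open>For \<open>N i\<close> serves the intersection of \<open>closed_pr S\<close> with the
  factor, read in \<open>G i\<close>. It is non-discrete by
  \<open>nondiscr_closed_pr_Int_factor\<close> and then cocompact by quasi
  just-non-compactness.\<close>

lemma irr1'_if_irreducible:
  assumes q: "\<forall>i\<in>I. quasi_just_non_compact (G i) (T i)" and irr: irreducible_projections
  shows "irr1' n G T \<Gamma>"
  unfolding irr1'_def I_eq[symmetric]
proof (intro allI impI)
  fix S assume S: "S \<subset> I"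
  have SI: "S \<subseteq> I" using S by blast
  define N where "N i = {x \<in> carrier (G i). emb i x \<in> closed_pr S \<inter> fac {i}}" for i
  have nd: "\<forall>i\<in>S. \<not> discr (closed_pr S \<inter> fac {i})"
    by (rule nondiscr_closed_pr_Int_factor[OF _ S]) (use irr in \<open>auto simp: irreducible_projections_def\<close>)
  have N: "N i \<lhd> G i \<and> closedin (T i) (N i) \<and> cocompact (G i) (T i) (N i) \<and> \<not> discretein (T i) (N i)"
    if i: "i \<in> S" for i
  proof -
    have iI: "i \<in> I" using i SI by blast
    interpret E: closed_embedding GG TT "G i" "T i" "emb i" "\<lambda>x. x i" by (rule closed_embedding_factor[OF iI])
    note C = closed_pr_Int_factor[OF SI i]
    note P = E.preimage[unfolded fac_single[OF iI], OF C(1) Int_lower2 C(2,3), folded N_def]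
    have "\<not> discretein (T i) (N i)" using P(4) nd i by blast
    then show ?thesis using P(1,2) q iI unfolding quasi_just_non_compact_def by blast
  qed
  have "(\<Pi>\<^sub>E i\<in>S. N i) \<subseteq> product_topology T S closure_of ((\<lambda>x. restrict x S) ` \<Gamma>)"
  proof
    fix y assume y: "y \<in> (\<Pi>\<^sub>E i\<in>S. N i)"
    have "finite S" using SI finite_I finite_subset by blast
    \<comment> \<open>The subgroup \<open>closed_pr S\<close> contains each coordinate of y
      separately, so y is assembled one coordinate at a time.\<close>
    have "A \<subseteq> S \<Longrightarrow> extend_one A y \<in> closed_pr S" if "finite A" for A
      using that
    proof (induction A)
      case empty
      have e: "extend_one {} y = \<one>\<^bsub>GG\<^esub>" by (simp add: extend_one_def)
      show ?case unfolding e by (rule subgroup.one_closed[OF closed_pr(1)])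
    next
      case (insert a A)
      then have a: "a \<in> S" "a \<in> I" using SI by auto
      have "emb a (y a) \<in> closed_pr S" using y a(1) unfolding N_def by auto
      then have "emb a (y a) \<otimes>\<^bsub>GG\<^esub> extend_one A y \<in> closed_pr S"
        using insert subgroup.m_closed[OF closed_pr(1)] by blast
      moreover have "emb a (y a) \<otimes>\<^bsub>GG\<^esub> extend_one A y = extend_one (insert a A) y"
      proof -
        have yc: "y i \<in> carrier (G i)" if "i \<in> insert a A" for i
          using y that insert.prems unfolding N_def by auto
        have r: "z \<otimes>\<^bsub>G i\<^esub> \<one>\<^bsub>G i\<^esub> = z" "\<one>\<^bsub>G i\<^esub> \<otimes>\<^bsub>G i\<^esub> z = z" if "i \<in> I" "z \<in> carrier (G i)" for i z
          using fam(1)[OF that(1)] that(2) by (simp_all add: group.is_monoid monoid.l_one monoid.r_one)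
        show ?thesis using insert.hyps(2) by (auto simp: emb_def extend_one_def r yc fam(3) intro!: restrict_ext)
      qed
      ultimately show ?case by simp
    qed
    then have "extend_one S y \<in> closed_pr S" using \<open>finite S\<close> by blast
    then have "restrict (extend_one S y) S \<in> product_topology T S closure_of ((\<lambda>x. restrict x S) ` \<Gamma>)"
      by (rule restrict_mem_closure[OF SI])
    moreover have e: "restrict (extend_one S y) S = y"
    proof
      fix i show "restrict (extend_one S y) S i = y i"
      proof (cases "i \<in> S")
        case True
        then show ?thesis using subsetD[OF SI True] by (simp add: extend_one_def)
      next
        case False
        then show ?thesis using PiE_arb[OF y False] by simp
      qed
    qed
    ultimately show "y \<in> product_topology T S closure_of ((\<lambda>x. restrict x S) ` \<Gamma>)" by (simp only: e)
  qed
  with N show "\<exists>N. (\<forall>i\<in>S. N i \<lhd> G i \<and> closedin (T i) (N i) \<and> cocompact (G i) (T i) (N i) \<and> \<not> discretein (T i) (N i)) \<and>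
      (\<Pi>\<^sub>E i\<in>S. N i) \<subseteq> product_topology T S closure_of ((\<lambda>x. restrict x S) ` \<Gamma>)" by blast
qed

text \<open>A discrete projection is closed, so it would contain the product of the
  \<open>N i\<close> and in particular a copy of one non-discrete \<open>N i\<close>.\<close>

lemma irreducible_if_irr1':
  assumes irr: "irr1' n G T \<Gamma>"
  shows irreducible_projections
  unfolding irreducible_projections_def
proof (intro allI impI notI, elim conjE)
  fix S assume S: "S \<subset> I" "S \<noteq> {}" and d: "discr (coord_pr I G S ` \<Gamma>)"
  obtain N where N: "\<forall>i\<in>S. N i \<lhd> G i \<and> \<not> discretein (T i) (N i)"
    "(\<Pi>\<^sub>E i\<in>S. N i) \<subseteq> product_topology T S closure_of ((\<lambda>x. restrict x S) ` \<Gamma>)"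
    using irr S(1) unfolding irr1'_def I_eq[symmetric] by meson
  obtain i where i: "i \<in> S" "i \<in> I" using S by blast
  have sP: "subgroup (coord_pr I G S ` \<Gamma>) GG" by (rule subgroup_pr_image[OF subgroup_\<Gamma>])
  have "extend_one S ` (product_topology T S closure_of ((\<lambda>x. restrict x S) ` \<Gamma>)) \<subseteq>
      TT closure_of (extend_one S ` (\<lambda>x. restrict x S) ` \<Gamma>)"
    by (rule continuous_map_image_closure_subset[OF extend_one_cont])
  also have "extend_one S ` (\<lambda>x. restrict x S) ` \<Gamma> = coord_pr I G S ` \<Gamma>"
    by (simp only: image_image extend_one_restrict)
  also have "TT closure_of (coord_pr I G S ` \<Gamma>) = coord_pr I G S ` \<Gamma>"
    by (rule closure_of_closedin[OF discr_subgroup_closedin[OF sP d]])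
  finally have eP: "extend_one S ` (\<Pi>\<^sub>E i\<in>S. N i) \<subseteq> coord_pr I G S ` \<Gamma>" using N(2) by blast
  have sN: "subgroup (N i) (G i)" using N(1) i normal_imp_subgroup by blast
  have "emb i ` N i \<subseteq> coord_pr I G S ` \<Gamma>"
  proof (rule image_subsetI)
    fix x assume x: "x \<in> N i"
    have one: "\<one>\<^bsub>G j\<^esub> \<in> N j" if "j \<in> S" for j
      using N(1) that normal_imp_subgroup subgroup.one_closed by blast
    let ?y = "\<lambda>j\<in>S. if j = i then x else \<one>\<^bsub>G j\<^esub>"
    have yN: "?y \<in> (\<Pi>\<^sub>E i\<in>S. N i)" using x one by auto
    have e: "emb i x = extend_one S ?y" using i by (auto simp: extend_one_def emb_def intro!: restrict_ext)
    show "emb i x \<in> coord_pr I G S ` \<Gamma>" unfolding e by (rule subsetD[OF eP imageI[OF yN]])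
  qed
  then have dN: "discr (emb i ` N i)" using discr_subset[OF d] by blast
  have hom: "group_hom (G i) GG (emb i)"
    by (intro group_hom.intro group_hom_axioms.intro fam(1)[OF i(2)] group_axioms emb_hom[OF i(2)])
  have "discretein TT (emb i ` N i)"
    using discr_iff_discretein[OF group_hom.subgroup_img_is_subgroup[OF hom sN]] dN by blast
  moreover have "N i \<subseteq> topspace (T i)" using subgroup.subset[OF sN] fam(2)[OF i(2)] by simp
  moreover have "inj_on (emb i) (N i)" by (rule inj_on_inverseI) (rule emb_apply[OF i(2)])
  ultimately have "discretein (T i) (N i)" using discretein_inj_preimage[OF emb_cont[OF i(2)]] by blast
  then show False using N(1) i(1) by blast
qed

lemma irreducible_if_irr4:
  assumes irr: "irr4 n G \<Gamma>"
  shows irreducible_projections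
  unfolding irreducible_projections_iff
proof (intro allI impI notI, elim conjE)
  fix P S assume PS: "P \<union> S = I" "P \<inter> S = {}" "P \<noteq> {}" "S \<noteq> {}" and fi: "finite_index_in (product_part P S)"
  note \<Lambda> = subgroup_product_part[OF PS(2)] and nt = product_parts_nontrivial[OF PS fi]
  let ?A = "GG\<lparr>carrier := fac P \<inter> \<Gamma>\<rparr>" and ?B = "GG\<lparr>carrier := fac S \<inter> \<Gamma>\<rparr>"
  have g: "group ?A" "group ?B" by (rule subgroup_imp_group[OF fac_Int_\<Gamma>(1)])+
  have t: "\<not> trivial_group ?A" "\<not> trivial_group ?B" using nt unfolding trivial_group_def by auto
  have "?A \<times>\<times> ?B \<cong> GG\<lparr>carrier := product_part P S\<rparr>"
    using product_part_iso[OF PS(2)] unfolding is_iso_def by blast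
  then have "GG\<lparr>carrier := product_part P S\<rparr> \<cong> ?A \<times>\<times> ?B"
    by (rule group.iso_sym[OF DirProd_group[OF g]])
  moreover have "subgroup (product_part P S) (GG\<lparr>carrier := \<Gamma>\<rparr>)"
    by (rule subgroup_incl[OF \<Lambda>(1) subgroup_\<Gamma> \<Lambda>(2)])
  ultimately have "\<not> finite_index (GG\<lparr>carrier := \<Gamma>\<rparr>) (product_part P S)"
    using irr g t unfolding irr4_def I_eq by blast
  then show False using finite_index_in_iff[OF \<Lambda>] fi by simp
qed

text \<open>The preimage \<open>H\<close> of \<open>X\<close> in \<open>G i\<close> is closed of
  finite index, hence open, so the hypothesis on finite index open subgroups applies to it; the
  embedding carries the conclusion back to \<open>X\<close>.\<close>

lemma jnc_finite_index:
  assumes hj: "\<forall>H. subgroup H (G i) \<and> openin (T i) H \<and> finite_index (G i) H \<longrightarrow>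
      just_non_compact (G i\<lparr>carrier := H\<rparr>) (subtopology (T i) H)"
    and i: "i \<in> I" and X: "subgroup X GG" "X \<subseteq> fac {i}" "closedin TT X"
    and F: "\<exists>F. finite F \<and> F \<subseteq> fac {i} \<and> (\<forall>x\<in>fac {i}. \<exists>f\<in>F. x \<otimes>\<^bsub>GG\<^esub> inv\<^bsub>GG\<^esub> f \<in> X)"
  shows "jnc X"
proof -
  interpret F: tdlc_group "G i" "T i" by (rule tdlc[OF i])
  interpret E: closed_embedding GG TT "G i" "T i" "emb i" "\<lambda>x. x i" by (rule closed_embedding_factor[OF i])
  interpret h: group_hom "G i" GG "emb i"
    by (intro group_hom.intro group_hom_axioms.intro F.group_axioms group_axioms emb_hom[OF i])
  define H where "H = {x \<in> carrier (G i). emb i x \<in> X}"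
  have sH: "subgroup H (G i)"
  proof
    show "H \<subseteq> carrier (G i)" by (auto simp: H_def)
    show "\<one>\<^bsub>G i\<^esub> \<in> H" using subgroup.one_closed[OF X(1)] h.hom_one unfolding H_def by simp
    fix x assume x: "x \<in> H"
    show "inv\<^bsub>G i\<^esub> x \<in> H" using x subgroup.m_inv_closed[OF X(1)] h.hom_inv unfolding H_def by simp
    fix y assume y: "y \<in> H"
    show "x \<otimes>\<^bsub>G i\<^esub> y \<in> H" using x y subgroup.m_closed[OF X(1)] h.hom_mult unfolding H_def by simp
  qed
  have cH: "closedin (T i) H"
    using closedin_continuous_map_preimage[OF emb_cont[OF i] X(3)] unfolding H_def fam(2)[OF i] .
  obtain F0 where F0: "finite F0" "F0 \<subseteq> fac {i}" "\<And>x. x \<in> fac {i} \<Longrightarrow> \<exists>f\<in>F0. x \<otimes>\<^bsub>GG\<^esub> inv\<^bsub>GG\<^esub> f \<in> X"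
    using F by blast
  have F1: "F0 \<subseteq> emb i ` carrier (G i)" using F0(2) unfolding fac_single[OF i] .
  obtain F' where F': "F' \<subseteq> carrier (G i)" "finite F'" "F0 = emb i ` F'"
    using finite_subset_image[OF F0(1) F1] by blast
  have cov: "\<exists>f\<in>F'. x \<otimes>\<^bsub>G i\<^esub> inv\<^bsub>G i\<^esub> f \<in> H" if x: "x \<in> carrier (G i)" for x
  proof -
    obtain f where f: "f \<in> F'" "emb i x \<otimes>\<^bsub>GG\<^esub> inv\<^bsub>GG\<^esub> (emb i f) \<in> X"
      using F0(3)[OF emb_in_fac[OF i x]] unfolding F'(3) by blast
    have fG: "f \<in> carrier (G i)" using f F' by blast
    have "emb i (x \<otimes>\<^bsub>G i\<^esub> inv\<^bsub>G i\<^esub> f) = emb i x \<otimes>\<^bsub>GG\<^esub> inv\<^bsub>GG\<^esub> (emb i f)"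
      using h.hom_mult[OF x F.inv_closed[OF fG]] h.hom_inv[OF fG] by simp
    then have "emb i (x \<otimes>\<^bsub>G i\<^esub> inv\<^bsub>G i\<^esub> f) \<in> X" using f(2) by simp
    then have "x \<otimes>\<^bsub>G i\<^esub> inv\<^bsub>G i\<^esub> f \<in> H" unfolding H_def using x fG by simp
    then show ?thesis using f(1) by blast
  qed
  have oH: "openin (T i) H" by (rule F.closed_finite_index_openin[OF sH cH F'(2,1) cov])
  have HG: "H \<subseteq> carrier (G i)" using sH subgroup.subset by blast
  have "finite_index (G i) H"
    using F.finite_index_iff[OF F.subgroup_self sH HG] F'(1,2) cov by auto
  then have j: "just_non_compact (G i\<lparr>carrier := H\<rparr>) (subtopology (T i) H)" using hj sH oH by blast
  then have lc: "locally_compact_group (G i\<lparr>carrier := H\<rparr>) (subtopology (T i) H)"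
    unfolding just_non_compact_def by blast
  note C = closed_embedding_subgroup[OF i X(2,3) H_def lc]
  show "jnc X" using closed_embedding.jnc_image[OF C(1) j] C(2) by simp
qed

text \<open>One factor suffices: by injectivity the direct factors of \<open>\<Lambda>\<close>
  project to commuting non-trivial subgroups there.\<close>

lemma irr4_if_irr2:
  assumes i: "i \<in> I"
    and hj: "\<forall>H. subgroup H (G i) \<and> openin (T i) H \<and> finite_index (G i) H \<longrightarrow>
      just_non_compact (G i\<lparr>carrier := H\<rparr>) (subtopology (T i) H)"
    and irr: "irr2 n \<Gamma>"
  shows "irr4 n G \<Gamma>"
  unfolding irr4_def I_eq[symmetric]
proof (intro allI impI notI, elim conjE exE)
  fix \<Lambda> and A B :: "(nat \<Rightarrow> 'a) monoid"
  assume s: "subgroup \<Lambda> (GG\<lparr>carrier := \<Gamma>\<rparr>)" and fi: "finite_index (GG\<lparr>carrier := \<Gamma>\<rparr>) \<Lambda>"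
    and AB: "group A" "group B" "\<not> trivial_group A" "\<not> trivial_group B"
    and iso: "GG\<lparr>carrier := \<Lambda>\<rparr> \<cong> A \<times>\<times> B"
  have \<Lambda>: "subgroup \<Lambda> GG" by (rule incl_subgroup[OF subgroup_\<Gamma> s])
  have \<Lambda>\<Gamma>: "\<Lambda> \<subseteq> \<Gamma>" using subgroup.subset[OF s] by simp
  have fi': "finite_index_in \<Lambda>" using finite_index_in_iff[OF \<Lambda> \<Lambda>\<Gamma>] fi by simp
  obtain A' B' where A': "subgroup A' GG" "A' \<subseteq> \<Lambda>" "normalizes \<Lambda> A'" "\<not> A' \<subseteq> {\<one>\<^bsub>GG\<^esub>}"
    and B': "subgroup B' GG" "B' \<subseteq> \<Lambda>" "normalizes \<Lambda> B'" "\<not> B' \<subseteq> {\<one>\<^bsub>GG\<^esub>}"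
    and c: "\<forall>a\<in>A'. \<forall>b\<in>B'. a \<otimes>\<^bsub>GG\<^esub> b = b \<otimes>\<^bsub>GG\<^esub> a"
    by (rule direct_product_commuting_normal_subgroups[OF \<Lambda> AB iso])
  show False
  proof (rule no_commuting_normal_subgroups[OF i _ _ \<Lambda> \<Lambda>\<Gamma> fi' A' B'])
    show "jnc X" if "subgroup X GG" "X \<subseteq> fac {i}" "closedin TT X"
      "\<exists>F. finite F \<and> F \<subseteq> fac {i} \<and> (\<forall>x\<in>fac {i}. \<exists>f\<in>F. x \<otimes>\<^bsub>GG\<^esub> inv\<^bsub>GG\<^esub> f \<in> X)" for X
      by (rule jnc_finite_index[OF hj i that])
    show "g = \<one>\<^bsub>GG\<^esub>" if "g \<in> \<Gamma>" "coord_pr I G {i} g = \<one>\<^bsub>GG\<^esub>" for g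
      using irr i that unfolding irr2_iff inj_on_pr_iff by blast
    show "a \<otimes>\<^bsub>GG\<^esub> b = b \<otimes>\<^bsub>GG\<^esub> a" if "a \<in> A'" "b \<in> B'" for a b using c that by blast
  qed
qed

end

lemma lattice_familyI:
  fixes G :: "nat \<Rightarrow> 'a monoid"
  assumes "tdlc_family I G T"
    and nd: "\<And>i. i \<in> I \<Longrightarrow> \<not> discretein (T i) (carrier (G i))"
    and cg: "\<And>i. i \<in> I \<Longrightarrow> compactly_generated (G i) (T i)"
    and \<Gamma>: "cocompact_lattice (product_group I G) (product_topology T I) \<Gamma>"
    and dense: "\<And>i. i \<in> I \<Longrightarrow> T i closure_of ((\<lambda>x. x i) ` \<Gamma>) = carrier (G i)"
    and q: "\<And>i. i \<in> I \<Longrightarrow> quasi_just_non_compact (G i) (T i)"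
    and I: "I = {1..n}"
  shows "lattice_family I G T \<Gamma> n"
proof -
  interpret tdlc_family I G T by fact
  have s: "subgroup \<Gamma> GG" and d: "discretein TT \<Gamma>" and cc: "cocompact GG TT \<Gamma>"
    using \<Gamma> unfolding cocompact_lattice_def lattice_subgroup_def by auto
  have \<Gamma>G: "\<Gamma> \<subseteq> carrier GG" using s subgroup.subset by blast
  have "product_lattice_axioms GG TT I (coord_pr I G) \<Gamma>"
  proof (rule product_lattice_axioms.intro)
    show "subgroup \<Gamma> GG" by (rule s)
    show "discr \<Gamma>" using discr_iff_discretein[OF s] d by blast
    show "cocompact_in \<Gamma> (carrier GG)" by (rule cocompact_imp_cocompact_in[OF s cc])
    fix j assume j: "j \<in> I"
    interpret E: closed_embedding GG TT "G j" "T j" "emb j" "\<lambda>x. x j" by (rule closed_embedding_factor[OF j])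
    have hom: "group_hom (G j) GG (emb j)"
      by (intro group_hom.intro group_hom_axioms.intro fam(1)[OF j] group_axioms emb_hom[OF j])
    have im: "emb j ` (\<lambda>x. x j) ` \<Gamma> = coord_pr I G {j} ` \<Gamma>"
      unfolding image_image by (rule image_cong) (simp_all add: coord_pr_single)
    show "cl (coord_pr I G {j} ` \<Gamma>) = fac {j}"
    proof
      show "cl (coord_pr I G {j} ` \<Gamma>) \<subseteq> fac {j}"
        by (rule closure_of_minimal[OF pr_image_fac[OF \<Gamma>G] closedin_fac])
      have "emb j ` (T j closure_of ((\<lambda>x. x j) ` \<Gamma>)) \<subseteq> TT closure_of (emb j ` (\<lambda>x. x j) ` \<Gamma>)"
        by (rule continuous_map_image_closure_subset[OF emb_cont[OF j]])
      then show "fac {j} \<subseteq> cl (coord_pr I G {j} ` \<Gamma>)"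
        unfolding im dense[OF j] fac_single[OF j] .
    qed
    show "\<exists>C. compactin TT C \<and> fac {j} = generate GG C"
    proof -
      obtain C where C: "compactin (T j) C" "generate (G j) C = carrier (G j)"
        using cg[OF j] unfolding compactly_generated_def by blast
      have CG: "C \<subseteq> carrier (G j)" using compactin_subset_topspace[OF C(1)] fam(2)[OF j] by simp
      have "generate GG (emb j ` C) = emb j ` carrier (G j)"
        using group_hom.generate_img[OF hom CG] C(2) by simp
      then show ?thesis
        using image_compactin[OF C(1) emb_cont[OF j]] unfolding fac_single[OF j] by blast
    qed
    show "qjnc (fac {j})" using E.qjnc_image[OF q[OF j]] unfolding fac_single[OF j] .
    show "\<not> discr (fac {j})"
    proof
      assume "discr (fac {j})"
      then have "discretein TT (emb j ` carrier (G j))"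
        unfolding fac_single[OF j] using discr_iff_discretein[OF subgroup_fac] by blast
      moreover have "carrier (G j) \<subseteq> topspace (T j)" using fam(2)[OF j] by simp
      moreover have "inj_on (emb j) (carrier (G j))" by (rule inj_on_inverseI) (rule emb_apply[OF j])
      ultimately show False using discretein_inj_preimage[OF emb_cont[OF j]] nd[OF j] by blast
    qed
  qed
  then show ?thesis
    using I by (intro lattice_family.intro product_lattice.intro lattice_family_axioms.intro
        tdlc_family_axioms tdlc_product_axioms)
qed

lemma just_non_compact_imp_quasi:
  assumes "just_non_compact G T"
  shows "quasi_just_non_compact G T"
proof -
  interpret locally_compact_group G T using assms unfolding just_non_compact_def by blast
  have "discretein T {\<one>\<^bsub>G\<^esub>}"
  proof -
    have "discr {\<one>\<^bsub>G\<^esub>}" unfolding discr_def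
      using openin_topspace[of T] by (intro exI[of _ "carrier G"]) auto
    then show ?thesis using discr_iff_discretein[OF triv_subgroup] by blast
  qed
  then show ?thesis using assms unfolding just_non_compact_def quasi_just_non_compact_def by blast
qed

theorem theorem8:
  fixes n :: nat
    and G :: "nat \<Rightarrow> 'a monoid"
    and T :: "nat \<Rightarrow> 'a topology"
    and \<Gamma> :: "(nat \<Rightarrow> 'a) set"
  assumes "n \<ge> 1"
    and "\<And>i. i \<in> {1..n} \<Longrightarrow> tdlc_group (G i) (T i)"
    and "\<And>i. i \<in> {1..n} \<Longrightarrow> \<not> discretein (T i) (carrier (G i))"
    and "\<And>i. i \<in> {1..n} \<Longrightarrow> compactly_generated (G i) (T i)"
    and "cocompact_lattice (product_group {1..n} G) (product_topology T {1..n}) \<Gamma>"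
    and "\<And>i. i \<in> {1..n} \<Longrightarrow> T i closure_of ((\<lambda>x. x i) ` \<Gamma>) = carrier (G i)"
  shows
    "((\<forall>i\<in>{1..n}. quasi_just_non_compact (G i) (T i)) \<longrightarrow>
        (irr2 n \<Gamma> \<longrightarrow> irr0 n G \<Gamma>) \<and>
        (irr0 n G \<Gamma> \<longleftrightarrow> irr1' n G T \<Gamma>) \<and>
        (irr1' n G T \<Gamma> \<longleftrightarrow> irr3 n T \<Gamma>) \<and>
        (irr4 n G \<Gamma> \<longrightarrow> irr3 n T \<Gamma>)) \<and>
     ((\<forall>i\<in>{1..n}. just_non_compact (G i) (T i)) \<longrightarrow>
        (irr0 n G \<Gamma> \<longleftrightarrow> irr1' n G T \<Gamma>) \<and>
        (irr1' n G T \<Gamma> \<longleftrightarrow> irr2 n \<Gamma>) \<and>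
        (irr2 n \<Gamma> \<longleftrightarrow> irr3 n T \<Gamma>) \<and>
        (irr4 n G \<Gamma> \<longrightarrow> irr3 n T \<Gamma>)) \<and>
     ((\<forall>i\<in>{1..n}. \<forall>H. subgroup H (G i) \<and> openin (T i) H \<and> finite_index (G i) H \<longrightarrow>
          just_non_compact (G i\<lparr>carrier := H\<rparr>) (subtopology (T i) H)) \<longrightarrow>
        (irr0 n G \<Gamma> \<longleftrightarrow> irr1' n G T \<Gamma>) \<and>
        (irr1' n G T \<Gamma> \<longleftrightarrow> irr2 n \<Gamma>) \<and>
        (irr2 n \<Gamma> \<longleftrightarrow> irr3 n T \<Gamma>) \<and>
        (irr3 n T \<Gamma> \<longleftrightarrow> irr4 n G \<Gamma>))"
proof -
  have fam: "tdlc_family {1..n} G T"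
    by (intro tdlc_family.intro assms(2)) simp
  have fl: "lattice_family {1..n} G T \<Gamma> n" if "\<forall>i\<in>{1..n}. quasi_just_non_compact (G i) (T i)"
    using that by (intro lattice_familyI[OF fam assms(3,4,5,6)]) auto
  have part1: "(irr2 n \<Gamma> \<longrightarrow> irr0 n G \<Gamma>) \<and> (irr0 n G \<Gamma> \<longleftrightarrow> irr1' n G T \<Gamma>) \<and>
      (irr1' n G T \<Gamma> \<longleftrightarrow> irr3 n T \<Gamma>) \<and> (irr4 n G \<Gamma> \<longrightarrow> irr3 n T \<Gamma>)"
    if q: "\<forall>i\<in>{1..n}. quasi_just_non_compact (G i) (T i)"
  proof -
    interpret L: lattice_family "{1..n}" G T \<Gamma> n by (rule fl[OF q])
    have "irr2 n \<Gamma> \<longrightarrow> L.irreducible_projections"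
      unfolding L.irr2_iff using L.irreducible_if_injective by blast
    then show ?thesis
      unfolding L.irr0_iff L.irr3_iff
      using L.irr1'_if_irreducible[OF q] L.irreducible_if_irr1' L.irreducible_if_irr4 by blast
  qed
  \<comment> \<open>Under the hypothesis of (ii) this is the only implication that
    \<open>part1\<close> does not give.\<close>
  have part2: "irr3 n T \<Gamma> \<longrightarrow> irr2 n \<Gamma>" if j: "\<forall>i\<in>{1..n}. just_non_compact (G i) (T i)"
  proof
    assume irr3: "irr3 n T \<Gamma>"
    interpret L: lattice_family "{1..n}" G T \<Gamma> n
      using j by (intro fl ballI just_non_compact_imp_quasi) blast
    have jf: "L.jnc (L.fac {i})" if "i \<in> {1..n}" for i
      using closed_embedding.jnc_image[OF L.closed_embedding_factor[OF that]] j that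
      unfolding L.fac_single[OF that] by blast
    show "irr2 n \<Gamma>"
      unfolding L.irr2_iff using L.injective_if_irreducible[OF jf] irr3 unfolding L.irr3_iff by blast
  qed
  \<comment> \<open>A group is a finite index open subgroup of itself, so the hypothesis of (iii)
    contains that of (ii).\<close>
  have j_if_f: "just_non_compact (G i) (T i)"
    if i: "i \<in> {1..n}" and f: "\<forall>H. subgroup H (G i) \<and> openin (T i) H \<and> finite_index (G i) H \<longrightarrow>
          just_non_compact (G i\<lparr>carrier := H\<rparr>) (subtopology (T i) H)" for i
  proof -
    interpret F: tdlc_group "G i" "T i" by (rule assms(2)[OF i])
    have "finite_index (G i) (carrier (G i))"
      using F.finite_index_iff[OF F.subgroup_self F.subgroup_self order_refl]
      by (auto intro!: exI[of _ "{\<one>\<^bsub>G i\<^esub>}"])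
    moreover have "openin (T i) (carrier (G i))" using openin_topspace[of "T i"] by simp
    ultimately have "just_non_compact (G i\<lparr>carrier := carrier (G i)\<rparr>) (subtopology (T i) (carrier (G i)))"
      using f F.subgroup_self by blast
    moreover have "subtopology (T i) (carrier (G i)) = T i"
      using subtopology_topspace[of "T i"] by simp
    ultimately show ?thesis by simp
  qed
  have part3: "irr2 n \<Gamma> \<longrightarrow> irr4 n G \<Gamma>"
    if f: "\<forall>i\<in>{1..n}. \<forall>H. subgroup H (G i) \<and> openin (T i) H \<and> finite_index (G i) H \<longrightarrow>
          just_non_compact (G i\<lparr>carrier := H\<rparr>) (subtopology (T i) H)"
  proof -
    interpret L: lattice_family "{1..n}" G T \<Gamma> n
      using f by (intro fl ballI just_non_compact_imp_quasi j_if_f) blast+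
    \<comment> \<open>\<open>irr4_if_irr2\<close> works in a single factor, and n \<ge> 1 provides
      one.\<close>
    have "1 \<in> {1..n}" using assms(1) by simp
    then show ?thesis using L.irr4_if_irr2 f by blast
  qed
  have jq: "\<forall>i\<in>{1..n}. quasi_just_non_compact (G i) (T i)" if "\<forall>i\<in>{1..n}. just_non_compact (G i) (T i)"
    using that just_non_compact_imp_quasi by blast
  show ?thesis
    using part1 part1[OF jq] part2 part3 j_if_f by (intro conjI impI) blast+
qed

end
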